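(* Let $N$ be a finitely generated free abelian group and $\Sigma$ a fan in $N$ whose cones span a full rank sublattice of $N$. Let $K/k$ be a finite cyclic Galois extension with Galois group $\mathcal{G}$ such that $\mathrm{Ext}^1_{\mathbb{Z}}(\mathrm{C}\ell(\Sigma),K^\times)=0$. Then for any homomorphism $\varphi\colon\mathcal{G}\to\mathrm{Aut}_\Sigma$, $$H^1(K/k,{}_\varphi\mathscr{T})\;\cong\;\frac{G_{\Sigma,\varphi}(k)\cap\mathrm{Im}\,\mathscr{N}_{\mathbb{G}^{\Sigma(1)}_{m,\varphi}}}{\mathrm{Im}\,\mathscr{N}_{G_{\Sigma,\varphi}}}.$$
   Context: $M=\mathrm{Hom}(N,\mathbb{Z})$. $\Sigma(1)$ is the set of rays of $\Sigma$, with $v_\rho\in N$ the primitive generator of $\rho\in\Sigma(1)$. The class group $\mathrm{C}\ell(\Sigma)$ is the cokernel of the injection $M\to\mathbb{Z}^{\Sigma(1)}$, $u\mapsto(u(v_\rho))_\rho$. $\mathrm{Aut}_\Sigma$ is the group of automorphisms of $N$ preserving $\Sigma$; it acts on $\Sigma(1)$ by permutations, hence compatibly on $M$, $\mathbb{Z}^{\Sigma(1)}$ and $\mathrm{C}\ell(\Sigma)$. Under the Ext hypothesis there is an exact sequence $$1\to G_\Sigma(K)\to\mathbb{G}_m^{\Sigma(1)}(K)\to\mathbb{T}_N(K)\to1,$$ where $G_\Sigma(K)=\mathrm{Hom}(\mathrm{C}\ell(\Sigma),K^\times)$, $\mathbb{G}_m^{\Sigma(1)}(K)=\mathrm{Hom}(\mathbb{Z}^{\Sigma(1)},K^\times)$,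 $\mathbb{T}_N(K)=\mathrm{Hom}(M,K^\times)=N\otimes K^\times$. For $\varphi\colon\mathcal{G}\to\mathrm{Aut}_\Sigma$, the groups with subscript $\varphi$, $G_{\Sigma,\varphi}$, $\mathbb{G}^{\Sigma(1)}_{m,\varphi}$, ${}_\varphi\mathscr{T}$, have the same $K$-points but with the twisted $\mathcal{G}$-action in which $g\in\mathcal{G}$ acts simultaneously through $\varphi_g$ on the lattice and through the Galois action on $K^\times$ (e.g. $g(n\otimes\lambda)=\varphi_g(n)\otimes g(\lambda)$ on ${}_\varphi\mathscr{T}(K)=N\otimes K^\times$); the sequence is $\mathcal{G}$-equivariant for the twisted actions, and $k$-points are the $\mathcal{G}$-invariants of the twisted action. $G_{\Sigma,\varphi}(k)$ is regarded as a subgroup of $\mathbb{G}^{\Sigma(1)}_{m,\varphi}(k)$. For such a group $T$, the norm $\mathscr{N}_T\colon T(K)\to T(k)$ is $\lambda\mapsto\prod_{g\in\mathcal{G}}{}^g\lambda$ (twisted action). $H^1(K/k,{}_\varphi\mathscr{T})=H^1(\mathcal{G},{}_\varphi\mathscr{T}(K))$. *)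

theory Defs
  imports "HOL-Analysis.Polytope" "HOL-Algebra.Algebra"
begin

section \<open>Lattices and fans\<close>

text \<open>A finitely generated free abelian group \<open>N\<close> is given inside the real vector space
  \<open>N\<^sub>\<real> = N \<otimes> \<real>\<close>, which is the whole type \<open>'v\<close>: a \<open>\<int>\<close>-basis of \<open>N\<close> is an \<open>\<real>\<close>-basis of \<open>'v\<close>.
  Rank 0 is not excluded.\<close>

definition int_span :: "'v::real_vector set \<Rightarrow> 'v set" where
  "int_span S = {(\<Sum>b\<in>T. of_int (c b) *\<^sub>R b) | T c. finite T \<and> T \<subseteq> S}"

definition full_lattice :: "'v::real_vector set \<Rightarrow> bool" where
  "full_lattice N \<longleftrightarrow>
     (\<exists>B. finite B \<and> independent B \<and> span B = UNIV \<and> N = int_span B)"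

definition add_group :: "'v::real_vector set \<Rightarrow> 'v monoid" where
  "add_group N = \<lparr>carrier = N, monoid.mult = (+), one = 0\<rparr>"

definition rational_polyhedral_cone :: "'v::real_vector set \<Rightarrow> 'v set \<Rightarrow> bool" where
  "rational_polyhedral_cone N \<sigma> \<longleftrightarrow>
     (\<exists>S. finite S \<and> S \<subseteq> N \<and> \<sigma> = convex_cone hull S)"

definition strongly_convex :: "'v::real_vector set \<Rightarrow> bool" where
  "strongly_convex \<sigma> \<longleftrightarrow> \<sigma> \<inter> uminus ` \<sigma> = {0}"

text \<open>The predicate \<open>face_of\<close> admits the empty set as a face; the faces of a cone in the sense of
  toric geometry are the nonempty ones.\<close>

definition fan :: "'v::real_vector set \<Rightarrow> 'v set set \<Rightarrow> bool" where
  "fan N \<Sigma> \<longleftrightarrow> finite \<Sigma> \<and>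
     (\<forall>\<sigma>\<in>\<Sigma>. rational_polyhedral_cone N \<sigma> \<and> strongly_convex \<sigma>) \<and>
     (\<forall>\<sigma>\<in>\<Sigma>. \<forall>\<tau>. \<tau> face_of \<sigma> \<and> \<tau> \<noteq> {} \<longrightarrow> \<tau> \<in> \<Sigma>) \<and>
     (\<forall>\<sigma>\<in>\<Sigma>. \<forall>\<tau>\<in>\<Sigma>. (\<sigma> \<inter> \<tau>) face_of \<sigma> \<and> (\<sigma> \<inter> \<tau>) face_of \<tau>)"

text \<open>The sublattice spanned by the cones is the one generated by their lattice points.  The rank of
  a subgroup of a full lattice is the dimension of its real span.\<close>

definition spans_full_rank :: "'v::real_vector set \<Rightarrow> 'v set set \<Rightarrow> bool" where
  "spans_full_rank N \<Sigma> \<longleftrightarrow> dim (int_span (N \<inter> \<Union>\<Sigma>)) = dim N"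

definition rays :: "'v::real_vector set set \<Rightarrow> 'v set set" where
  "rays \<Sigma> = {\<rho> \<in> \<Sigma>. dim \<rho> = 1}"

definition primitive :: "'v::real_vector set \<Rightarrow> 'v \<Rightarrow> bool" where
  "primitive N v \<longleftrightarrow> v \<in> N \<and> v \<noteq> 0 \<and>
     (\<forall>w\<in>N. \<forall>m::int. v = of_int m *\<^sub>R w \<longrightarrow> \<bar>m\<bar> = 1)"

definition ray_gen :: "'v::real_vector set \<Rightarrow> 'v set \<Rightarrow> 'v" where
  "ray_gen N \<rho> = (THE v. primitive N v \<and> \<rho> = convex_cone hull {v})"

text \<open>An automorphism of \<open>N\<close> is recorded as its \<open>\<real>\<close>-linear extension to \<open>N\<^sub>\<real>\<close>.\<close>

definition fan_aut :: "'v::real_vector set \<Rightarrow> 'v set set \<Rightarrow> ('v \<Rightarrow> 'v) monoid" where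
  "fan_aut N \<Sigma> =
     \<lparr>carrier = {f. linear f \<and> bij f \<and> f ` N = N \<and> (\<lambda>\<sigma>. f ` \<sigma>) ` \<Sigma> = \<Sigma>},
      monoid.mult = (\<circ>), one = id\<rparr>"


section \<open>Hom, Ext and first cohomology\<close>

definition hom_grp ::
    "('a, 'm) monoid_scheme \<Rightarrow> ('b, 'n) monoid_scheme \<Rightarrow> ('a \<Rightarrow> 'b) monoid" where
  "hom_grp A B =
     \<lparr>carrier = hom A B \<inter> extensional (carrier A),
      monoid.mult = (\<lambda>f g. \<lambda>x\<in>carrier A. f x \<otimes>\<^bsub>B\<^esub> g x),
      one = (\<lambda>x\<in>carrier A. \<one>\<^bsub>B\<^esub>)\<rparr>"

text \<open>\<open>Ext\<^sup>1\<^sub>\<int>(A,B)\<close> is computed from the free resolution \<open>0 \<rightarrow> R \<rightarrow> \<int>[A] \<rightarrow> A \<rightarrow> 0\<close>, where \<open>\<int>[A]\<close> is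
  the free abelian group on the underlying set of \<open>A\<close>: it is the cokernel of
  \<open>Hom(\<int>[A],B) \<rightarrow> Hom(R,B)\<close>.\<close>

definition free_eval :: "('a, 'm) monoid_scheme \<Rightarrow> ('a \<Rightarrow>\<^sub>0 int) \<Rightarrow> 'a" where
  "free_eval A x = (\<Otimes>\<^bsub>A\<^esub>a\<in>Poly_Mapping.keys x. a [^]\<^bsub>A\<^esub> Poly_Mapping.lookup x a)"

definition free_rels :: "('a, 'm) monoid_scheme \<Rightarrow> ('a \<Rightarrow>\<^sub>0 int) monoid" where
  "free_rels A = (free_Abelian_group (carrier A))
     \<lparr>carrier := kernel (free_Abelian_group (carrier A)) A (free_eval A)\<rparr>"

definition Ext1 ::
    "('a, 'm) monoid_scheme \<Rightarrow> ('b, 'n) monoid_scheme \<Rightarrow> (('a \<Rightarrow>\<^sub>0 int) \<Rightarrow> 'b) set monoid" where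
  "Ext1 A B = hom_grp (free_rels A) B Mod
     ((\<lambda>f. restrict f (carrier (free_rels A))) `
        carrier (hom_grp (free_Abelian_group (carrier A)) B))"

definition invariants ::
    "('g, 'm) monoid_scheme \<Rightarrow> ('a, 'n) monoid_scheme \<Rightarrow> ('g \<Rightarrow> 'a \<Rightarrow> 'a) \<Rightarrow> 'a set" where
  "invariants \<G> A act = {x \<in> carrier A. \<forall>g\<in>carrier \<G>. act g x = x}"

definition norm_map ::
    "('g, 'm) monoid_scheme \<Rightarrow> ('a, 'n) monoid_scheme \<Rightarrow> ('g \<Rightarrow> 'a \<Rightarrow> 'a) \<Rightarrow> 'a \<Rightarrow> 'a" where
  "norm_map \<G> A act x = (\<Otimes>\<^bsub>A\<^esub>g\<in>carrier \<G>. act g x)"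

definition cocycles1 ::
    "('g, 'm) monoid_scheme \<Rightarrow> ('a, 'n) monoid_scheme \<Rightarrow> ('g \<Rightarrow> 'a \<Rightarrow> 'a) \<Rightarrow> ('g \<Rightarrow> 'a) set" where
  "cocycles1 \<G> A act = {c \<in> carrier \<G> \<rightarrow>\<^sub>E carrier A.
     \<forall>g\<in>carrier \<G>. \<forall>h\<in>carrier \<G>. c (g \<otimes>\<^bsub>\<G>\<^esub> h) = c g \<otimes>\<^bsub>A\<^esub> act g (c h)}"

definition coboundaries1 ::
    "('g, 'm) monoid_scheme \<Rightarrow> ('a, 'n) monoid_scheme \<Rightarrow> ('g \<Rightarrow> 'a \<Rightarrow> 'a) \<Rightarrow> ('g \<Rightarrow> 'a) set" where
  "coboundaries1 \<G> A act =
     (\<lambda>a. \<lambda>g\<in>carrier \<G>. act g a \<otimes>\<^bsub>A\<^esub> inv\<^bsub>A\<^esub> a) ` carrier A"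

definition H1 ::
    "('g, 'm) monoid_scheme \<Rightarrow> ('a, 'n) monoid_scheme \<Rightarrow> ('g \<Rightarrow> 'a \<Rightarrow> 'a) \<Rightarrow> ('g \<Rightarrow> 'a) set monoid"
  where
  "H1 \<G> A act = (product_group (carrier \<G>) (\<lambda>_. A))\<lparr>carrier := cocycles1 \<G> A act\<rparr>
     Mod coboundaries1 \<G> A act"


section \<open>Galois extensions\<close>

definition Gal :: "('k, 'm) ring_scheme \<Rightarrow> 'k set \<Rightarrow> ('k \<Rightarrow> 'k) monoid" where
  "Gal K k = (BijGroup (carrier K))
     \<lparr>carrier := {g \<in> ring_iso K K \<inter> extensional (carrier K). \<forall>x\<in>k. g x = x}\<rparr>"

definition finite_galois :: "('k, 'm) ring_scheme \<Rightarrow> 'k set \<Rightarrow> bool" where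
  "finite_galois K k \<longleftrightarrow> field K \<and> subfield k K \<and> ring.finite_dimension K k (carrier K) \<and>
     {x \<in> carrier K. \<forall>g\<in>carrier (Gal K k). g x = x} = k"


section \<open>The class group and the three groups of multiplicative type\<close>

definition char_lattice :: "'v::real_vector set \<Rightarrow> ('v \<Rightarrow> int) monoid" where
  "char_lattice N = hom_grp (add_group N) integer_group"

definition ray_lattice :: "'v::real_vector set set \<Rightarrow> ('v set \<Rightarrow> int) monoid" where
  "ray_lattice \<Sigma> = product_group (rays \<Sigma>) (\<lambda>_. integer_group)"

definition char_to_ray ::
    "'v::real_vector set \<Rightarrow> 'v set set \<Rightarrow> ('v \<Rightarrow> int) \<Rightarrow> ('v set \<Rightarrow> int)" where
  "char_to_ray N \<Sigma> u = (\<lambda>\<rho>\<in>rays \<Sigma>. u (ray_gen N \<rho>))"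

definition principal :: "'v::real_vector set \<Rightarrow> 'v set set \<Rightarrow> ('v set \<Rightarrow> int) set" where
  "principal N \<Sigma> = char_to_ray N \<Sigma> ` carrier (char_lattice N)"

definition class_group :: "'v::real_vector set \<Rightarrow> 'v set set \<Rightarrow> ('v set \<Rightarrow> int) set monoid" where
  "class_group N \<Sigma> = ray_lattice \<Sigma> Mod principal N \<Sigma>"

definition ray_class :: "'v::real_vector set \<Rightarrow> 'v set set \<Rightarrow> ('v set \<Rightarrow> int) \<Rightarrow> ('v set \<Rightarrow> int) set"
  where "ray_class N \<Sigma> a = r_coset (ray_lattice \<Sigma>) (principal N \<Sigma>) a"

text \<open>Actions of \<open>f \<in> Aut\<^sub>\<Sigma>\<close>: \<open>(f\<cdot>u)(n) = u(f\<^sup>-\<^sup>1 n)\<close> on \<open>M\<close>,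
  \<open>(f\<cdot>a)(\<rho>) = a(f\<^sup>-\<^sup>1 \<rho>)\<close> on \<open>\<int>\<^sup>\<Sigma>\<^sup>(\<^sup>1\<^sup>)\<close>, i.e. the basis vector of \<open>\<rho>\<close> goes to that of \<open>f \<rho>\<close>, and
  the induced action on classes.\<close>

definition char_act ::
    "'v::real_vector set \<Rightarrow> ('v \<Rightarrow> 'v) \<Rightarrow> ('v \<Rightarrow> int) \<Rightarrow> ('v \<Rightarrow> int)" where
  "char_act N f u = (\<lambda>n\<in>N. u (inv_into UNIV f n))"

definition ray_act ::
    "'v::real_vector set set \<Rightarrow> ('v \<Rightarrow> 'v) \<Rightarrow> ('v set \<Rightarrow> int) \<Rightarrow> ('v set \<Rightarrow> int)" where
  "ray_act \<Sigma> f a = (\<lambda>\<rho>\<in>rays \<Sigma>. a (inv_into UNIV f ` \<rho>))"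

definition class_act ::
    "'v::real_vector set set \<Rightarrow> ('v \<Rightarrow> 'v) \<Rightarrow> ('v set \<Rightarrow> int) set \<Rightarrow> ('v set \<Rightarrow> int) set" where
  "class_act \<Sigma> f c = ray_act \<Sigma> f ` c"

text \<open>For a group \<open>\<G>\<close> of automorphisms of \<open>K\<close> acting on \<open>A\<close> through \<open>\<alpha>\<close>, the twisted action on
  \<open>Hom(A,K\<^sup>\<times>)\<close> is \<open>(g\<cdot>\<xi>)(x) = g(\<xi>(g\<^sup>-\<^sup>1 x))\<close>.  On \<open>Hom(M,K\<^sup>\<times>) = N \<otimes> K\<^sup>\<times>\<close>, where \<open>n \<otimes> \<lambda>\<close> is the
  homomorphism \<open>u \<mapsto> \<lambda>\<^bsup>u(n)\<^esup>\<close>, this is \<open>g(n \<otimes> \<lambda>) = \<phi>\<^sub>g(n) \<otimes> g(\<lambda>)\<close>.\<close>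

definition twisted_act ::
    "('k \<Rightarrow> 'k) monoid \<Rightarrow> ('a, 'm) monoid_scheme \<Rightarrow> (('k \<Rightarrow> 'k) \<Rightarrow> 'a \<Rightarrow> 'a) \<Rightarrow>
     ('k \<Rightarrow> 'k) \<Rightarrow> ('a \<Rightarrow> 'k) \<Rightarrow> ('a \<Rightarrow> 'k)" where
  "twisted_act \<G> A \<alpha> g \<xi> = (\<lambda>x\<in>carrier A. g (\<xi> (\<alpha> (inv\<^bsub>\<G>\<^esub> g) x)))"

text \<open>\<open>\<T>\<close>, \<open>\<bbbG>\<^sub>m\<^sup>\<Sigma>\<^sup>(\<^sup>1\<^sup>)\<close> and \<open>G\<^sub>\<Sigma>\<close> are represented by their groups of \<open>K\<close>-points.\<close>

definition torus :: "'v::real_vector set \<Rightarrow> ('k, 'm) ring_scheme \<Rightarrow> (('v \<Rightarrow> int) \<Rightarrow> 'k) monoid" where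
  "torus N K = hom_grp (char_lattice N) (units_of K)"

definition torus_act where
  "torus_act N K k \<phi> = twisted_act (Gal K k) (char_lattice N) (\<lambda>g. char_act N (\<phi> g))"

definition ray_torus ::
    "'v::real_vector set set \<Rightarrow> ('k, 'm) ring_scheme \<Rightarrow> (('v set \<Rightarrow> int) \<Rightarrow> 'k) monoid" where
  "ray_torus \<Sigma> K = hom_grp (ray_lattice \<Sigma>) (units_of K)"

definition ray_torus_act where
  "ray_torus_act \<Sigma> K k \<phi> = twisted_act (Gal K k) (ray_lattice \<Sigma>) (\<lambda>g. ray_act \<Sigma> (\<phi> g))"

definition G_group ::
    "'v::real_vector set \<Rightarrow> 'v set set \<Rightarrow> ('k, 'm) ring_scheme \<Rightarrow> (('v set \<Rightarrow> int) set \<Rightarrow> 'k) monoid"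
  where "G_group N \<Sigma> K = hom_grp (class_group N \<Sigma>) (units_of K)"

definition G_group_act where
  "G_group_act N \<Sigma> K k \<phi> = twisted_act (Gal K k) (class_group N \<Sigma>) (\<lambda>g. class_act \<Sigma> (\<phi> g))"

definition G_incl ::
    "'v::real_vector set \<Rightarrow> 'v set set \<Rightarrow> (('v set \<Rightarrow> int) set \<Rightarrow> 'k) \<Rightarrow> (('v set \<Rightarrow> int) \<Rightarrow> 'k)" where
  "G_incl N \<Sigma> \<xi> = (\<lambda>a\<in>carrier (ray_lattice \<Sigma>). \<xi> (ray_class N \<Sigma> a))"

text \<open>\<open>(G\<^sub>\<Sigma>\<^sub>,\<^sub>\<phi>(k) \<inter> Im \<N>) / Im \<N>\<close>, all formed inside \<open>\<bbbG>\<^sub>m\<^sup>\<Sigma>\<^sup>(\<^sup>1\<^sup>)(K)\<close>.\<close>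

definition norm_quotient ::
    "'v::real_vector set \<Rightarrow> 'v set set \<Rightarrow> ('k, 'm) ring_scheme \<Rightarrow> 'k set \<Rightarrow>
     (('k \<Rightarrow> 'k) \<Rightarrow> 'v \<Rightarrow> 'v) \<Rightarrow> (('v set \<Rightarrow> int) \<Rightarrow> 'k) set monoid" where
  "norm_quotient N \<Sigma> K k \<phi> =
     (ray_torus \<Sigma> K)\<lparr>carrier :=
        G_incl N \<Sigma> ` invariants (Gal K k) (G_group N \<Sigma> K) (G_group_act N \<Sigma> K k \<phi>)
        \<inter> norm_map (Gal K k) (ray_torus \<Sigma> K) (ray_torus_act \<Sigma> K k \<phi>) ` carrier (ray_torus \<Sigma> K)\<rparr>
     Mod (G_incl N \<Sigma> `
        norm_map (Gal K k) (G_group N \<Sigma> K) (G_group_act N \<Sigma> K k \<phi>) ` carrier (G_group N \<Sigma> K))"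

end

theory Submission
  imports Defs
begin

text \<open>Write \<open>\<Gamma>\<close> for the Galois group, \<open>\<sigma>\<close> for a generator, and \<open>G\<close>, \<open>P\<close>, \<open>T\<close> for the groups of \<open>K\<close>-points
  of \<open>G\<^sub>\<Sigma>\<close>, of the torus of the rays and of the torus of \<open>N\<close>.  The theorem is the dimension shift
  along \<open>1 \<rightarrow> G \<rightarrow> P \<rightarrow> T \<rightarrow> 1\<close> in the Tate cohomology of the cyclic group \<open>\<Gamma>\<close>.  A cocycle of a cyclic
  group is determined by its value at \<open>\<sigma>\<close>, which can be any element of norm 1; it is a coboundary if
  and only if this value has the form \<open>\<sigma>t / t\<close>.  The connecting homomorphism lifts an element of norm 1 to
  \<open>p \<in> P\<close> and sends it to the norm of \<open>p\<close>, an invariant element of \<open>G\<close> known up to norms from \<open>G\<close>.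

  No exact sequence of cohomology groups has to be set up for this.  Let \<open>S\<close> be the group of those
  \<open>p \<in> P\<close> whose norm lies in \<open>G\<close>.  Sending \<open>p\<close> to the class of the cocycle whose value at \<open>\<sigma>\<close> is the image
  of \<open>p\<close> in \<open>T\<close> maps \<open>S\<close> onto \<open>H\<^sup>1(\<Gamma>, T)\<close>, because \<open>P \<rightarrow> T\<close> is surjective;
  sending \<open>p\<close> to its norm maps \<open>S\<close> onto the quotient
  on the other side.  Both maps have the kernel \<open>G \<cdot> (\<sigma> - 1)P\<close>: for the first this is the exactness of
  the sequence, for the second it says that elements of norm 1 in \<open>P\<close> have the form \<open>\<sigma>q / q\<close>.  This
  is \<open>cyclic_H1_iso_norm_quotient\<close>.

  Three facts about the situation at hand enter.  The extension \<open>K/k\<close> provides the last property of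
  \<open>P\<close>: as a Galois module \<open>P\<close> consists of the functions from the rays to \<open>K\<^sup>\<times>\<close>, with \<open>\<Gamma>\<close> permuting the
  rays, and Hilbert's Theorem 90 holds for such modules (\<open>hilbert90_permutation\<close>, resting on Dedekind's
  independence of automorphisms).  The fan provides the injectivity of \<open>M \<rightarrow> \<int>\<^sup>\<Sigma>\<^sup>(\<^sup>1\<^sup>)\<close>: a linear form that
  vanishes on all rays vanishes on all cones, which are generated by rays, hence on a spanning set
  (\<open>character_vanishing_on_rays\<close>).  The vanishing of Ext then gives the surjectivity of \<open>P \<rightarrow> T\<close>
  (\<open>extend_hom_of_trivial_Ext1\<close>).\<close>

section \<open>Cohomology of cyclic groups\<close>

lemma surj_hom_FactGroup_iso:
  assumes "group S" "comm_group U" "subgroup A U" "f \<in> hom S U" "f ` carrier S = carrier U"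
  shows "{s \<in> carrier S. f s \<in> A} \<lhd> S" "S Mod {s \<in> carrier S. f s \<in> A} \<cong> U Mod A"
proof -
  interpret S: group S by fact
  interpret U: comm_group U by fact
  interpret A: normal A U using assms(3) by (simp add: U.normal_iff_subgroup)
  let ?q = "\<lambda>s. A #>\<^bsub>U\<^esub> f s"
  have "(\<lambda>x. A #>\<^bsub>U\<^esub> x) \<circ> f \<in> hom S (U Mod A)"
    by (rule hom_compose[OF assms(4) A.r_coset_hom_Mod])
  then have q: "?q \<in> hom S (U Mod A)" by (simp add: o_def)
  interpret q: group_hom S "U Mod A" ?q
    using q A.factorgroup_is_group S.is_group by (simp add: group_hom_def group_hom_axioms_def)
  have "?q ` carrier S = carrier (U Mod A)"
    unfolding carrier_FactGroup using assms(5) by (auto simp: image_image[symmetric])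
  then have "S Mod kernel S (U Mod A) ?q \<cong> U Mod A"
    using q.FactGroup_iso_set by (auto simp: is_iso_def)
  moreover have "A #>\<^bsub>U\<^esub> f s = A \<longleftrightarrow> f s \<in> A" if "s \<in> carrier S" for s
    using that assms(3,4) U.coset_join1 U.coset_join2 by (metis hom_in_carrier)
  then have "kernel S (U Mod A) ?q = {s \<in> carrier S. f s \<in> A}"
    by (auto simp: kernel_def)
  ultimately show "{s \<in> carrier S. f s \<in> A} \<lhd> S"
    "S Mod {s \<in> carrier S. f s \<in> A} \<cong> U Mod A"
    using q.normal_kernel by auto
qed

text \<open>Two quotients are compared through a common cover instead of by a map between them: this avoids
  choosing lifts and checking that the result does not depend on them.\<close>

lemma quotients_iso_of_common_cover:
  assumes S: "group S" and U: "comm_group U" "subgroup A U" and Y: "comm_group Y" "subgroup B Y"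
    and f: "f \<in> hom S U" "f ` carrier S = carrier U"
    and h: "h \<in> hom S Y" "h ` carrier S = carrier Y"
    and eq: "\<And>s. s \<in> carrier S \<Longrightarrow> f s \<in> A \<longleftrightarrow> h s \<in> B"
  shows "U Mod A \<cong> Y Mod B"
proof -
  have "{s \<in> carrier S. f s \<in> A} = {s \<in> carrier S. h s \<in> B}" using eq by blast
  then have *: "S Mod {s \<in> carrier S. f s \<in> A} \<cong> Y Mod B"
    using surj_hom_FactGroup_iso(2)[OF S Y h] by simp
  have U': "S Mod {s \<in> carrier S. f s \<in> A} \<cong> U Mod A"
    by (rule surj_hom_FactGroup_iso(2)[OF S U f])
  have "{s \<in> carrier S. f s \<in> A} \<lhd> S"
    by (rule surj_hom_FactGroup_iso(1)[OF S U f])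
  then have "group (S Mod {s \<in> carrier S. f s \<in> A})" by (rule normal.factorgroup_is_group)
  then show ?thesis using * U' by (meson group.iso_sym iso_trans)
qed

lemma comm_group_subgroup:
  assumes "comm_group A" "subgroup H A" shows "comm_group (A\<lparr>carrier := H\<rparr>)"
proof (rule group.group_comm_groupI)
  show "group (A\<lparr>carrier := H\<rparr>)"
    using assms by (simp add: comm_group_def subgroup.subgroup_is_group)
  show "\<And>x y. x \<in> carrier (A\<lparr>carrier := H\<rparr>) \<Longrightarrow> y \<in> carrier (A\<lparr>carrier := H\<rparr>) \<Longrightarrow>
    x \<otimes>\<^bsub>A\<lparr>carrier := H\<rparr>\<^esub> y = y \<otimes>\<^bsub>A\<lparr>carrier := H\<rparr>\<^esub> x"
    using assms by (simp add: comm_groupE(4) subgroup.mem_carrier)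
qed

lemma hom_finprod:
  assumes A: "comm_group A" and B: "comm_group B" and f: "f \<in> hom A B" and x: "x \<in> I \<rightarrow> carrier A"
  shows "f (finprod A x I) = finprod B (f \<circ> x) I"
proof -
  interpret A: comm_group A by fact
  interpret B: comm_group B by fact
  interpret f: group_hom A B f
    using f A.is_group B.is_group by (simp add: group_hom_def group_hom_axioms_def)
  show ?thesis using x
  proof (induction I rule: infinite_finite_induct)
    case (insert i I)
    then have "x \<in> I \<rightarrow> carrier A" "x i \<in> carrier A" by auto
    moreover from this have "(\<lambda>a. f (x a)) \<in> I \<rightarrow> carrier B" "f (x i) \<in> carrier B"
      using f.hom_closed by fastforce+
    ultimately show ?case using insert by (simp add: comp_def)
  qed auto
qed

text \<open>A \<open>\<Gamma>\<close>-module, written multiplicatively.  The action is constrained on the carriers only, because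
  the modules below consist of functions that are normalised outside their domain.\<close>

locale gmodule = G: group \<Gamma> + comm_group A
  for \<Gamma> :: "('g, 'm) monoid_scheme" and A :: "('a, 'n) monoid_scheme" (structure)
    and act :: "'g \<Rightarrow> 'a \<Rightarrow> 'a" +
  assumes act_hom: "g \<in> carrier \<Gamma> \<Longrightarrow> act g \<in> hom A A"
    and act_one: "a \<in> carrier A \<Longrightarrow> act \<one>\<^bsub>\<Gamma>\<^esub> a = a"
    and act_mult: "\<lbrakk>g \<in> carrier \<Gamma>; h \<in> carrier \<Gamma>; a \<in> carrier A\<rbrakk>
      \<Longrightarrow> act (g \<otimes>\<^bsub>\<Gamma>\<^esub> h) a = act g (act h a)"
begin

lemma act_closed [simp, intro]: "g \<in> carrier \<Gamma> \<Longrightarrow> a \<in> carrier A \<Longrightarrow> act g a \<in> carrier A"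
  using act_hom by (auto simp: hom_def)

lemma act_m:
  "\<lbrakk>g \<in> carrier \<Gamma>; a \<in> carrier A; b \<in> carrier A\<rbrakk> \<Longrightarrow> act g (a \<otimes> b) = act g a \<otimes> act g b"
  using act_hom by (auto simp: hom_def)

lemma act_1 [simp]: "g \<in> carrier \<Gamma> \<Longrightarrow> act g \<one> = \<one>"
  using act_hom hom_one is_group by blast

lemma act_inv: "g \<in> carrier \<Gamma> \<Longrightarrow> a \<in> carrier A \<Longrightarrow> act g (inv a) = inv (act g a)"
  using act_hom group_hom.hom_inv is_group by (metis group_hom.intro group_hom_axioms.intro)

lemma norm_closed: "a \<in> carrier A \<Longrightarrow> norm_map \<Gamma> A act a \<in> carrier A"
  unfolding norm_map_def by (rule finprod_closed) auto

lemma norm_hom: "norm_map \<Gamma> A act \<in> hom A A"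
proof (rule homI)
  fix a b assume ab: "a \<in> carrier A" "b \<in> carrier A"
  have "norm_map \<Gamma> A act (a \<otimes> b) = finprod A (\<lambda>g. act g a \<otimes> act g b) (carrier \<Gamma>)"
    unfolding norm_map_def by (rule finprod_cong') (use ab in \<open>auto simp: act_m\<close>)
  also have "\<dots> = norm_map \<Gamma> A act a \<otimes> norm_map \<Gamma> A act b"
    unfolding norm_map_def by (rule finprod_multf) (use ab in auto)
  finally show "norm_map \<Gamma> A act (a \<otimes> b) = norm_map \<Gamma> A act a \<otimes> norm_map \<Gamma> A act b" .
qed (rule norm_closed)

lemma subgroup_invariants: "subgroup (invariants \<Gamma> A act) A"
proof (rule subgroupI)
  have "\<one> \<in> invariants \<Gamma> A act" by (simp add: invariants_def)
  then show "invariants \<Gamma> A act \<noteq> {}" by blast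
qed (simp_all add: invariants_def act_m act_inv subset_iff)

text \<open>Acting by \<open>g\<close> on the norm only permutes its factors by left translation.\<close>

lemma norm_invariant:
  assumes "a \<in> carrier A" shows "norm_map \<Gamma> A act a \<in> invariants \<Gamma> A act"
proof -
  have "act g (norm_map \<Gamma> A act a) = norm_map \<Gamma> A act a" if g: "g \<in> carrier \<Gamma>" for g
  proof -
    have "act g (norm_map \<Gamma> A act a) = finprod A (\<lambda>h. act (g \<otimes>\<^bsub>\<Gamma>\<^esub> h) a) (carrier \<Gamma>)"
      unfolding norm_map_def
      by (subst hom_finprod[OF comm_group_axioms comm_group_axioms act_hom[OF g]])
        (use assms g in \<open>auto simp: act_mult intro!: finprod_cong'\<close>)
    also have "\<dots> = finprod A (\<lambda>h. act h a) ((\<otimes>\<^bsub>\<Gamma>\<^esub>) g ` carrier \<Gamma>)"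
      by (rule finprod_reindex[symmetric]) (use assms g in \<open>auto simp: inj_on_def\<close>)
    also have "(\<otimes>\<^bsub>\<Gamma>\<^esub>) g ` carrier \<Gamma> = carrier \<Gamma>"
      using G.surj_const_mult g by blast
    finally show ?thesis by (simp add: norm_map_def)
  qed
  then show ?thesis using assms by (simp add: invariants_def norm_closed)
qed

lemma subgroup_cocycles: "subgroup (cocycles1 \<Gamma> A act) (product_group (carrier \<Gamma>) (\<lambda>_. A))"
proof -
  have PG: "group (product_group (carrier \<Gamma>) (\<lambda>_. A))" by (simp add: is_group)
  show ?thesis
  proof (rule group.subgroupI[OF PG])
    show "cocycles1 \<Gamma> A act \<subseteq> carrier (product_group (carrier \<Gamma>) (\<lambda>_. A))"
      by (auto simp: cocycles1_def)
    have "(\<lambda>g\<in>carrier \<Gamma>. \<one>) \<in> cocycles1 \<Gamma> A act" by (auto simp: cocycles1_def)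
    then show "cocycles1 \<Gamma> A act \<noteq> {}" by blast
  next
    fix c assume c: "c \<in> cocycles1 \<Gamma> A act"
    then have "c \<in> carrier (product_group (carrier \<Gamma>) (\<lambda>_. A))" by (auto simp: cocycles1_def)
    then have "inv\<^bsub>product_group (carrier \<Gamma>) (\<lambda>_. A)\<^esub> c = (\<lambda>g\<in>carrier \<Gamma>. inv (c g))"
      by (auto simp: is_group)
    moreover have cg: "\<And>g. g \<in> carrier \<Gamma> \<Longrightarrow> c g \<in> carrier A"
      using c by (auto simp: cocycles1_def)
    have "(\<lambda>g\<in>carrier \<Gamma>. inv (c g)) \<in> cocycles1 \<Gamma> A act"
      using c cg unfolding cocycles1_def by (auto simp: act_inv inv_mult)
    ultimately show "inv\<^bsub>product_group (carrier \<Gamma>) (\<lambda>_. A)\<^esub> c \<in> cocycles1 \<Gamma> A act" by simp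
  next
    fix c d assume c: "c \<in> cocycles1 \<Gamma> A act" and d: "d \<in> cocycles1 \<Gamma> A act"
    then have "\<And>g. g \<in> carrier \<Gamma> \<Longrightarrow> c g \<in> carrier A" "\<And>g. g \<in> carrier \<Gamma> \<Longrightarrow> d g \<in> carrier A"
      by (auto simp: cocycles1_def)
    with c d show "c \<otimes>\<^bsub>product_group (carrier \<Gamma>) (\<lambda>_. A)\<^esub> d \<in> cocycles1 \<Gamma> A act"
      by (auto simp: cocycles1_def act_m m_ac)
  qed
qed

lemma cocycle_group: "comm_group ((product_group (carrier \<Gamma>) (\<lambda>_. A))\<lparr>carrier := cocycles1 \<Gamma> A act\<rparr>)"
proof (rule comm_group_subgroup[OF _ subgroup_cocycles])
  show "comm_group (product_group (carrier \<Gamma>) (\<lambda>_. A))"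
    by (rule group.group_comm_groupI) (auto simp: is_group intro!: restrict_ext m_comm)
qed

lemma coboundary_in_cocycles:
  assumes a: "a \<in> carrier A"
  shows "(\<lambda>g\<in>carrier \<Gamma>. act g a \<otimes> inv a) \<in> cocycles1 \<Gamma> A act"
proof -
  have "act (g \<otimes>\<^bsub>\<Gamma>\<^esub> h) a \<otimes> inv a = (act g a \<otimes> inv a) \<otimes> act g (act h a \<otimes> inv a)"
    if g: "g \<in> carrier \<Gamma>" and h: "h \<in> carrier \<Gamma>" for g h
  proof -
    let ?x = "act g a" and ?y = "act g (act h a)" and ?z = "inv a"
    have c: "?x \<in> carrier A" "?y \<in> carrier A" "?z \<in> carrier A" "inv ?x \<in> carrier A"
      using a g h by auto
    have "(?x \<otimes> ?z) \<otimes> (?y \<otimes> inv ?x) = (?y \<otimes> ?z) \<otimes> (?x \<otimes> inv ?x)"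
      using c by (simp only: m_ac m_closed)
    also have "\<dots> = ?y \<otimes> ?z" using c by (simp only: r_inv r_one m_closed)
    finally show ?thesis using a g h by (simp add: act_m act_inv act_mult)
  qed
  then show ?thesis using a by (auto simp: cocycles1_def)
qed

lemma subgroup_coboundaries:
  "subgroup (coboundaries1 \<Gamma> A act)
     ((product_group (carrier \<Gamma>) (\<lambda>_. A))\<lparr>carrier := cocycles1 \<Gamma> A act\<rparr>)" (is "subgroup ?B ?Z")
proof -
  let ?d = "\<lambda>a. \<lambda>g\<in>carrier \<Gamma>. act g a \<otimes> inv a"
  have "?d \<in> hom A ?Z"
  proof (rule homI)
    fix a b assume "a \<in> carrier A" "b \<in> carrier A"
    then show "?d (a \<otimes> b) = ?d a \<otimes>\<^bsub>?Z\<^esub> ?d b"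
      by (auto simp: act_m inv_mult m_ac)
  qed (use coboundary_in_cocycles in auto)
  then interpret d: group_hom A ?Z ?d
    using is_group cocycle_group by (simp add: group_hom_def group_hom_axioms_def comm_group_def)
  show ?thesis using d.img_is_subgroup by (simp add: coboundaries1_def)
qed

end

locale cyclic_gmodule = gmodule \<Gamma> A act
  for \<Gamma> :: "('g, 'm) monoid_scheme" and A :: "('a, 'n) monoid_scheme" (structure)
    and act :: "'g \<Rightarrow> 'a \<Rightarrow> 'a" and \<sigma> :: 'g +
  assumes finite_group: "finite (carrier \<Gamma>)"
    and generator: "\<sigma> \<in> carrier \<Gamma>"
    and generates: "carrier \<Gamma> = range (\<lambda>i::nat. \<sigma> [^]\<^bsub>\<Gamma>\<^esub> i)"
begin

lemma pow_order: "\<sigma> [^]\<^bsub>\<Gamma>\<^esub> (order \<Gamma>) = \<one>\<^bsub>\<Gamma>\<^esub>"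
  using generator G.pow_order_eq_1 by blast

lemma pow_mod: "\<sigma> [^]\<^bsub>\<Gamma>\<^esub> (i mod order \<Gamma>) = \<sigma> [^]\<^bsub>\<Gamma>\<^esub> (i::nat)"
proof -
  have "\<sigma> [^]\<^bsub>\<Gamma>\<^esub> i = \<sigma> [^]\<^bsub>\<Gamma>\<^esub> (order \<Gamma> * (i div order \<Gamma>) + i mod order \<Gamma>)" by simp
  also have "\<dots> = \<sigma> [^]\<^bsub>\<Gamma>\<^esub> (i mod order \<Gamma>)"
    using generator by (simp only: G.nat_pow_mult[symmetric] G.nat_pow_pow[symmetric] pow_order) simp
  finally show ?thesis by simp
qed

lemma order_pos: "0 < order \<Gamma>"
  using finite_group G.order_gt_0_iff_finite by blast

lemma bij_pow: "bij_betw (\<lambda>i::nat. \<sigma> [^]\<^bsub>\<Gamma>\<^esub> i) {..<order \<Gamma>} (carrier \<Gamma>)"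
proof -
  have "(\<lambda>i::nat. \<sigma> [^]\<^bsub>\<Gamma>\<^esub> i) ` {..<order \<Gamma>} = carrier \<Gamma>"
  proof
    show "carrier \<Gamma> \<subseteq> (\<lambda>i::nat. \<sigma> [^]\<^bsub>\<Gamma>\<^esub> i) ` {..<order \<Gamma>}"
    proof
      fix g assume "g \<in> carrier \<Gamma>"
      then obtain i :: nat where "g = \<sigma> [^]\<^bsub>\<Gamma>\<^esub> i" using generates by auto
      then have "g = \<sigma> [^]\<^bsub>\<Gamma>\<^esub> (i mod order \<Gamma>)" by (simp add: pow_mod)
      then show "g \<in> (\<lambda>i::nat. \<sigma> [^]\<^bsub>\<Gamma>\<^esub> i) ` {..<order \<Gamma>}" using order_pos by auto
    qed
  qed (use generator in auto)
  then show ?thesis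
    by (auto simp: bij_betw_def order_def intro!: eq_card_imp_inj_on)
qed

text \<open>In a cyclic group the cocycle with value \<open>a\<close> at \<open>\<sigma>\<close> must take the value
  \<open>a \<cdot> \<sigma>a \<cdots> \<sigma>\<^sup>i\<^sup>-\<^sup>1a\<close> at \<open>\<sigma>\<^sup>i\<close>; for \<open>i\<close> the order of the group this product is the norm.\<close>

definition partial_norm :: "'a \<Rightarrow> nat \<Rightarrow> 'a" where
  "partial_norm a i = finprod A (\<lambda>j. act (\<sigma> [^]\<^bsub>\<Gamma>\<^esub> j) a) {..<i}"

lemma pow_closed [simp]: "\<sigma> [^]\<^bsub>\<Gamma>\<^esub> (i::nat) \<in> carrier \<Gamma>"
  using generator by simp

lemma partial_norm_closed [simp]: "a \<in> carrier A \<Longrightarrow> partial_norm a i \<in> carrier A"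
  unfolding partial_norm_def by (rule finprod_closed) auto

lemma partial_norm_0 [simp]: "partial_norm a 0 = \<one>"
  by (simp add: partial_norm_def)

lemma partial_norm_Suc:
  assumes "a \<in> carrier A"
  shows "partial_norm a (Suc i) = partial_norm a i \<otimes> act (\<sigma> [^]\<^bsub>\<Gamma>\<^esub> i) a"
  unfolding partial_norm_def lessThan_Suc
  by (subst finprod_insert) (use assms in \<open>auto intro: m_comm finprod_closed\<close>)

lemma partial_norm_1: "a \<in> carrier A \<Longrightarrow> partial_norm a 1 = a"
  using partial_norm_Suc[of a 0] by (simp add: act_one)

lemma partial_norm_m:
  "\<lbrakk>a \<in> carrier A; b \<in> carrier A\<rbrakk> \<Longrightarrow> partial_norm (a \<otimes> b) i = partial_norm a i \<otimes> partial_norm b i"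
  by (induction i) (simp_all add: partial_norm_Suc act_m m_ac)

text \<open>This is the cocycle identity for the exponents, before they are reduced modulo the order.\<close>

lemma partial_norm_add:
  assumes "a \<in> carrier A"
  shows "partial_norm a (i + j) = partial_norm a i \<otimes> act (\<sigma> [^]\<^bsub>\<Gamma>\<^esub> i) (partial_norm a j)"
proof (induction j)
  case (Suc j)
  then show ?case using assms
    by (simp add: partial_norm_Suc act_m m_assoc G.nat_pow_mult[symmetric] generator act_mult[symmetric])
qed (use assms in simp)

lemma norm_eq_partial_norm:
  assumes "a \<in> carrier A"
  shows "norm_map \<Gamma> A act a = partial_norm a (order \<Gamma>)"
proof -
  have "finprod A (\<lambda>g. act g a) ((\<lambda>i::nat. \<sigma> [^]\<^bsub>\<Gamma>\<^esub> i) ` {..<order \<Gamma>}) =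
     finprod A (\<lambda>j. act (\<sigma> [^]\<^bsub>\<Gamma>\<^esub> j) a) {..<order \<Gamma>}"
    by (rule finprod_reindex) (use assms bij_pow in \<open>auto simp: bij_betw_def\<close>)
  then show ?thesis
    using bij_pow by (simp add: norm_map_def partial_norm_def bij_betw_def)
qed

definition cyclic_cocycle :: "'a \<Rightarrow> 'g \<Rightarrow> 'a" where
  "cyclic_cocycle a =
     (\<lambda>g\<in>carrier \<Gamma>. partial_norm a (inv_into {..<order \<Gamma>} (\<lambda>i. \<sigma> [^]\<^bsub>\<Gamma>\<^esub> i) g))"

text \<open>In the definition the exponent of a group element is the one below the order.  Norm 1 makes
  the partial norms periodic in the exponent, so that any exponent may be used in place
  of the chosen one.\<close>

lemma cyclic_cocycle_pow:
  assumes a: "a \<in> carrier A" and N: "norm_map \<Gamma> A act a = \<one>"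
  shows "cyclic_cocycle a (\<sigma> [^]\<^bsub>\<Gamma>\<^esub> (i::nat)) = partial_norm a i"
proof -
  have period: "partial_norm a (order \<Gamma> * m + i) = partial_norm a i" for m i
  proof (induction m)
    case (Suc m)
    have "partial_norm a (order \<Gamma> + (order \<Gamma> * m + i)) = partial_norm a (order \<Gamma> * m + i)"
      by (subst partial_norm_add[OF a])
        (use a N in \<open>simp add: norm_eq_partial_norm pow_order act_one\<close>)
    with Suc show ?case by (simp add: add.assoc)
  qed simp
  have "inv_into {..<order \<Gamma>} (\<lambda>i. \<sigma> [^]\<^bsub>\<Gamma>\<^esub> i) (\<sigma> [^]\<^bsub>\<Gamma>\<^esub> (i mod order \<Gamma>)) = i mod order \<Gamma>"
    by (rule inv_into_f_f) (use bij_pow order_pos in \<open>auto simp: bij_betw_def\<close>)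
  then have "cyclic_cocycle a (\<sigma> [^]\<^bsub>\<Gamma>\<^esub> i) = partial_norm a (i mod order \<Gamma>)"
    by (simp add: cyclic_cocycle_def pow_mod)
  also have "\<dots> = partial_norm a i"
    using period[of "i div order \<Gamma>" "i mod order \<Gamma>"] by simp
  finally show ?thesis .
qed

lemma cyclic_cocycle_generator:
  assumes "a \<in> carrier A" "norm_map \<Gamma> A act a = \<one>"
  shows "cyclic_cocycle a \<sigma> = a"
  using cyclic_cocycle_pow[OF assms, of 1] partial_norm_1[OF assms(1)] generator by simp

lemma cyclic_cocycle_is_cocycle:
  assumes a: "a \<in> carrier A" and N: "norm_map \<Gamma> A act a = \<one>"
  shows "cyclic_cocycle a \<in> cocycles1 \<Gamma> A act"
proof -
  have "cyclic_cocycle a (g \<otimes>\<^bsub>\<Gamma>\<^esub> h) = cyclic_cocycle a g \<otimes> act g (cyclic_cocycle a h)"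
    if gh: "g \<in> carrier \<Gamma>" "h \<in> carrier \<Gamma>" for g h
  proof -
    obtain i j :: nat where ij: "g = \<sigma> [^]\<^bsub>\<Gamma>\<^esub> i" "h = \<sigma> [^]\<^bsub>\<Gamma>\<^esub> j"
      using gh generates by auto
    then show ?thesis
      using a N by (simp add: G.nat_pow_mult generator cyclic_cocycle_pow partial_norm_add)
  qed
  then show ?thesis using a by (auto simp: cocycles1_def cyclic_cocycle_def)
qed

lemma cocycle_pow:
  assumes c: "c \<in> cocycles1 \<Gamma> A act"
  shows "c (\<sigma> [^]\<^bsub>\<Gamma>\<^esub> (i::nat)) = partial_norm (c \<sigma>) i"
proof (induction i)
  case 0
  have c1: "c \<one>\<^bsub>\<Gamma>\<^esub> \<in> carrier A" using c by (auto simp: cocycles1_def)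
  have "c (\<one>\<^bsub>\<Gamma>\<^esub> \<otimes>\<^bsub>\<Gamma>\<^esub> \<one>\<^bsub>\<Gamma>\<^esub>) = c \<one>\<^bsub>\<Gamma>\<^esub> \<otimes> act \<one>\<^bsub>\<Gamma>\<^esub> (c \<one>\<^bsub>\<Gamma>\<^esub>)"
    using c unfolding cocycles1_def by blast
  then have "c \<one>\<^bsub>\<Gamma>\<^esub> = c \<one>\<^bsub>\<Gamma>\<^esub> \<otimes> c \<one>\<^bsub>\<Gamma>\<^esub>" using c1 by (simp add: act_one)
  then show ?case using c1 by (simp add: r_cancel_one)
next
  case (Suc i)
  have cs: "c \<sigma> \<in> carrier A" using c generator by (auto simp: cocycles1_def)
  have "c (\<sigma> [^]\<^bsub>\<Gamma>\<^esub> i \<otimes>\<^bsub>\<Gamma>\<^esub> \<sigma>) = c (\<sigma> [^]\<^bsub>\<Gamma>\<^esub> i) \<otimes> act (\<sigma> [^]\<^bsub>\<Gamma>\<^esub> i) (c \<sigma>)"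
    using c generator unfolding cocycles1_def by simp
  with Suc cs show ?case by (simp add: partial_norm_Suc)
qed

text \<open>The norm of \<open>c \<sigma>\<close> is the value of \<open>c\<close> at the power of \<open>\<sigma>\<close> whose exponent is the order of the
  group, that is, at the identity.\<close>

lemma cocycle_norm:
  assumes c: "c \<in> cocycles1 \<Gamma> A act"
  shows "norm_map \<Gamma> A act (c \<sigma>) = \<one>"
proof -
  have cs: "c \<sigma> \<in> carrier A" using c generator by (auto simp: cocycles1_def)
  show ?thesis
    using cocycle_pow[OF c, of "order \<Gamma>"] cocycle_pow[OF c, of 0] cs
    by (simp add: norm_eq_partial_norm pow_order)
qed

lemma cocycle_eqI:
  assumes "c \<in> cocycles1 \<Gamma> A act" "d \<in> cocycles1 \<Gamma> A act" "c \<sigma> = d \<sigma>"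
  shows "c = d"
proof (rule extensionalityI[of _ "carrier \<Gamma>"])
  fix g assume "g \<in> carrier \<Gamma>"
  then obtain i :: nat where "g = \<sigma> [^]\<^bsub>\<Gamma>\<^esub> i" using generates by auto
  then show "c g = d g" using assms by (simp add: cocycle_pow)
qed (use assms in \<open>auto simp: cocycles1_def PiE_def\<close>)

lemma cyclic_cocycle_m:
  assumes "a \<in> carrier A" "b \<in> carrier A"
  shows "cyclic_cocycle (a \<otimes> b) = cyclic_cocycle a \<otimes>\<^bsub>product_group (carrier \<Gamma>) (\<lambda>_. A)\<^esub> cyclic_cocycle b"
  using assms by (auto simp: cyclic_cocycle_def partial_norm_m)

text \<open>Cocycles are determined by their value at \<open>\<sigma>\<close>, so only this value has to be compared.\<close>

lemma cyclic_cocycle_coboundary_iff: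
  assumes a: "a \<in> carrier A" and N: "norm_map \<Gamma> A act a = \<one>"
  shows "cyclic_cocycle a \<in> coboundaries1 \<Gamma> A act \<longleftrightarrow> (\<exists>b\<in>carrier A. a = act \<sigma> b \<otimes> inv b)"
proof
  assume "cyclic_cocycle a \<in> coboundaries1 \<Gamma> A act"
  then obtain b where "b \<in> carrier A" "cyclic_cocycle a = (\<lambda>g\<in>carrier \<Gamma>. act g b \<otimes> inv b)"
    by (auto simp: coboundaries1_def)
  then show "\<exists>b\<in>carrier A. a = act \<sigma> b \<otimes> inv b"
    using cyclic_cocycle_generator[OF assms] generator by auto
next
  assume "\<exists>b\<in>carrier A. a = act \<sigma> b \<otimes> inv b"
  then obtain b where b: "b \<in> carrier A" "a = act \<sigma> b \<otimes> inv b" by blast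
  have "cyclic_cocycle a = (\<lambda>g\<in>carrier \<Gamma>. act g b \<otimes> inv b)"
    by (rule cocycle_eqI[OF cyclic_cocycle_is_cocycle[OF assms] coboundary_in_cocycles[OF b(1)]])
      (use cyclic_cocycle_generator[OF assms] b generator in simp)
  then show "cyclic_cocycle a \<in> coboundaries1 \<Gamma> A act"
    using b(1) by (auto simp: coboundaries1_def)
qed

lemma norm_act_div:
  assumes "b \<in> carrier A" shows "norm_map \<Gamma> A act (act \<sigma> b \<otimes> inv b) = \<one>"
  using cocycle_norm[OF coboundary_in_cocycles[OF assms]] generator by simp

end

lemma equivariant_norm:
  assumes "gmodule \<Gamma> A actA" "gmodule \<Gamma> B actB" "f \<in> hom A B"
    and eq: "\<And>g a. g \<in> carrier \<Gamma> \<Longrightarrow> a \<in> carrier A \<Longrightarrow> f (actA g a) = actB g (f a)"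
    and a: "a \<in> carrier A"
  shows "f (norm_map \<Gamma> A actA a) = norm_map \<Gamma> B actB (f a)"
proof -
  interpret A: gmodule \<Gamma> A actA by fact
  interpret B: gmodule \<Gamma> B actB by fact
  have "f (norm_map \<Gamma> A actA a) = finprod B (f \<circ> (\<lambda>g. actA g a)) (carrier \<Gamma>)"
    unfolding norm_map_def
    by (rule hom_finprod[OF A.comm_group_axioms B.comm_group_axioms assms(3)]) (use a in auto)
  also have "\<dots> = norm_map \<Gamma> B actB (f a)"
    unfolding norm_map_def
    by (rule B.finprod_cong') (use a eq assms(3) in \<open>auto simp: hom_in_carrier\<close>)
  finally show ?thesis .
qed

text \<open>The dimension shift.  The hypothesis on elements of norm 1 says that \<open>P\<close> has no first cohomology;
  it determines the kernel of the norm on the common cover \<open>S\<close>.  The numerator on the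
  right is contained in \<open>P\<close> as the intersection of two subgroups, and \<open>S\<close> is exactly its preimage
  under the norm: a norm from \<open>P\<close> is invariant, and injectivity of \<open>i\<close> carries the invariance over
  to \<open>G\<close>.\<close>

theorem cyclic_H1_iso_norm_quotient:
  assumes G: "cyclic_gmodule \<Gamma> G actG \<sigma>" and P: "cyclic_gmodule \<Gamma> P actP \<sigma>"
    and T: "cyclic_gmodule \<Gamma> T actT \<sigma>"
    and i: "i \<in> hom G P" "inj_on i (carrier G)"
    and r: "r \<in> hom P T" "r ` carrier P = carrier T"
    and exact: "i ` carrier G = kernel P T r"
    and i_eq: "\<And>g a. g \<in> carrier \<Gamma> \<Longrightarrow> a \<in> carrier G \<Longrightarrow> i (actG g a) = actP g (i a)"
    and r_eq: "\<And>g p. g \<in> carrier \<Gamma> \<Longrightarrow> p \<in> carrier P \<Longrightarrow> r (actP g p) = actT g (r p)"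
    and H90: "\<And>p. p \<in> carrier P \<Longrightarrow> norm_map \<Gamma> P actP p = \<one>\<^bsub>P\<^esub> \<Longrightarrow>
        \<exists>q\<in>carrier P. p = actP \<sigma> q \<otimes>\<^bsub>P\<^esub> inv\<^bsub>P\<^esub> q"
  shows "H1 \<Gamma> T actT \<cong>
     P\<lparr>carrier := i ` invariants \<Gamma> G actG \<inter> norm_map \<Gamma> P actP ` carrier P\<rparr>
       Mod (i ` norm_map \<Gamma> G actG ` carrier G)"
proof -
  interpret G: cyclic_gmodule \<Gamma> G actG \<sigma> by fact
  interpret P: cyclic_gmodule \<Gamma> P actP \<sigma> by fact
  interpret T: cyclic_gmodule \<Gamma> T actT \<sigma> by fact
  interpret i: group_hom G P i
    using i(1) G.is_group P.is_group by (simp add: group_hom_def group_hom_axioms_def)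
  interpret r: group_hom P T r
    using r(1) P.is_group T.is_group by (simp add: group_hom_def group_hom_axioms_def)
  let ?NG = "norm_map \<Gamma> G actG" and ?NP = "norm_map \<Gamma> P actP" and ?NT = "norm_map \<Gamma> T actT"
  interpret NP: group_hom P P ?NP
    using P.norm_hom P.is_group by (simp add: group_hom_def group_hom_axioms_def)
  interpret NG: group_hom G G ?NG
    using G.norm_hom G.is_group by (simp add: group_hom_def group_hom_axioms_def)
  interpret NT: group_hom T T ?NT
    using T.norm_hom T.is_group by (simp add: group_hom_def group_hom_axioms_def)
  have rN: "r (?NP p) = ?NT (r p)" if "p \<in> carrier P" for p
    using P.gmodule_axioms T.gmodule_axioms r(1) r_eq that
    by (rule equivariant_norm[of \<Gamma> P actP T actT r p])
  have iN: "i (?NG a) = ?NP (i a)" if "a \<in> carrier G" for a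
    using G.gmodule_axioms P.gmodule_axioms i(1) i_eq that
    by (rule equivariant_norm[of \<Gamma> G actG P actP i a])
  define S where "S = {p \<in> carrier P. ?NT (r p) = \<one>\<^bsub>T\<^esub>}"
  have S: "subgroup S P"
  proof (rule P.subgroupI)
    have "\<one>\<^bsub>P\<^esub> \<in> S" by (simp add: S_def)
    then show "S \<noteq> {}" by blast
  qed (simp_all add: S_def subset_iff)
  have SP: "S \<subseteq> carrier P" by (auto simp: S_def)
  let ?Z = "(product_group (carrier \<Gamma>) (\<lambda>_. T))\<lparr>carrier := cocycles1 \<Gamma> T actT\<rparr>"
  let ?I = "i ` invariants \<Gamma> G actG \<inter> ?NP ` carrier P"
  let ?f = "\<lambda>p. T.cyclic_cocycle (r p)"
  have I: "subgroup ?I P"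
    by (rule P.subgroups_Inter_pair)
      (use i.subgroup_img_is_subgroup[OF G.subgroup_invariants] NP.img_is_subgroup in auto)
  have BI: "i ` ?NG ` carrier G \<subseteq> ?I"
  proof
    fix y assume "y \<in> i ` ?NG ` carrier G"
    then obtain a where a: "a \<in> carrier G" "y = i (?NG a)" by blast
    then have "y = ?NP (i a)" by (simp add: iN)
    then have "y \<in> ?NP ` carrier P" using a(1) by simp
    moreover have "y \<in> i ` invariants \<Gamma> G actG"
      unfolding a(2) by (rule imageI[OF G.norm_invariant[OF a(1)]])
    ultimately show "y \<in> ?I" by (rule IntI[rotated])
  qed
  have f1: "?f \<in> hom (P\<lparr>carrier := S\<rparr>) ?Z"
    by (rule homI) (simp_all add: S_def T.cyclic_cocycle_is_cocycle T.cyclic_cocycle_m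
        del: mult_product_group)
  have f2: "?f ` carrier (P\<lparr>carrier := S\<rparr>) = carrier ?Z"
  proof
    show "carrier ?Z \<subseteq> ?f ` carrier (P\<lparr>carrier := S\<rparr>)"
    proof
      fix c assume "c \<in> carrier ?Z"
      then have c: "c \<in> cocycles1 \<Gamma> T actT" by simp
      then have cs: "c \<sigma> \<in> carrier T" using T.generator by (auto simp: cocycles1_def)
      then obtain p where p: "p \<in> carrier P" "r p = c \<sigma>" using r(2) by (metis imageE)
      then have "p \<in> S" using T.cocycle_norm[OF c] by (simp add: S_def)
      moreover have "c = ?f p"
        by (rule T.cocycle_eqI[OF c])
          (use p cs T.cocycle_norm[OF c] in
            \<open>simp_all add: T.cyclic_cocycle_is_cocycle T.cyclic_cocycle_generator\<close>)
      ultimately show "c \<in> ?f ` carrier (P\<lparr>carrier := S\<rparr>)" by auto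
    qed
  qed (auto simp: S_def T.cyclic_cocycle_is_cocycle)
  \<comment> \<open>\<open>S\<close> is the preimage under the norm of the numerator\<close>
  have S_iff: "p \<in> S \<longleftrightarrow> ?NP p \<in> ?I" if p: "p \<in> carrier P" for p
  proof
    assume "p \<in> S"
    then have "?NP p \<in> kernel P T r" using p by (simp add: S_def kernel_def rN)
    then obtain a where a: "a \<in> carrier G" "i a = ?NP p" using exact by (metis imageE)
    have "actG g a = a" if g: "g \<in> carrier \<Gamma>" for g
    proof -
      have "i (actG g a) = i a"
        using P.norm_invariant[OF p] g a by (simp add: i_eq invariants_def)
      then show ?thesis using i(2) a g by (meson G.act_closed inj_onD)
    qed
    then have "a \<in> invariants \<Gamma> G actG" using a(1) by (simp add: invariants_def)
    then show "?NP p \<in> ?I" using a(2) p by (metis IntI imageI)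
  next
    assume "?NP p \<in> ?I"
    then obtain a where "a \<in> carrier G" "?NP p = i a" by (auto simp: invariants_def)
    then have "?NP p \<in> kernel P T r" using exact by auto
    then show "p \<in> S" using p by (simp add: S_def kernel_def rN)
  qed
  have S_sub: "p \<in> S \<Longrightarrow> p \<in> carrier P" for p using SP by blast
  have NI: "?NP p \<in> ?I" if "p \<in> S" for p
    by (rule iffD1[OF S_iff[OF S_sub[OF that]] that])
  have h1: "?NP \<in> hom (P\<lparr>carrier := S\<rparr>) (P\<lparr>carrier := ?I\<rparr>)"
    by (rule homI) (use NI S_sub in \<open>simp_all del: Int_iff\<close>)
  have h2: "?NP ` carrier (P\<lparr>carrier := S\<rparr>) = carrier (P\<lparr>carrier := ?I\<rparr>)"
  proof
    show "carrier (P\<lparr>carrier := ?I\<rparr>) \<subseteq> ?NP ` carrier (P\<lparr>carrier := S\<rparr>)"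
    proof
      fix y assume "y \<in> carrier (P\<lparr>carrier := ?I\<rparr>)"
      then have y: "y \<in> ?I" by simp
      then obtain p where p: "p \<in> carrier P" "y = ?NP p" by blast
      have "p \<in> S" by (rule iffD2[OF S_iff[OF p(1)]]) (use y p(2) in simp)
      then show "y \<in> ?NP ` carrier (P\<lparr>carrier := S\<rparr>)" using p(2) by simp
    qed
    show "?NP ` carrier (P\<lparr>carrier := S\<rparr>) \<subseteq> carrier (P\<lparr>carrier := ?I\<rparr>)"
      by (rule image_subsetI) (use NI in \<open>simp del: Int_iff\<close>)
  qed
  \<comment> \<open>both conditions say that \<open>p\<close> lies in \<open>G \<cdot> (\<sigma> - 1)P\<close>\<close>
  have kernels: "?f p \<in> coboundaries1 \<Gamma> T actT \<longleftrightarrow> ?NP p \<in> i ` ?NG ` carrier G"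
    if "p \<in> carrier (P\<lparr>carrier := S\<rparr>)" for p
  proof -
    have pS: "p \<in> carrier P" "?NT (r p) = \<one>\<^bsub>T\<^esub>" using that by (auto simp: S_def)
    have "?f p \<in> coboundaries1 \<Gamma> T actT \<longleftrightarrow> (\<exists>b\<in>carrier T. r p = actT \<sigma> b \<otimes>\<^bsub>T\<^esub> inv\<^bsub>T\<^esub> b)"
      using pS by (simp add: T.cyclic_cocycle_coboundary_iff)
    also have "\<dots> \<longleftrightarrow> (\<exists>a\<in>carrier G. \<exists>q\<in>carrier P. p = i a \<otimes>\<^bsub>P\<^esub> (actP \<sigma> q \<otimes>\<^bsub>P\<^esub> inv\<^bsub>P\<^esub> q))"
    proof
      assume "\<exists>b\<in>carrier T. r p = actT \<sigma> b \<otimes>\<^bsub>T\<^esub> inv\<^bsub>T\<^esub> b"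
      then obtain q where q: "q \<in> carrier P" "r p = actT \<sigma> (r q) \<otimes>\<^bsub>T\<^esub> inv\<^bsub>T\<^esub> (r q)"
        using r(2) by (metis imageE)
      let ?d = "actP \<sigma> q \<otimes>\<^bsub>P\<^esub> inv\<^bsub>P\<^esub> q"
      have d: "?d \<in> carrier P" "r ?d = r p" using q P.generator by (simp_all add: r_eq)
      then have "p \<otimes>\<^bsub>P\<^esub> inv\<^bsub>P\<^esub> ?d \<in> kernel P T r" using pS(1) by (simp add: kernel_def)
      then obtain a where "a \<in> carrier G" "i a = p \<otimes>\<^bsub>P\<^esub> inv\<^bsub>P\<^esub> ?d" using exact by (metis imageE)
      moreover from this have "p = i a \<otimes>\<^bsub>P\<^esub> ?d" using d(1) pS(1) by (simp add: P.m_assoc)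
      ultimately show "\<exists>a\<in>carrier G. \<exists>q\<in>carrier P. p = i a \<otimes>\<^bsub>P\<^esub> (actP \<sigma> q \<otimes>\<^bsub>P\<^esub> inv\<^bsub>P\<^esub> q)"
        using q(1) by blast
    next
      assume "\<exists>a\<in>carrier G. \<exists>q\<in>carrier P. p = i a \<otimes>\<^bsub>P\<^esub> (actP \<sigma> q \<otimes>\<^bsub>P\<^esub> inv\<^bsub>P\<^esub> q)"
      then obtain a q where aq: "a \<in> carrier G" "q \<in> carrier P"
        "p = i a \<otimes>\<^bsub>P\<^esub> (actP \<sigma> q \<otimes>\<^bsub>P\<^esub> inv\<^bsub>P\<^esub> q)" by blast
      have "r (i a) = \<one>\<^bsub>T\<^esub>" using aq(1) exact by (auto simp: kernel_def)
      then have "r p = actT \<sigma> (r q) \<otimes>\<^bsub>T\<^esub> inv\<^bsub>T\<^esub> (r q)" using aq P.generator by (simp add: r_eq)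
      then show "\<exists>b\<in>carrier T. r p = actT \<sigma> b \<otimes>\<^bsub>T\<^esub> inv\<^bsub>T\<^esub> b"
        by (rule bexI) (rule r.hom_closed[OF aq(2)])
    qed
    also have "\<dots> \<longleftrightarrow> (\<exists>a\<in>carrier G. ?NP p = i (?NG a))"
    proof
      assume "\<exists>a\<in>carrier G. \<exists>q\<in>carrier P. p = i a \<otimes>\<^bsub>P\<^esub> (actP \<sigma> q \<otimes>\<^bsub>P\<^esub> inv\<^bsub>P\<^esub> q)"
      then obtain a q where "a \<in> carrier G" "q \<in> carrier P"
        "p = i a \<otimes>\<^bsub>P\<^esub> (actP \<sigma> q \<otimes>\<^bsub>P\<^esub> inv\<^bsub>P\<^esub> q)" by blast
      moreover have "?NP (actP \<sigma> q \<otimes>\<^bsub>P\<^esub> inv\<^bsub>P\<^esub> q) = \<one>\<^bsub>P\<^esub>"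
        using \<open>q \<in> carrier P\<close> by (rule P.norm_act_div)
      ultimately have "?NP p = i (?NG a)" 
        using NP.hom_mult[of "i a" "actP \<sigma> q \<otimes>\<^bsub>P\<^esub> inv\<^bsub>P\<^esub> q"] P.generator by (simp add: iN)
      then show "\<exists>a\<in>carrier G. ?NP p = i (?NG a)" by (rule bexI) fact
    next
      assume "\<exists>a\<in>carrier G. ?NP p = i (?NG a)"
      then obtain a where a: "a \<in> carrier G" "?NP p = ?NP (i a)" by (auto simp: iN)
      then have "?NP (p \<otimes>\<^bsub>P\<^esub> inv\<^bsub>P\<^esub> i a) = \<one>\<^bsub>P\<^esub>" using pS(1) by simp
      then obtain q where q: "q \<in> carrier P" "p \<otimes>\<^bsub>P\<^esub> inv\<^bsub>P\<^esub> i a = actP \<sigma> q \<otimes>\<^bsub>P\<^esub> inv\<^bsub>P\<^esub> q"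
        using H90[of "p \<otimes>\<^bsub>P\<^esub> inv\<^bsub>P\<^esub> i a"] pS(1) a(1) by auto
      have "p = i a \<otimes>\<^bsub>P\<^esub> (p \<otimes>\<^bsub>P\<^esub> inv\<^bsub>P\<^esub> i a)" using pS(1) a(1) by (simp add: P.m_lcomm)
      then show "\<exists>a\<in>carrier G. \<exists>q\<in>carrier P. p = i a \<otimes>\<^bsub>P\<^esub> (actP \<sigma> q \<otimes>\<^bsub>P\<^esub> inv\<^bsub>P\<^esub> q)"
        using a(1) q by metis
    qed
    also have "\<dots> \<longleftrightarrow> ?NP p \<in> i ` ?NG ` carrier G" by auto
    finally show ?thesis .
  qed
  have B: "subgroup (i ` ?NG ` carrier G) (P\<lparr>carrier := ?I\<rparr>)"
  proof (rule P.subgroup_incl[OF _ I BI])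
    show "subgroup (i ` ?NG ` carrier G) P"
      using i.subgroup_img_is_subgroup NG.img_is_subgroup by blast
  qed
  have "?Z Mod coboundaries1 \<Gamma> T actT \<cong> P\<lparr>carrier := ?I\<rparr> Mod (i ` ?NG ` carrier G)"
    using subgroup.subgroup_is_group[OF S P.is_group] T.cocycle_group T.subgroup_coboundaries
      comm_group_subgroup[OF P.comm_group_axioms I] B f1 f2 h1 h2 kernels
    by (rule quotients_iso_of_common_cover[where f = ?f and h = ?NP])
  then show ?thesis by (simp add: H1_def)
qed

section \<open>Galois groups and Hilbert 90\<close>

lemma subgroup_Gal:
  assumes "ring K" "k \<subseteq> carrier K"
  shows "subgroup {g \<in> ring_iso K K \<inter> extensional (carrier K). \<forall>x\<in>k. g x = x}
    (BijGroup (carrier K))" (is "subgroup ?H ?B")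
proof -
  interpret ring K by fact
  have HB: "g \<in> Bij (carrier K)" if "g \<in> ?H" for g
    using that ring_iso_memE(5)[of g K K] by (auto simp: Bij_def)
  show ?thesis
  proof (rule group.subgroupI[OF group_BijGroup])
    show "?H \<subseteq> carrier ?B" using HB by (auto simp: BijGroup_def)
    have "(\<lambda>x\<in>carrier K. x) \<in> ring_iso K K"
      by (rule ring_iso_memI) (auto simp: bij_betw_def inj_on_def)
    then have "(\<lambda>x\<in>carrier K. x) \<in> ?H" using assms(2) by auto
    then show "?H \<noteq> {}" by blast
  next
    fix g assume g: "g \<in> ?H"
    let ?i = "restrict (inv_into (carrier K) g) (carrier K)"
    have "inv\<^bsub>?B\<^esub> g = ?i" using HB[OF g] by (rule inv_BijGroup)
    moreover have "?i \<in> ring_iso K K"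
      by (rule ring_iso_restrict[OF ring_iso_set_sym[OF ring_axioms]]) (use g in auto)
    moreover have "?i x = x" if "x \<in> k" for x
    proof -
      have "g x = x" "x \<in> carrier K" "inj_on g (carrier K)"
        using that g assms(2) ring_iso_memE(5)[of g K K] by (auto simp: bij_betw_def)
      then show ?thesis by (simp add: inv_into_f_eq)
    qed
    ultimately show "inv\<^bsub>?B\<^esub> g \<in> ?H" by auto
  next
    fix g h assume gh: "g \<in> ?H" "h \<in> ?H"
    have "g \<otimes>\<^bsub>?B\<^esub> h = compose (carrier K) g h"
      using HB gh by (simp add: BijGroup_def)
    moreover have "compose (carrier K) g h \<in> ring_iso K K"
      by (rule ring_iso_restrict[OF ring_iso_set_trans[of h K K g K]])
        (use gh in \<open>auto simp: compose_def\<close>)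
    moreover have "compose (carrier K) g h x = x" if "x \<in> k" for x
      using that gh assms(2) by (auto simp: compose_def)
    ultimately show "g \<otimes>\<^bsub>?B\<^esub> h \<in> ?H" by auto
  qed
qed

locale galois_extension = field K for K :: "('k, 'm) ring_scheme" (structure) +
  fixes k :: "'k set"
  assumes subfield_k: "subfield k K"
    and finite_dim: "finite_dimension k (carrier K)"
begin

lemma k_subset: "k \<subseteq> carrier K"
  using subfield_k by (simp add: subfieldE(3))

lemma group_Gal: "group (Gal K k)"
  unfolding Gal_def
  by (rule subgroup.subgroup_is_group[OF subgroup_Gal[OF ring_axioms k_subset] group_BijGroup])

lemma Gal_memE:
  assumes "g \<in> carrier (Gal K k)"
  shows "g \<in> ring_iso K K" "g \<in> Bij (carrier K)" "\<And>x. x \<in> k \<Longrightarrow> g x = x"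
  using assms ring_iso_memE(5)[of g K K] by (auto simp: Gal_def Bij_def)

lemma Gal_ring_hom: "g \<in> carrier (Gal K k) \<Longrightarrow> g \<in> ring_hom K K"
  using Gal_memE(1) by (auto simp: ring_iso_def)

lemma Gal_ring_hom_cring:
  assumes "g \<in> carrier (Gal K k)" shows "ring_hom_cring K K g"
  using Gal_ring_hom[OF assms] by unfold_locales

lemma Gal_one: "\<one>\<^bsub>Gal K k\<^esub> = (\<lambda>x\<in>carrier K. x)"
  by (simp add: Gal_def BijGroup_def)

lemma Gal_mult:
  assumes "g \<in> carrier (Gal K k)" "h \<in> carrier (Gal K k)" "x \<in> carrier K"
  shows "(g \<otimes>\<^bsub>Gal K k\<^esub> h) x = g (h x)"
  using Gal_memE(2)[OF assms(1)] Gal_memE(2)[OF assms(2)] assms(3)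
  by (simp add: Gal_def BijGroup_def compose_def)

lemma Gal_closed: "g \<in> carrier (Gal K k) \<Longrightarrow> x \<in> carrier K \<Longrightarrow> g x \<in> carrier K"
  using Gal_ring_hom ring_hom_closed by metis

lemma Gal_eqI:
  assumes "g \<in> carrier (Gal K k)" "h \<in> carrier (Gal K k)" "\<And>x. x \<in> carrier K \<Longrightarrow> g x = h x"
  shows "g = h"
  using Gal_memE(2)[OF assms(1)] Gal_memE(2)[OF assms(2)] assms(3)
  by (auto simp: Bij_def intro: extensionalityI)

text \<open>An automorphism is determined by its values on a finite generating family of \<open>K\<close> over \<open>k\<close>, and
  each of these values is a root of a fixed nonzero polynomial over \<open>k\<close>.  Norms are products over the
  whole group, so they are meaningful only because of this.\<close>

lemma finite_Gal: "finite (carrier (Gal K k))"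
proof -
  obtain n where n: "dimension n k (carrier K)" using finite_dim by blast
  obtain us where us: "set us \<subseteq> carrier K" "Span k us = carrier K"
    using exists_base[OF subfield_k n] by blast
  have finite_conj: "finite ((\<lambda>g. g x) ` carrier (Gal K k))" if x: "x \<in> carrier K" for x
  proof -
    have "(algebraic over k) x"
      by (rule finite_dimension_imp_algebraic[OF subfield_k carrier_is_subring finite_dim x])
    then obtain p where p: "p \<in> carrier (univ_poly K k)" "p \<noteq> []" "eval p x = \<zero>"
      using algebraicE[OF subfieldE(1)[OF subfield_k] x] by blast
    have pk: "set p \<subseteq> k"
      using p(1) by (metis polynomial_incl univ_poly_carrier)
    have "is_root p (g x)" if g: "g \<in> carrier (Gal K k)" for g
    proof -
      interpret g: ring_hom_cring K K g by (rule Gal_ring_hom_cring[OF g])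
      have gr: "ring_hom_ring K K g" by unfold_locales
      have "g (eval p x) = eval (map g p) (g x)"
        by (rule ring_hom_ring.eval_hom'[OF gr x]) (use pk k_subset in auto)
      moreover have "map g p = p" using pk Gal_memE(3)[OF g] by (intro map_idI) auto
      ultimately show ?thesis using p x g Gal_closed by (auto simp: is_root_def)
    qed
    moreover have "p \<in> carrier (poly_ring K)"
      using p(1) pk k_subset carrier_polynomial[OF subfieldE(1)[OF subfield_k]]
      by (simp add: univ_poly_carrier[symmetric])
    ultimately show ?thesis
      using finite_number_of_roots[of p] by (auto elim!: finite_subset[rotated])
  qed
  let ?r = "\<lambda>g. restrict g (set us)"
  have "inj_on ?r (carrier (Gal K k))"
  proof (rule inj_onI)
    fix g h assume g: "g \<in> carrier (Gal K k)" and h: "h \<in> carrier (Gal K k)" and eq: "?r g = ?r h"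
    interpret g: ring_hom_cring K K g by (rule Gal_ring_hom_cring[OF g])
    interpret h: ring_hom_cring K K h by (rule Gal_ring_hom_cring[OF h])
    have gh: "g u = h u" if "u \<in> set us" for u using eq that by (metis restrict_apply')
    have comb: "g (combine cs vs) = h (combine cs vs)"
      if "set cs \<subseteq> k" "set vs \<subseteq> set us" for cs vs
      using that
    proof (induction cs vs rule: combine.induct)
      case (1 c cs v vs)
      have "c \<in> carrier K" "v \<in> carrier K" "set cs \<subseteq> carrier K" "set vs \<subseteq> carrier K"
        using 1(2,3) us(1) k_subset by auto
      moreover from this have "combine cs vs \<in> carrier K" by (intro combine_in_carrier)
      ultimately show ?case
        using 1 Gal_memE(3)[OF g] Gal_memE(3)[OF h] gh by simp
    qed auto
    show "g = h"
    proof (rule Gal_eqI[OF g h])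
      fix x assume "x \<in> carrier K"
      then obtain cs where "x = combine cs us" "set cs \<subseteq> k"
        using us Span_eq_combine_set[OF subfield_k us(1)] by auto
      then show "g x = h x" using comb by simp
    qed
  qed
  moreover have "?r ` carrier (Gal K k) \<subseteq> (\<Pi>\<^sub>E u\<in>set us. (\<lambda>g. g u) ` carrier (Gal K k))"
    by auto
  moreover have "finite (\<Pi>\<^sub>E u\<in>set us. (\<lambda>g. g u) ` carrier (Gal K k))"
    by (rule finite_PiE) (use finite_conj us(1) in auto)
  ultimately show ?thesis by (meson finite_imageD finite_subset)
qed

text \<open>Given a relation that involves \<open>h\<close>, replacing \<open>x\<close> by \<open>yx\<close> and subtracting \<open>h(y)\<close> times the relation
  removes the term of \<open>h\<close> and multiplies the coefficient of every other \<open>g\<close> by \<open>g(y) - h(y)\<close>, which is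
  nonzero for a suitable \<open>y\<close>.\<close>

lemma dedekind_independence:
  assumes "finite S" "S \<subseteq> carrier (Gal K k)" "a \<in> S \<rightarrow> carrier K"
    and "\<And>x. x \<in> carrier K \<Longrightarrow> (\<Oplus>g\<in>S. a g \<otimes> g x) = \<zero>"
  shows "\<forall>g\<in>S. a g = \<zero>"
  using assms
proof (induction S arbitrary: a rule: finite_induct)
  case (insert h S)
  have h: "h \<in> carrier (Gal K k)" and S: "\<And>g. g \<in> S \<Longrightarrow> g \<in> carrier (Gal K k)"
    and ah: "a h \<in> carrier K" and aS: "\<And>g. g \<in> S \<Longrightarrow> a g \<in> carrier K"
    using insert.prems(1,2) by auto
  have sum: "a h \<otimes> h x \<oplus> (\<Oplus>g\<in>S. a g \<otimes> g x) = \<zero>" if x: "x \<in> carrier K" for x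
    using insert.prems(3)[OF x] insert.hyps ah aS h S x by (simp add: Gal_closed)
  have zero: "a g \<otimes> (g y \<ominus> h y) = \<zero>" if y: "y \<in> carrier K" and g: "g \<in> S" for y g
  proof -
    have "\<forall>g\<in>S. a g \<otimes> (g y \<ominus> h y) = \<zero>"
    proof (rule insert.IH)
      show "S \<subseteq> carrier (Gal K k)" using S by auto
      show "(\<lambda>g. a g \<otimes> (g y \<ominus> h y)) \<in> S \<rightarrow> carrier K" using aS S h y by (auto simp: Gal_closed)
      fix x assume x: "x \<in> carrier K"
      have c: "\<And>g. g \<in> S \<Longrightarrow> g x \<in> carrier K" "\<And>g. g \<in> S \<Longrightarrow> g y \<in> carrier K"
          "h x \<in> carrier K" "h y \<in> carrier K"
        using S h x y Gal_closed by auto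
      have hm: "h (y \<otimes> x) = h y \<otimes> h x" and gm: "\<And>g. g \<in> S \<Longrightarrow> g (y \<otimes> x) = g y \<otimes> g x"
        using Gal_ring_hom h S x y by (auto simp: ring_hom_mult)
      let ?s = "\<Oplus>g\<in>S. a g \<otimes> g x" and ?t = "\<Oplus>g\<in>S. a g \<otimes> g (y \<otimes> x)"
      have st: "?s \<in> carrier K" "?t \<in> carrier K"
        using aS S x y by (auto intro!: finsum_closed simp: Gal_closed)
      have "(\<Oplus>g\<in>S. a g \<otimes> (g y \<ominus> h y) \<otimes> g x) = (\<Oplus>g\<in>S. a g \<otimes> g (y \<otimes> x) \<oplus> (\<ominus> h y) \<otimes> (a g \<otimes> g x))"
      proof (rule finsum_cong')
        fix g assume g: "g \<in> S"
        have "a g \<otimes> (g y \<ominus> h y) \<otimes> g x = a g \<otimes> (g y \<otimes> g x) \<oplus> (\<ominus> h y) \<otimes> (a g \<otimes> g x)"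
          using c(3,4) c(1,2)[OF g] aS[OF g] by algebra
        then show "a g \<otimes> (g y \<ominus> h y) \<otimes> g x = a g \<otimes> g (y \<otimes> x) \<oplus> (\<ominus> h y) \<otimes> (a g \<otimes> g x)"
          by (simp add: gm g)
      qed (use aS S x y c in \<open>auto simp: Gal_closed\<close>)
      also have "\<dots> = ?t \<oplus> (\<Oplus>g\<in>S. (\<ominus> h y) \<otimes> (a g \<otimes> g x))"
        by (rule finsum_addf) (use aS S x y c in \<open>auto simp: Gal_closed\<close>)
      also have "(\<Oplus>g\<in>S. (\<ominus> h y) \<otimes> (a g \<otimes> g x)) = (\<ominus> h y) \<otimes> ?s"
        by (rule finsum_rdistr[symmetric]) (use aS S x y c insert.hyps in \<open>auto simp: Gal_closed\<close>)
      also have "?t \<oplus> (\<ominus> h y) \<otimes> ?s = \<zero>"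
      proof -
        have "a h \<otimes> (h y \<otimes> h x) \<oplus> ?t = \<zero>" using sum[of "y \<otimes> x"] x y hm by simp
        moreover have "a h \<otimes> h x \<oplus> ?s = \<zero>" by (rule sum[OF x])
        ultimately have "?t = \<ominus> (a h \<otimes> (h y \<otimes> h x))" "?s = \<ominus> (a h \<otimes> h x)"
          using st ah c(3,4) by (simp_all add: minus_equality[symmetric] a_comm sum_zero_eq_neg)
        then show ?thesis using ah c(3,4) by algebra
      qed
      finally show "(\<Oplus>g\<in>S. a g \<otimes> (g y \<ominus> h y) \<otimes> g x) = \<zero>" .
    qed
    then show ?thesis using g by blast
  qed
  have aS0: "a g = \<zero>" if g: "g \<in> S" for g
  proof -
    have "g \<noteq> h" using g insert.hyps by auto
    then obtain y where y: "y \<in> carrier K" "g y \<noteq> h y" using Gal_eqI[OF S[OF g] h] by blast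
    then have "g y \<ominus> h y \<noteq> \<zero>" using S[OF g] h by (simp add: Gal_closed)
    then show ?thesis using zero[OF y(1) g] aS[OF g] S[OF g] h y(1)
      by (metis Gal_closed integral minus_closed)
  qed
  have "(\<Oplus>g\<in>S. a g \<otimes> g \<one>) = (\<Oplus>g\<in>S. \<zero>)"
    by (rule finsum_cong') (use aS0 S in \<open>auto simp: Gal_closed\<close>)
  then have "a h \<otimes> h \<one> = \<zero>" using sum[of \<one>] ah h by (simp add: Gal_closed)
  then have "a h = \<zero>" using ah h Gal_ring_hom ring_hom_one by fastforce
  then show ?case using aS0 by auto
qed simp

text \<open>Hilbert 90 for the module of all functions \<open>R \<rightarrow> K\<^sup>\<times>\<close>, in the form that a cocycle \<open>c\<close> is a coboundary.
  As in the classical case the trivialising function is a Poincare series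
  \<open>b(\<rho>) = \<Sum>\<^sub>h c\<^sub>h(\<rho>) h(\<theta>(h\<^sup>-\<^sup>1\<rho>))\<close>, which satisfies the required equation for every \<open>\<theta>\<close>; the point is to
  choose \<open>\<theta>\<close> so that \<open>b\<close> has no zero.  By the equation it suffices to look at one \<open>\<rho>\<close> in each orbit.  If
  \<open>\<theta>\<close> is zero away from these representatives, the series at a representative is a sum over its
  stabiliser, and Dedekind independence gives a value of \<open>\<theta>\<close> there that makes it nonzero.  This
  replaces the appeal to Shapiro's lemma.\<close>

lemma hilbert90_permutation:
  fixes \<pi> :: "('k \<Rightarrow> 'k) \<Rightarrow> 'r \<Rightarrow> 'r" and c :: "('k \<Rightarrow> 'k) \<Rightarrow> 'r \<Rightarrow> 'k"
  assumes \<pi>_closed: "\<And>g \<rho>. g \<in> carrier (Gal K k) \<Longrightarrow> \<rho> \<in> R \<Longrightarrow> \<pi> g \<rho> \<in> R"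
    and \<pi>_one: "\<And>\<rho>. \<rho> \<in> R \<Longrightarrow> \<pi> \<one>\<^bsub>Gal K k\<^esub> \<rho> = \<rho>"
    and \<pi>_mult: "\<And>g h \<rho>. g \<in> carrier (Gal K k) \<Longrightarrow> h \<in> carrier (Gal K k) \<Longrightarrow> \<rho> \<in> R \<Longrightarrow>
      \<pi> (g \<otimes>\<^bsub>Gal K k\<^esub> h) \<rho> = \<pi> g (\<pi> h \<rho>)"
    and c_unit: "\<And>g \<rho>. g \<in> carrier (Gal K k) \<Longrightarrow> \<rho> \<in> R \<Longrightarrow> c g \<rho> \<in> carrier K - {\<zero>}"
    and cocycle: "\<And>g h \<rho>. g \<in> carrier (Gal K k) \<Longrightarrow> h \<in> carrier (Gal K k) \<Longrightarrow> \<rho> \<in> R \<Longrightarrow>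
      c (g \<otimes>\<^bsub>Gal K k\<^esub> h) \<rho> = c g \<rho> \<otimes> g (c h (\<pi> (inv\<^bsub>Gal K k\<^esub> g) \<rho>))"
  shows "\<exists>b. (\<forall>\<rho>\<in>R. b \<rho> \<in> carrier K - {\<zero>}) \<and>
    (\<forall>g\<in>carrier (Gal K k). \<forall>\<rho>\<in>R. c g \<rho> \<otimes> g (b (\<pi> (inv\<^bsub>Gal K k\<^esub> g) \<rho>)) = b \<rho>)"
proof -
  interpret \<Gamma>: group "Gal K k" by (rule group_Gal)
  let ?\<Gamma> = "carrier (Gal K k)"
  let ?i = "\<lambda>g. inv\<^bsub>Gal K k\<^esub> g"
  define orbit where "orbit \<rho> = (\<lambda>g. \<pi> g \<rho>) ` ?\<Gamma>" for \<rho>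
  define rep where "rep \<rho> = (SOME \<rho>'. \<rho>' \<in> orbit \<rho>)" for \<rho>
  define stab where "stab \<rho> = {g \<in> ?\<Gamma>. \<pi> (?i g) \<rho> = \<rho>}" for \<rho>
  define P where "P \<rho> t \<longleftrightarrow> t \<in> carrier K \<and> (\<Oplus>h\<in>stab \<rho>. c h \<rho> \<otimes> h t) \<noteq> \<zero>" for \<rho> t
  \<comment> \<open>the weight function, supported on the orbit representatives\<close>
  define \<theta> where "\<theta> \<rho> = (if rep \<rho> = \<rho> then SOME t. P \<rho> t else \<zero>)" for \<rho>
  define b where "b \<rho> = (\<Oplus>h\<in>?\<Gamma>. c h \<rho> \<otimes> h (\<theta> (\<pi> (?i h) \<rho>)))" for \<rho>
  have P: "P \<rho> (SOME t. P \<rho> t)" if \<rho>: "\<rho> \<in> R" for \<rho>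
  proof -
    have one_stab: "\<one>\<^bsub>Gal K k\<^esub> \<in> stab \<rho>" using \<rho> by (simp add: stab_def \<pi>_one)
    have "\<exists>t. P \<rho> t"
    proof (rule ccontr)
      assume "\<not> (\<exists>t. P \<rho> t)"
      then have "\<And>t. t \<in> carrier K \<Longrightarrow> (\<Oplus>h\<in>stab \<rho>. c h \<rho> \<otimes> h t) = \<zero>" by (auto simp: P_def)
      moreover have "finite (stab \<rho>)" "stab \<rho> \<subseteq> ?\<Gamma>" using finite_Gal by (auto simp: stab_def)
      moreover have "(\<lambda>h. c h \<rho>) \<in> stab \<rho> \<rightarrow> carrier K" using c_unit \<rho> by (auto simp: stab_def)
      ultimately have "\<forall>h\<in>stab \<rho>. c h \<rho> = \<zero>"
        by (intro dedekind_independence) auto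
      then show False using one_stab c_unit[OF _ \<rho>] by fastforce
    qed
    then show ?thesis by (rule someI_ex)
  qed
  have orbit_self: "\<rho> \<in> orbit \<rho>" if "\<rho> \<in> R" for \<rho>
    unfolding orbit_def using \<pi>_one[OF that] by (metis \<Gamma>.one_closed imageI)
  have rep: "rep \<rho> \<in> orbit \<rho>" if "\<rho> \<in> R" for \<rho>
    unfolding rep_def by (rule someI, rule orbit_self[OF that])
  have orbit_\<pi>: "orbit (\<pi> g \<rho>) = orbit \<rho>" if g: "g \<in> ?\<Gamma>" and \<rho>: "\<rho> \<in> R" for g \<rho>
  proof -
    have "orbit (\<pi> g \<rho>) = (\<lambda>h. \<pi> (h \<otimes>\<^bsub>Gal K k\<^esub> g) \<rho>) ` ?\<Gamma>"
      unfolding orbit_def using \<pi>_mult g \<rho> by (intro image_cong) auto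
    also have "\<dots> = (\<lambda>h. \<pi> h \<rho>) ` (\<lambda>h. h \<otimes>\<^bsub>Gal K k\<^esub> g) ` ?\<Gamma>" by (simp add: image_image)
    also have "(\<lambda>h. h \<otimes>\<^bsub>Gal K k\<^esub> g) ` ?\<Gamma> = ?\<Gamma>"
    proof
      show "?\<Gamma> \<subseteq> (\<lambda>h. h \<otimes>\<^bsub>Gal K k\<^esub> g) ` ?\<Gamma>"
      proof
        fix x assume x: "x \<in> ?\<Gamma>"
        have "x = (x \<otimes>\<^bsub>Gal K k\<^esub> ?i g) \<otimes>\<^bsub>Gal K k\<^esub> g"
          using x g by (simp add: \<Gamma>.m_assoc)
        then show "x \<in> (\<lambda>h. h \<otimes>\<^bsub>Gal K k\<^esub> g) ` ?\<Gamma>"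
          using x g by (metis \<Gamma>.inv_closed \<Gamma>.m_closed imageI)
      qed
    qed (use g in auto)
    finally show ?thesis by (simp add: orbit_def)
  qed
  have rep_\<pi>: "rep (\<pi> g \<rho>) = rep \<rho>" if "g \<in> ?\<Gamma>" "\<rho> \<in> R" for g \<rho>
    using that by (simp add: rep_def orbit_\<pi>)
  have \<theta>: "\<theta> \<rho> \<in> carrier K" if "\<rho> \<in> R" for \<rho>
    using P[OF that] by (auto simp: \<theta>_def P_def)
  have summand: "c h \<rho> \<otimes> h (\<theta> (\<pi> (?i h) \<rho>)) \<in> carrier K" if "h \<in> ?\<Gamma>" "\<rho> \<in> R" for h \<rho>
    using that c_unit \<theta> \<pi>_closed by (auto simp: Gal_closed)
  have b_closed: "b \<rho> \<in> carrier K" if "\<rho> \<in> R" for \<rho>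
    unfolding b_def by (rule finsum_closed) (use summand that in auto)
  \<comment> \<open>the Poincare series trivialises the cocycle, by left translation of the summation index\<close>
  have b_eq: "c g \<rho> \<otimes> g (b (\<pi> (?i g) \<rho>)) = b \<rho>" if g: "g \<in> ?\<Gamma>" and \<rho>: "\<rho> \<in> R" for g \<rho>
  proof -
    interpret g: ring_hom_cring K K g by (rule Gal_ring_hom_cring[OF g])
    let ?\<rho> = "\<pi> (?i g) \<rho>"
    have \<rho>': "?\<rho> \<in> R" using g \<rho> \<pi>_closed by simp
    have cg: "c g \<rho> \<in> carrier K" using c_unit g \<rho> by auto
    let ?t = "\<lambda>h. c h \<rho> \<otimes> h (\<theta> (\<pi> (?i h) \<rho>))"
    have "g (b ?\<rho>) = (\<Oplus>h\<in>?\<Gamma>. g (c h ?\<rho> \<otimes> h (\<theta> (\<pi> (?i h) ?\<rho>))))"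
      unfolding b_def using summand \<rho>' by (subst g.hom_finsum) (auto simp: comp_def)
    then have "c g \<rho> \<otimes> g (b ?\<rho>) = (\<Oplus>h\<in>?\<Gamma>. c g \<rho> \<otimes> g (c h ?\<rho> \<otimes> h (\<theta> (\<pi> (?i h) ?\<rho>))))"
      using summand \<rho>' cg finite_Gal by (simp add: finsum_rdistr)
    also have "\<dots> = (\<Oplus>h\<in>?\<Gamma>. ?t (g \<otimes>\<^bsub>Gal K k\<^esub> h))"
    proof (rule finsum_cong')
      fix h assume h: "h \<in> ?\<Gamma>"
      have "\<pi> (?i h) ?\<rho> \<in> R" using h \<rho>' \<pi>_closed by simp
      then have c: "c h ?\<rho> \<in> carrier K" "\<theta> (\<pi> (?i h) ?\<rho>) \<in> carrier K"
        using c_unit[OF h \<rho>'] \<theta> by auto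
      have "\<pi> (?i (g \<otimes>\<^bsub>Gal K k\<^esub> h)) \<rho> = \<pi> (?i h) ?\<rho>"
        using g h \<rho> by (simp add: \<Gamma>.inv_mult_group \<pi>_mult)
      then show "c g \<rho> \<otimes> g (c h ?\<rho> \<otimes> h (\<theta> (\<pi> (?i h) ?\<rho>))) = ?t (g \<otimes>\<^bsub>Gal K k\<^esub> h)"
        using c cg g h \<rho> by (simp add: cocycle Gal_mult Gal_closed m_assoc)
    qed (use summand \<rho> g in auto)
    also have "\<dots> = (\<Oplus>h\<in>(\<otimes>\<^bsub>Gal K k\<^esub>) g ` ?\<Gamma>. ?t h)"
      by (rule finsum_reindex[symmetric]) (use summand \<rho> g in \<open>auto simp: inj_on_def\<close>)
    also have "\<dots> = b \<rho>" using g by (simp add: b_def \<Gamma>.surj_const_mult)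
    finally show ?thesis .
  qed
  have b_rep: "b (rep \<rho>) \<noteq> \<zero>" if \<rho>: "\<rho> \<in> R" for \<rho>
  proof -
    let ?r = "rep \<rho>"
    obtain g where g: "g \<in> ?\<Gamma>" "?r = \<pi> g \<rho>" using rep[OF \<rho>] by (auto simp: orbit_def)
    then have r: "?r \<in> R" "rep ?r = ?r" using \<rho> \<pi>_closed rep_\<pi>[of g \<rho>] by auto
    let ?t = "\<lambda>h. c h ?r \<otimes> h (\<theta> (\<pi> (?i h) ?r))"
    have "b ?r = (\<Oplus>h\<in>stab ?r. c h ?r \<otimes> h (SOME t. P ?r t))"
      unfolding b_def
    proof (rule add.finprod_mono_neutral_cong_right)
      show "finite ?\<Gamma>" "stab ?r \<subseteq> ?\<Gamma>" using finite_Gal by (auto simp: stab_def)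
      show "?t \<in> ?\<Gamma> \<rightarrow> carrier K" using summand r by auto
      show "?t h = c h ?r \<otimes> h (SOME t. P ?r t)" if "h \<in> stab ?r" for h
        using that r by (simp add: stab_def \<theta>_def)
      show "?t h = \<zero>" if h: "h \<in> ?\<Gamma> - stab ?r" for h
      proof -
        from h have "rep (\<pi> (?i h) ?r) \<noteq> \<pi> (?i h) ?r"
          using rep_\<pi>[of "?i h" ?r] r by (auto simp: stab_def)
        then have "h (\<theta> (\<pi> (?i h) ?r)) = \<zero>"
          using h by (simp add: \<theta>_def ring_hom_cring.hom_zero[OF Gal_ring_hom_cring])
        then show ?thesis using c_unit[of h ?r] h r by simp
      qed
    qed
    then show ?thesis using P[OF r(1)] by (simp add: P_def)
  qed
  \<comment> \<open>zeros of \<open>b\<close> propagate along orbits, up to the representative\<close>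
  have b_nonzero: "b \<rho> \<noteq> \<zero>" if \<rho>: "\<rho> \<in> R" for \<rho>
  proof
    assume b0: "b \<rho> = \<zero>"
    obtain g where g: "g \<in> ?\<Gamma>" "rep \<rho> = \<pi> g \<rho>" using rep[OF \<rho>] by (auto simp: orbit_def)
    have r: "rep \<rho> \<in> R" using g \<rho> \<pi>_closed by simp
    have "\<pi> (?i g) (rep \<rho>) = \<rho>" using g \<rho> by (simp add: \<pi>_mult[symmetric] \<pi>_one)
    then have "b (rep \<rho>) = c g (rep \<rho>) \<otimes> g \<zero>" using b_eq[OF g(1) r] b0 by simp
    then show False
      using b_rep[OF \<rho>] c_unit[OF g(1) r] ring_hom_cring.hom_zero[OF Gal_ring_hom_cring[OF g(1)]]
      by simp
  qed
  show ?thesis using b_closed b_nonzero b_eq by blast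
qed

end

section \<open>Lattices, cones and rays\<close>

lemma int_span_finite:
  assumes "finite B"
  shows "int_span B = range (\<lambda>c. \<Sum>b\<in>B. of_int (c b) *\<^sub>R b)"
proof
  show "int_span B \<subseteq> range (\<lambda>c. \<Sum>b\<in>B. of_int (c b) *\<^sub>R b)"
  proof
    fix x assume "x \<in> int_span B"
    then obtain T c where T: "T \<subseteq> B" "x = (\<Sum>b\<in>T. of_int (c b) *\<^sub>R b)"
      unfolding int_span_def by blast
    have "x = (\<Sum>b\<in>B. of_int (if b \<in> T then c b else 0) *\<^sub>R b)"
      unfolding T(2) by (rule sum.mono_neutral_cong_left) (use T assms in auto)
    then show "x \<in> range (\<lambda>c. \<Sum>b\<in>B. of_int (c b) *\<^sub>R b)" by (intro range_eqI[where x = "\<lambda>b. if b \<in> T then c b else 0"])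
  qed
  show "range (\<lambda>c. \<Sum>b\<in>B. of_int (c b) *\<^sub>R b) \<subseteq> int_span B"
    unfolding int_span_def using assms by blast
qed

lemma full_latticeE:
  assumes "full_lattice N"
  obtains B where "finite B" "independent B" "span B = UNIV" "B \<subseteq> N"
    "N = range (\<lambda>c. \<Sum>b\<in>B. of_int (c b) *\<^sub>R b)"
proof -
  obtain B where B: "finite B" "independent B" "span B = UNIV" "N = int_span B"
    using assms by (auto simp: full_lattice_def)
  have N: "N = range (\<lambda>c. \<Sum>b\<in>B. of_int (c b) *\<^sub>R b)"
    unfolding B(4) by (rule int_span_finite[OF B(1)])
  have "b \<in> N" if b: "b \<in> B" for b
  proof -
    have "(\<Sum>x\<in>B. of_int (if x = b then 1 else 0) *\<^sub>R x) = (\<Sum>x\<in>B. if x = b then b else 0)"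
      by (rule sum.cong) auto
    then have "b = (\<Sum>x\<in>B. of_int (if x = b then 1 else 0) *\<^sub>R x)"
      using B(1) b by simp
    then show ?thesis unfolding N by (intro range_eqI[where x = "\<lambda>x. if x = b then 1 else 0"])
  qed
  then have "B \<subseteq> N" by (rule subsetI)
  then show ?thesis by (rule that[OF B(1-3) _ N])
qed

lemma lattice_add:
  assumes "full_lattice N" "x \<in> N" "y \<in> N" shows "x + y \<in> N"
proof -
  obtain B where N: "N = range (\<lambda>c. \<Sum>b\<in>B. of_int (c b) *\<^sub>R b)"
    using assms(1) by (rule full_latticeE)
  obtain c where c: "x = (\<Sum>b\<in>B. of_int (c b) *\<^sub>R b)" using assms(2) unfolding N by (rule rangeE)
  obtain d where d: "y = (\<Sum>b\<in>B. of_int (d b) *\<^sub>R b)" using assms(3) unfolding N by (rule rangeE)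
  have "x + y = (\<Sum>b\<in>B. of_int (c b + d b) *\<^sub>R b)"
    unfolding c d by (simp add: sum.distrib scaleR_add_left)
  then show ?thesis unfolding N by (intro range_eqI[where x = "\<lambda>b. c b + d b"])
qed

lemma lattice_scale:
  assumes "full_lattice N" "x \<in> N" shows "of_int m *\<^sub>R x \<in> N"
proof -
  obtain B where N: "N = range (\<lambda>c. \<Sum>b\<in>B. of_int (c b) *\<^sub>R b)"
    using assms(1) by (rule full_latticeE)
  obtain c where c: "x = (\<Sum>b\<in>B. of_int (c b) *\<^sub>R b)" using assms(2) unfolding N by (rule rangeE)
  have "of_int m *\<^sub>R x = (\<Sum>b\<in>B. of_int (m * c b) *\<^sub>R b)"
    unfolding c by (simp add: scaleR_right.sum)
  then show ?thesis unfolding N by (intro range_eqI[where x = "\<lambda>b. m * c b"])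
qed

lemma lattice_uminus: "full_lattice N \<Longrightarrow> x \<in> N \<Longrightarrow> - x \<in> N"
  using lattice_scale[of N x "-1"] by simp

lemma lattice_zero:
  assumes "full_lattice N" shows "0 \<in> N"
proof -
  obtain B where N: "N = range (\<lambda>c. \<Sum>b\<in>B. of_int (c b) *\<^sub>R b)"
    using assms by (rule full_latticeE)
  have "0 = (\<Sum>b\<in>B. of_int 0 *\<^sub>R b)" by simp
  then show ?thesis unfolding N by (intro range_eqI[where x = "\<lambda>_. 0"])
qed

lemma comm_group_add_group:
  assumes "full_lattice N" shows "comm_group (add_group N)"
proof (rule comm_groupI)
  show "\<exists>y\<in>carrier (add_group N). y \<otimes>\<^bsub>add_group N\<^esub> x = \<one>\<^bsub>add_group N\<^esub>"
    if "x \<in> carrier (add_group N)" for x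
    using that lattice_uminus[OF assms] by (auto simp: add_group_def intro!: bexI[of _ "- x"])
qed (use lattice_add[OF assms] lattice_zero[OF assms] in \<open>auto simp: add_group_def\<close>)

text \<open>A character of \<open>N\<close> is additive only, but it agrees on \<open>N\<close> with the linear form that has the same
  values on a lattice basis.\<close>

lemma lattice_functional:
  assumes N: "full_lattice N" and u: "u \<in> hom (add_group N) integer_group"
  shows "\<exists>L. linear L \<and> (\<forall>n\<in>N. L n = real_of_int (u n))"
proof -
  obtain B where B: "finite B" "independent B" "span B = UNIV" "B \<subseteq> N"
    "N = range (\<lambda>c. \<Sum>b\<in>B. of_int (c b) *\<^sub>R b)"
    using N by (rule full_latticeE)
  obtain L :: "'a \<Rightarrow> real" where L: "linear L" "\<And>b. b \<in> B \<Longrightarrow> L b = real_of_int (u b)"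
    using linear_independent_extend[OF B(2), of "\<lambda>b. real_of_int (u b)"] by blast
  have add: "u (x + y) = u x + u y" if "x \<in> N" "y \<in> N" for x y
    using u that by (auto simp: hom_def add_group_def)
  have zero: "u 0 = 0" using add[of 0 0] lattice_zero[OF N] by simp
  have uminus: "u (- x) = - u x" if "x \<in> N" for x
    using add[of x "- x"] that lattice_uminus[OF N] zero by simp
  have scale: "u (of_int m *\<^sub>R x) = m * u x" if x: "x \<in> N" for m x
  proof (induction m rule: int_induct[where k = 0])
    case (step1 i)
    have "of_int (i + 1) *\<^sub>R x = of_int i *\<^sub>R x + x" by (simp add: scaleR_add_left)
    then have "u (of_int (i + 1) *\<^sub>R x) = u (of_int i *\<^sub>R x) + u x"
      using add x lattice_scale[OF N x] by simp
    then show ?case using step1 by (simp add: algebra_simps)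
  next
    case (step2 i)
    have "of_int (i - 1) *\<^sub>R x = of_int i *\<^sub>R x + (- x)" by (simp add: scaleR_diff_left)
    then have "u (of_int (i - 1) *\<^sub>R x) = u (of_int i *\<^sub>R x) - u x"
      using add[OF lattice_scale[OF N x] lattice_uminus[OF N x]] uminus[OF x] by simp
    then show ?case using step2 by (simp add: algebra_simps)
  qed (simp add: zero)
  have sum: "(\<Sum>b\<in>F. of_int (c b) *\<^sub>R b) \<in> N \<and>
      real_of_int (u (\<Sum>b\<in>F. of_int (c b) *\<^sub>R b)) = L (\<Sum>b\<in>F. of_int (c b) *\<^sub>R b)"
    if "finite F" "F \<subseteq> B" for F c
    using that
  proof (induction F rule: finite_induct)
    case empty
    then show ?case using lattice_zero[OF N] zero linear_0[OF L(1)] by simp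
  next
    case (insert b F)
    have b: "b \<in> N" "b \<in> B" using insert.prems B(4) by auto
    let ?x = "of_int (c b) *\<^sub>R b" and ?y = "\<Sum>b\<in>F. of_int (c b) *\<^sub>R b"
    have x: "?x \<in> N" by (rule lattice_scale[OF N b(1)])
    have "F \<subseteq> B" using insert.prems by simp
    then have y: "?y \<in> N" "real_of_int (u ?y) = L ?y" using insert.IH by blast+
    have "real_of_int (u (?x + ?y)) = of_int (u ?x) + of_int (u ?y)"
      using add[OF x y(1)] by simp
    also have "\<dots> = L (?x + ?y)"
      unfolding scale[OF b(1)] y(2) linear_add[OF L(1)] linear_scale[OF L(1)] L(2)[OF b(2)]
      by simp
    finally show ?case using lattice_add[OF N x y(1)] insert.hyps by simp
  qed
  have "L n = real_of_int (u n)" if n: "n \<in> N" for n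
  proof -
    obtain c where "n = (\<Sum>b\<in>B. of_int (c b) *\<^sub>R b)" using n unfolding B(5) by (rule rangeE)
    then show ?thesis using sum[of B c] B(1) by simp
  qed
  then show ?thesis using L(1) by blast
qed

text \<open>A coordinate of \<open>s\<close> that does not vanish.  Such a form is injective on the line of \<open>s\<close> and so
  identifies the lattice points of this line with a group of integers.\<close>

lemma lattice_separating_functional:
  assumes N: "full_lattice N" and s: "s \<in> N" "s \<noteq> 0"
  shows "\<exists>L. linear L \<and> (\<forall>n\<in>N. L n \<in> \<int>) \<and> L s \<noteq> (0::real)"
proof -
  obtain B where B: "finite B" "independent B" "span B = UNIV" "B \<subseteq> N"
    "N = range (\<lambda>c. \<Sum>b\<in>B. of_int (c b) *\<^sub>R b)"
    using N by (rule full_latticeE)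
  obtain c where c: "s = (\<Sum>b\<in>B. of_int (c b) *\<^sub>R b)" using s(1) unfolding B(5) by (rule rangeE)
  have "\<exists>b\<in>B. c b \<noteq> 0"
  proof (rule ccontr)
    assume "\<not> (\<exists>b\<in>B. c b \<noteq> 0)"
    then have "s = 0" unfolding c by (intro sum.neutral) auto
    then show False using s(2) by simp
  qed
  then obtain b where b: "b \<in> B" "c b \<noteq> 0" by blast
  obtain L :: "'a \<Rightarrow> real" where L: "linear L" "\<And>x. x \<in> B \<Longrightarrow> L x = (if x = b then 1 else 0)"
    using linear_independent_extend[OF B(2), of "\<lambda>x. if x = b then 1 else 0"] by blast
  have Lsum: "L (\<Sum>x\<in>B. of_int (d x) *\<^sub>R x) = of_int (d b)" for d
  proof -
    have "L (\<Sum>x\<in>B. of_int (d x) *\<^sub>R x) = (\<Sum>x\<in>B. of_int (d x) * L x)"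
      by (simp add: linear_sum[OF L(1)] linear_scale[OF L(1)])
    also have "\<dots> = (\<Sum>x\<in>B. if x = b then of_int (d b) else 0)"
      by (rule sum.cong) (auto simp: L(2))
    finally show ?thesis using B(1) b(1) by simp
  qed
  have "\<forall>n\<in>N. L n \<in> \<int>" unfolding B(5) using Lsum by simp
  moreover have "L s \<noteq> 0" using Lsum[of c] c b(2) by simp
  ultimately show ?thesis using L(1) by blast
qed

lemma convex_cone_hull_sing: "convex_cone hull {s} = (\<lambda>c. c *\<^sub>R s) ` {0..}"
  by (auto simp: convex_cone_hull_convex_hull_nonempty)

lemma convex_cone_hull_sing_scale:
  assumes "c > 0" shows "convex_cone hull {c *\<^sub>R s} = convex_cone hull {s}"
proof
  show "convex_cone hull {c *\<^sub>R s} \<subseteq> convex_cone hull {s}"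
    by (rule hull_minimal)
      (use assms in \<open>auto intro: convex_cone_hull_mul hull_inc simp: convex_cone_convex_cone_hull\<close>)
  have "(1 / c) *\<^sub>R c *\<^sub>R s \<in> convex_cone hull {c *\<^sub>R s}"
    using assms by (intro convex_cone_hull_mul[OF hull_inc]) simp_all
  moreover have "(1 / c) *\<^sub>R c *\<^sub>R s = s" using assms by simp
  ultimately have "s \<in> convex_cone hull {c *\<^sub>R s}" by metis
  then show "convex_cone hull {s} \<subseteq> convex_cone hull {c *\<^sub>R s}"
    by (intro hull_minimal) (simp_all add: convex_cone_convex_cone_hull)
qed

text \<open>If \<open>ts\<close> lies strictly between \<open>a = \<alpha>s + a'\<close> and \<open>b = \<beta>s + b'\<close>, with \<open>a'\<close> and \<open>b'\<close> in the cone over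
  the other generators, then some multiple \<open>\<gamma>s\<close> equals a positive combination of \<open>a'\<close> and \<open>b'\<close>.  A
  positive \<open>\<gamma>\<close> would make \<open>s\<close> redundant, a negative one would put a line into the cone; and for
  \<open>\<gamma> = 0\<close> strong convexity forces \<open>a' = b' = 0\<close>.\<close>

lemma irredundant_generator_face:
  assumes sc: "strongly_convex (convex_cone hull S)" and s: "s \<in> S"
    and irr: "s \<notin> convex_cone hull (S - {s})"
  shows "(convex_cone hull {s}) face_of (convex_cone hull S)"
  unfolding face_of_def
proof (intro conjI ballI impI)
  let ?\<sigma> = "convex_cone hull S" and ?T = "convex_cone hull (S - {s})"
  show "convex_cone hull {s} \<subseteq> ?\<sigma>" using s by (intro hull_mono) simp
  show "convex (convex_cone hull {s})" by (rule convex_convex_cone_hull)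
  fix a b x assume a: "a \<in> ?\<sigma>" and b: "b \<in> ?\<sigma>" and x: "x \<in> convex_cone hull {s}"
    and seg: "x \<in> open_segment a b"
  have T\<sigma>: "?T \<subseteq> ?\<sigma>" by (rule hull_mono) auto
  have s\<sigma>: "s \<in> ?\<sigma>" using s by (rule hull_inc)
  have s0: "s \<noteq> 0" using irr convex_cone_hull_contains_0 by metis
  have decomp: "\<exists>\<alpha>\<ge>0. \<exists>y\<in>?T. z = \<alpha> *\<^sub>R s + y" if "z \<in> ?\<sigma>" for z
  proof -
    have "{s} \<union> (S - {s}) = S" using s by auto
    then have "z \<in> (\<Union>x\<in>convex_cone hull {s}. \<Union>y\<in>?T. {x + y})"
      using that convex_cone_hull_Un[of "{s}" "S - {s}"] by simp
    then show ?thesis by (auto simp: convex_cone_hull_sing)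
  qed
  obtain \<alpha> a' where a': "\<alpha> \<ge> 0" "a' \<in> ?T" "a = \<alpha> *\<^sub>R s + a'" using decomp[OF a] by blast
  obtain \<beta> b' where b': "\<beta> \<ge> 0" "b' \<in> ?T" "b = \<beta> *\<^sub>R s + b'" using decomp[OF b] by blast
  obtain t where t: "x = t *\<^sub>R s" using x by (auto simp: convex_cone_hull_sing)
  obtain u where u: "0 < u" "u < 1" "x = (1 - u) *\<^sub>R a + u *\<^sub>R b"
    using seg by (auto simp: in_segment)
  define \<gamma> where "\<gamma> = t - (1 - u) * \<alpha> - u * \<beta>"
  have w: "\<gamma> *\<^sub>R s = (1 - u) *\<^sub>R a' + u *\<^sub>R b'"
    using u(3) unfolding t a'(3) b'(3) \<gamma>_def by (simp add: algebra_simps)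
  have wa: "(1 - u) *\<^sub>R a' \<in> ?T" and wb: "u *\<^sub>R b' \<in> ?T"
    using a'(2) b'(2) u by (auto intro: convex_cone_hull_mul)
  then have wT: "\<gamma> *\<^sub>R s \<in> ?T" unfolding w by (rule convex_cone_hull_add)
  have pointed: "y = 0" if "y \<in> ?\<sigma>" "- y \<in> ?\<sigma>" for y
  proof -
    have "y \<in> uminus ` ?\<sigma>" using that(2) by (metis imageI minus_minus)
    then show ?thesis using that(1) sc by (auto simp: strongly_convex_def)
  qed
  have "\<gamma> = 0"
  proof (rule ccontr)
    assume "\<gamma> \<noteq> 0"
    then consider "\<gamma> > 0" | "\<gamma> < 0" by linarith
    then show False
    proof cases
      case 1
      then have "(1 / \<gamma>) *\<^sub>R \<gamma> *\<^sub>R s \<in> ?T" by (intro convex_cone_hull_mul[OF wT]) simp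
      moreover have "(1 / \<gamma>) *\<^sub>R \<gamma> *\<^sub>R s = s" using 1 by simp
      ultimately show False using irr by metis
    next
      case 2
      then have "(1 / - \<gamma>) *\<^sub>R \<gamma> *\<^sub>R s \<in> ?T" by (intro convex_cone_hull_mul[OF wT]) simp
      moreover have "(1 / - \<gamma>) *\<^sub>R \<gamma> *\<^sub>R s = - s" using 2 by simp
      ultimately have "- s \<in> ?T" by metis
      then show False using pointed[OF s\<sigma>] T\<sigma> s0 by blast
    qed
  qed
  then have eq: "(1 - u) *\<^sub>R a' = - (u *\<^sub>R b')" using w by (simp add: eq_neg_iff_add_eq_0)
  have "(1 - u) *\<^sub>R a' = 0"
    by (rule pointed) (use wa wb T\<sigma> eq in auto)
  then have "a' = 0" "b' = 0" using eq u by auto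
  then show "a \<in> convex_cone hull {s} " "b \<in> convex_cone hull {s}"
    using a' b' by (auto simp: convex_cone_hull_sing)
qed

text \<open>Any generating set of minimal size consists of generators of rays.\<close>

lemma cone_generated_by_rays:
  assumes "rational_polyhedral_cone N \<sigma>" "strongly_convex \<sigma>"
  shows "\<exists>S. finite S \<and> S \<subseteq> N \<and> \<sigma> = convex_cone hull S \<and>
    (\<forall>s\<in>S. s \<noteq> 0 \<and> (convex_cone hull {s}) face_of \<sigma>)"
proof -
  let ?P = "\<lambda>S. finite S \<and> S \<subseteq> N \<and> \<sigma> = convex_cone hull S"
  obtain S0 where "?P S0" using assms(1) by (auto simp: rational_polyhedral_cone_def)
  then obtain S where S: "?P S" and min: "\<And>S'. ?P S' \<Longrightarrow> card S \<le> card S'"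
    using ex_has_least_nat[of ?P S0 card] by blast
  have irr: "s \<notin> convex_cone hull (S - {s})" if s: "s \<in> S" for s
  proof
    assume "s \<in> convex_cone hull (S - {s})"
    then have "convex_cone hull (insert s (S - {s})) = convex_cone hull (S - {s})"
      by (rule hull_redundant)
    then have "?P (S - {s})" using S s by (auto simp: insert_absorb)
    then have "card S \<le> card (S - {s})" by (rule min)
    then show False using S s by (metis card_Diff1_less linorder_not_less)
  qed
  have "s \<noteq> 0 \<and> (convex_cone hull {s}) face_of \<sigma>" if s: "s \<in> S" for s
    using irr[OF s] convex_cone_hull_contains_0 irredundant_generator_face[OF _ s irr[OF s]]
      assms(2) S by metis
  then show ?thesis using S by blast
qed

lemma dim_ray: assumes "s \<noteq> 0" shows "dim (convex_cone hull {s}) = 1"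
proof -
  have "card {s} = dim (convex_cone hull {s})"
  proof (rule basis_card_eq_dim)
    show "{s} \<subseteq> convex_cone hull {s}" by (simp add: hull_inc)
    show "convex_cone hull {s} \<subseteq> span {s}"
      by (auto simp: convex_cone_hull_sing intro: span_base span_scale)
  qed (use assms in simp)
  then show ?thesis by simp
qed

lemma one_dimensional_cone:
  assumes "rational_polyhedral_cone N \<rho>" "strongly_convex \<rho>" "dim \<rho> = 1"
  shows "\<exists>s\<in>N. s \<noteq> 0 \<and> \<rho> = convex_cone hull {s}"
proof -
  obtain S where S: "S \<subseteq> N" "\<rho> = convex_cone hull S" "\<And>s. s \<in> S \<Longrightarrow> s \<noteq> 0"
    using cone_generated_by_rays[OF assms(1,2)] by blast
  have "S \<noteq> {}"
  proof
    assume "S = {}"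
    then have "\<rho> \<subseteq> span {}" using S(2) by simp
    then have "dim \<rho> \<le> card ({} :: 'a set)" by (intro dim_le_card) auto
    then show False using assms(3) by simp
  qed
  then obtain s where s: "s \<in> S" "s \<in> N" "s \<noteq> 0" using S by blast
  have s\<rho>: "s \<in> \<rho>" using S(2) s(1) by (simp add: hull_inc)
  obtain B where B: "\<rho> \<subseteq> span B" "card B = 1" using basis_exists[of \<rho>] assms(3) by metis
  then obtain b where b: "B = {b}" by (auto simp: card_1_singleton_iff)
  then obtain c where c: "s = c *\<^sub>R b" using B(1) s\<rho> by (auto simp: span_singleton)
  have "\<rho> \<subseteq> convex_cone hull {s}"
  proof
    fix x assume x: "x \<in> \<rho>"
    then obtain d where d: "x = d *\<^sub>R b" using B(1) b by (auto simp: span_singleton)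
    have "c \<noteq> 0" using c s(3) by auto
    then have "x = (d / c) *\<^sub>R s" using c d by simp
    then obtain r where xs: "x = r *\<^sub>R s" by blast
    have "r \<ge> 0"
    proof (rule ccontr)
      assume neg: "\<not> r \<ge> 0"
      then have "(1 / - r) *\<^sub>R x \<in> \<rho>"
        using x unfolding S(2) by (intro convex_cone_hull_mul) auto
      moreover have "(1 / - r) *\<^sub>R x = - s" unfolding xs using neg by simp
      ultimately have "s \<in> uminus ` \<rho>" by (metis imageI minus_minus)
      then show False using s\<rho> s(3) assms(2) by (auto simp: strongly_convex_def)
    qed
    then show "x \<in> convex_cone hull {s}" using xs by (auto simp: convex_cone_hull_sing)
  qed
  moreover have "convex_cone hull {s} \<subseteq> \<rho>" unfolding S(2) using s(1) by (intro hull_mono) simp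
  ultimately show ?thesis using s by blast
qed

text \<open>Among the lattice points of the ray take one, \<open>v\<close>, at which the absolute value of a separating
  functional is minimal.  A divisor of \<open>v\<close> in \<open>N\<close> would have a smaller value, and so would the
  remainder of another lattice point of the ray on division by \<open>v\<close>; hence \<open>v\<close> is primitive and all
  lattice points of the ray are multiples of \<open>v\<close>.\<close>

lemma primitive_generator:
  assumes N: "full_lattice N" and s: "s \<in> N" "s \<noteq> 0"
  shows "\<exists>!v. primitive N v \<and> convex_cone hull {s} = convex_cone hull {v}"
proof -
  obtain L :: "'a \<Rightarrow> real" where L: "linear L" "\<And>n. n \<in> N \<Longrightarrow> L n \<in> \<int>" "L s \<noteq> 0"
    using lattice_separating_functional[OF N s] by blast
  let ?D = "\<lambda>w. w \<in> N \<and> (\<exists>c>0. w = c *\<^sub>R s)"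
  have "?D s" using s by (auto intro: exI[of _ 1])
  then obtain v where v: "?D v" and min: "\<And>w. ?D w \<Longrightarrow> nat \<lfloor>\<bar>L v\<bar>\<rfloor> \<le> nat \<lfloor>\<bar>L w\<bar>\<rfloor>"
    using ex_has_least_nat[of ?D s "\<lambda>w. nat \<lfloor>\<bar>L w\<bar>\<rfloor>"] by blast
  have Lmin: "\<bar>L v\<bar> \<le> \<bar>L w\<bar>" if w: "?D w" for w
  proof -
    have "\<bar>L v\<bar> \<in> \<int>" "\<bar>L w\<bar> \<in> \<int>" using L(2) v w by auto
    then obtain a b where ab: "\<bar>L v\<bar> = of_int a" "\<bar>L w\<bar> = of_int b" by (auto elim!: Ints_cases)
    then have "a \<ge> 0" "b \<ge> 0" by (metis abs_ge_zero of_int_0_le_iff)+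
    then show ?thesis using min[OF w] ab by simp
  qed
  obtain c where c: "c > 0" "v = c *\<^sub>R s" "v \<in> N" using v by blast
  have v0: "v \<noteq> 0" using c s by simp
  have Lv: "L v \<noteq> 0" using c L by (simp add: linear_scale)
  have "\<bar>m\<bar> = 1" if w: "w \<in> N" "v = of_int m *\<^sub>R w" for w m
  proof -
    have m: "m \<noteq> 0" using v0 w(2) by auto
    have wv: "w = (1 / of_int m) *\<^sub>R v" using w(2) m by simp
    have "of_int (sgn m) *\<^sub>R w = (1 / \<bar>of_int m\<bar>) *\<^sub>R v"
      unfolding wv using m by (simp add: sgn_if)
    also have "\<dots> = (c / \<bar>of_int m\<bar>) *\<^sub>R s" by (simp add: c(2))
    finally have "?D (of_int (sgn m) *\<^sub>R w)" 
      using lattice_scale[OF N w(1)] c(1) m by (metis divide_pos_pos of_int_eq_0_iff zero_less_abs_iff)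
    then have "\<bar>L v\<bar> \<le> \<bar>L (of_int (sgn m) *\<^sub>R w)\<bar>" by (rule Lmin)
    also have "\<dots> = \<bar>L v\<bar> / \<bar>of_int m\<bar>"
      using m by (simp add: wv linear_scale[OF L(1)] abs_mult sgn_if)
    finally have "\<bar>L v\<bar> * \<bar>of_int m\<bar> \<le> \<bar>L v\<bar> * 1" using m by (simp add: field_simps)
    then have "\<bar>of_int m\<bar> \<le> (1::real)" using Lv by (meson mult_left_le_imp_le zero_less_abs_iff)
    then have "\<bar>m\<bar> \<le> 1" by linarith
    then show ?thesis using m by linarith
  qed
  then have pv: "primitive N v" using c(3) v0 by (auto simp: primitive_def)
  have hv: "convex_cone hull {s} = convex_cone hull {v}"
    using convex_cone_hull_sing_scale[OF c(1), of s] c(2) by simp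
  have "v' = v" if v': "primitive N v'" "convex_cone hull {s} = convex_cone hull {v'}" for v'
  proof -
    have v'N: "v' \<in> N" "v' \<noteq> 0" using v'(1) by (auto simp: primitive_def)
    have "v' \<in> convex_cone hull {v}" using v'(2) hv by (metis hull_inc singletonI)
    then obtain r where r: "r \<ge> 0" "v' = r *\<^sub>R v" by (auto simp: convex_cone_hull_sing)
    then have r0: "r > 0" using v'N(2) by (cases "r = 0") auto
    \<comment> \<open>the remainder of \<open>v'\<close> on division by \<open>v\<close>\<close>
    let ?w = "v' - of_int \<lfloor>r\<rfloor> *\<^sub>R v"
    have w: "?w = (r - of_int \<lfloor>r\<rfloor>) *\<^sub>R v" by (simp add: r(2) scaleR_diff_left)
    have "r = of_int \<lfloor>r\<rfloor>"
    proof (rule ccontr)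
      assume ne: "r \<noteq> of_int \<lfloor>r\<rfloor>"
      have fr: "0 < r - of_int \<lfloor>r\<rfloor>" "r - of_int \<lfloor>r\<rfloor> < 1"
        using ne by linarith+
      have "?w = ((r - of_int \<lfloor>r\<rfloor>) * c) *\<^sub>R s" unfolding w by (simp add: c(2))
      moreover have "?w \<in> N"
        using lattice_add[OF N v'N(1) lattice_uminus[OF N lattice_scale[OF N c(3)]]] by simp
      ultimately have "?D ?w" using fr(1) c(1) by (metis mult_pos_pos)
      then have "\<bar>L v\<bar> \<le> \<bar>L ?w\<bar>" by (rule Lmin)
      also have "\<dots> = (r - of_int \<lfloor>r\<rfloor>) * \<bar>L v\<bar>"
        unfolding w linear_scale[OF L(1)] using fr(1) by (simp add: abs_mult)
      also have "\<dots> < 1 * \<bar>L v\<bar>" using fr(2) Lv by (intro mult_strict_right_mono) auto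
      finally show False by simp
    qed
    then have q: "v' = of_int \<lfloor>r\<rfloor> *\<^sub>R v" using r(2) by simp
    then have "\<bar>\<lfloor>r\<rfloor>\<bar> = 1" using v'(1) c(3) unfolding primitive_def by blast
    then have "\<lfloor>r\<rfloor> = 1" using r0 by linarith
    then show ?thesis using q by simp
  qed
  then show ?thesis using pv hv by (intro ex1I[of _ v]) simp_all
qed

text \<open>This makes the definite description in \<open>ray_gen\<close> meaningful.\<close>

lemma ray_gen_unique:
  assumes N: "full_lattice N" and F: "fan N \<Sigma>" and \<rho>: "\<rho> \<in> rays \<Sigma>"
  shows "\<exists>!v. primitive N v \<and> \<rho> = convex_cone hull {v}"
proof -
  have "rational_polyhedral_cone N \<rho>" "strongly_convex \<rho>" "dim \<rho> = 1"
    using F \<rho> by (auto simp: fan_def rays_def)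
  then obtain s where s: "s \<in> N" "s \<noteq> 0" "\<rho> = convex_cone hull {s}"
    using one_dimensional_cone by blast
  then show ?thesis using primitive_generator[OF N s(1,2)] by simp
qed

lemma ray_gen:
  assumes "full_lattice N" "fan N \<Sigma>" "\<rho> \<in> rays \<Sigma>"
  shows "primitive N (ray_gen N \<rho>)" "\<rho> = convex_cone hull {ray_gen N \<rho>}"
  using theI'[OF ray_gen_unique[OF assms]] unfolding ray_gen_def by blast+

lemma ray_gen_in_lattice:
  assumes "full_lattice N" "fan N \<Sigma>" "\<rho> \<in> rays \<Sigma>"
  shows "ray_gen N \<rho> \<in> N" "ray_gen N \<rho> \<noteq> 0"
  using ray_gen(1)[OF assms] by (auto simp: primitive_def)

lemma ray_gen_eqI:
  assumes "full_lattice N" "fan N \<Sigma>" "\<rho> \<in> rays \<Sigma>" "primitive N v" "\<rho> = convex_cone hull {v}"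
  shows "ray_gen N \<rho> = v"
  using ray_gen_unique[OF assms(1-3)] ray_gen[OF assms(1-3)] assms(4,5) by blast

text \<open>Primitivity is invariant under automorphisms of \<open>N\<close>, so uniqueness of the generator gives the equation.\<close>

lemma fan_aut_rays:
  assumes N: "full_lattice N" and F: "fan N \<Sigma>" and f: "f \<in> carrier (fan_aut N \<Sigma>)"
    and \<rho>: "\<rho> \<in> rays \<Sigma>"
  shows "f ` \<rho> \<in> rays \<Sigma>" "ray_gen N (f ` \<rho>) = f (ray_gen N \<rho>)"
proof -
  let ?v = "ray_gen N \<rho>"
  have f: "linear f" "bij f" "f ` N = N" "(\<lambda>\<sigma>. f ` \<sigma>) ` \<Sigma> = \<Sigma>"
    using f by (auto simp: fan_aut_def)
  have hull: "f ` \<rho> = convex_cone hull {f ?v}"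
    using ray_gen(2)[OF N F \<rho>] convex_cone_hull_linear_image[OF f(1), of "{?v}"] by simp
  have v: "?v \<in> N" "?v \<noteq> 0" using ray_gen_in_lattice[OF N F \<rho>] by auto
  have fv: "f ?v \<in> N" "f ?v \<noteq> 0"
  proof -
    show "f ?v \<in> N" using v(1) f(3) by blast
    show "f ?v \<noteq> 0"
      using v(2) linear_0[OF f(1)] injD[OF bij_is_inj[OF f(2)], of ?v 0] by auto
  qed
  have "f ` \<rho> \<in> \<Sigma>" using f(4) \<rho> by (auto simp: rays_def)
  then show r: "f ` \<rho> \<in> rays \<Sigma>" using dim_ray[OF fv(2)] by (simp add: rays_def hull)
  have "primitive N (f ?v)"
    unfolding primitive_def
  proof (intro conjI ballI allI impI)
    fix w m assume w: "w \<in> N" "f ?v = of_int m *\<^sub>R w"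
    obtain w' where w': "w' \<in> N" "w = f w'" using w(1) f(3) by blast
    have "f ?v = f (of_int m *\<^sub>R w')" using w w' by (simp add: linear_scale[OF f(1)])
    then have "?v = of_int m *\<^sub>R w'" using bij_is_inj[OF f(2)] by (simp add: injD)
    then show "\<bar>m\<bar> = 1" using ray_gen(1)[OF N F \<rho>] w'(1) unfolding primitive_def by blast
  qed (use fv in auto)
  then show "ray_gen N (f ` \<rho>) = f ?v" using ray_gen_eqI[OF N F r] hull by blast
qed

text \<open>The rank condition is an equality of dimensions; in a space of finite dimension it forces the
  span of the lattice points of the cones to be everything.\<close>

lemma span_full_rank:
  assumes N: "full_lattice N" and sp: "spans_full_rank N \<Sigma>"
  shows "span (\<Union>\<Sigma>) = UNIV"
proof -
  obtain B where B: "finite B" "independent B" "span B = UNIV" "B \<subseteq> N"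
    using N by (rule full_latticeE)
  let ?I = "int_span (N \<inter> \<Union>\<Sigma>)"
  have "dim N = card B" using basis_card_eq_dim[OF B(4) _ B(2)] B(3) by simp
  then have dimI: "dim ?I = card B" using sp by (simp add: spans_full_rank_def)
  obtain C where C: "C \<subseteq> ?I" "independent C" "?I \<subseteq> span C" "card C = dim ?I"
    using basis_exists by blast
  have finC: "finite C" using independent_span_bound[OF B(1) C(2)] B(3) by simp
  have "span C = UNIV"
  proof (rule ccontr)
    assume "span C \<noteq> UNIV"
    then obtain x where x: "x \<notin> span C" by blast
    then have "independent (insert x C)" using C(2) by (rule independent_insertI)
    then have "card (insert x C) \<le> card B"
      using independent_span_bound[OF B(1), of "insert x C"] B(3) by simp
    moreover have "x \<notin> C" using x span_base by blast
    ultimately show False using finC C(4) dimI by simp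
  qed
  moreover have "?I \<subseteq> span (\<Union>\<Sigma>)"
    unfolding int_span_def by (auto intro!: span_sum span_scale intro: span_base)
  ultimately show ?thesis using C(1) by (metis span_minimal subspace_span subset_antisym subset_UNIV order_trans)
qed

text \<open>This is the injectivity of \<open>M \<rightarrow> \<int>\<^sup>\<Sigma>\<^sup>(\<^sup>1\<^sup>)\<close>.  Every cone of the fan is generated by faces of
  dimension 1, and these belong to the fan.\<close>

theorem character_vanishing_on_rays:
  assumes N: "full_lattice N" and F: "fan N \<Sigma>" and sp: "spans_full_rank N \<Sigma>"
    and u: "u \<in> hom (add_group N) integer_group" and n: "n \<in> N"
    and vanish: "\<And>\<rho>. \<rho> \<in> rays \<Sigma> \<Longrightarrow> u (ray_gen N \<rho>) = 0"
  shows "u n = 0"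
proof -
  obtain L :: "'a \<Rightarrow> real" where L: "linear L" "\<forall>n\<in>N. L n = of_int (u n)"
    using lattice_functional[OF N u] by blast
  have ker: "subspace {x. L x = 0}"
    using L(1) by (rule linear_subspace_kernel)
  have "\<sigma> \<subseteq> {x. L x = 0}" if \<sigma>: "\<sigma> \<in> \<Sigma>" for \<sigma>
  proof -
    have "rational_polyhedral_cone N \<sigma>" "strongly_convex \<sigma>" using F \<sigma> by (auto simp: fan_def)
    then obtain S where S: "\<sigma> = convex_cone hull S"
      "\<forall>s\<in>S. s \<noteq> 0 \<and> (convex_cone hull {s}) face_of \<sigma>"
      using cone_generated_by_rays by metis
    have "L s = 0" if s: "s \<in> S" for s
    proof -
      let ?\<rho> = "convex_cone hull {s}"
      have "?\<rho> \<in> \<Sigma>" using F \<sigma> bspec[OF S(2) s] convex_cone_hull_nonempty unfolding fan_def by metis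
      then have \<rho>: "?\<rho> \<in> rays \<Sigma>" using bspec[OF S(2) s] dim_ray[of s] by (simp add: rays_def)
      have "s \<in> ?\<rho>" by (simp add: hull_inc)
      then have "s \<in> convex_cone hull {ray_gen N ?\<rho>}" using ray_gen(2)[OF N F \<rho>] by simp
      then obtain c where c: "s = c *\<^sub>R ray_gen N ?\<rho>" by (auto simp: convex_cone_hull_sing)
      have "L (c *\<^sub>R ray_gen N ?\<rho>) = 0"
        using bspec[OF L(2) ray_gen_in_lattice(1)[OF N F \<rho>]] vanish[OF \<rho>] linear_scale[OF L(1)]
        by simp
      then show ?thesis using c by metis
    qed
    then show ?thesis unfolding S(1)
      by (intro hull_minimal subspace_imp_convex_cone[OF ker]) auto
  qed
  then have "span (\<Union>\<Sigma>) \<subseteq> {x. L x = 0}" by (intro span_minimal ker) auto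
  then have "L n = 0" using span_full_rank[OF N sp] by auto
  then show ?thesis using L(2) n by simp
qed

section \<open>Groups of homomorphisms and Ext\<close>

lemma carrier_hom_grp [simp]: "carrier (hom_grp A B) = hom A B \<inter> extensional (carrier A)"
  by (simp add: hom_grp_def)

lemma mult_hom_grp [simp]:
  "f \<otimes>\<^bsub>hom_grp A B\<^esub> g = (\<lambda>x\<in>carrier A. f x \<otimes>\<^bsub>B\<^esub> g x)"
  by (simp add: hom_grp_def)

lemma one_hom_grp [simp]: "\<one>\<^bsub>hom_grp A B\<^esub> = (\<lambda>x\<in>carrier A. \<one>\<^bsub>B\<^esub>)"
  by (simp add: hom_grp_def)

lemma restrict_hom:
  assumes "group A" "f \<in> hom A B"
  shows "restrict f (carrier A) \<in> carrier (hom_grp A B)"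
proof -
  interpret group A by fact
  show ?thesis using assms(2) by (auto simp: hom_def)
qed

lemma comm_group_hom_grp:
  assumes "group A" "comm_group B"
  shows "comm_group (hom_grp A B)"
proof -
  interpret A: group A by fact
  interpret B: comm_group B by fact
  have cl: "f x \<in> carrier B" if "f \<in> hom A B" "x \<in> carrier A" for f x
    using that by (auto simp: hom_def)
  show ?thesis
  proof (rule comm_groupI)
    fix f g assume "f \<in> carrier (hom_grp A B)" "g \<in> carrier (hom_grp A B)"
    then show "f \<otimes>\<^bsub>hom_grp A B\<^esub> g \<in> carrier (hom_grp A B)"
      by (auto intro!: homI simp: cl hom_mult B.m_ac)
  next
    show "\<one>\<^bsub>hom_grp A B\<^esub> \<in> carrier (hom_grp A B)" by (auto intro!: homI)
  next
    fix f assume f: "f \<in> carrier (hom_grp A B)"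
    let ?g = "\<lambda>x\<in>carrier A. inv\<^bsub>B\<^esub> f x"
    have "?g \<in> carrier (hom_grp A B)"
      using f by (auto intro!: homI simp: cl hom_mult B.inv_mult)
    moreover have "?g \<otimes>\<^bsub>hom_grp A B\<^esub> f = \<one>\<^bsub>hom_grp A B\<^esub>"
      using f by (auto simp: cl intro!: restrict_ext)
    ultimately show "\<exists>g\<in>carrier (hom_grp A B). g \<otimes>\<^bsub>hom_grp A B\<^esub> f = \<one>\<^bsub>hom_grp A B\<^esub>" by blast
    show "\<one>\<^bsub>hom_grp A B\<^esub> \<otimes>\<^bsub>hom_grp A B\<^esub> f = f"
      using f by (auto simp: cl intro!: extensionalityI[of _ "carrier A" f])
  qed (auto simp: cl B.m_ac intro!: restrict_ext)
qed

lemma hom_grpD: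
  assumes "f \<in> carrier (hom_grp A B)"
  shows "f \<in> hom A B" "\<And>x. x \<in> carrier A \<Longrightarrow> f x \<in> carrier B"
    "\<And>x y. x \<in> carrier A \<Longrightarrow> y \<in> carrier A \<Longrightarrow> f (x \<otimes>\<^bsub>A\<^esub> y) = f x \<otimes>\<^bsub>B\<^esub> f y"
    "f \<in> extensional (carrier A)"
  using assms by (auto simp: hom_def)

lemma hom_grp_eqI:
  assumes "f \<in> carrier (hom_grp A B)" "g \<in> carrier (hom_grp A B)"
    "\<And>x. x \<in> carrier A \<Longrightarrow> f x = g x"
  shows "f = g"
  using assms by (auto intro: extensionalityI)

lemma hom_grpI:
  assumes "\<And>x. x \<in> carrier A \<Longrightarrow> f x \<in> carrier B"
    "\<And>x y. x \<in> carrier A \<Longrightarrow> y \<in> carrier A \<Longrightarrow> f (x \<otimes>\<^bsub>A\<^esub> y) = f x \<otimes>\<^bsub>B\<^esub> f y"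
    "f \<in> extensional (carrier A)"
  shows "f \<in> carrier (hom_grp A B)"
  using assms by (auto intro: homI)

lemma hom_grp_one:
  assumes "group A" "group B" "f \<in> carrier (hom_grp A B)"
  shows "f \<one>\<^bsub>A\<^esub> = \<one>\<^bsub>B\<^esub>"
  using hom_one[OF hom_grpD(1)[OF assms(3)] assms(1,2)] .

text \<open>The elements of \<open>\<Gamma>\<close> are themselves functions that act on \<open>B\<close>; this is the shape of a Galois group
  acting on \<open>K\<^sup>\<times>\<close>.\<close>

lemma twisted_gmodule:
  fixes \<Gamma> :: "('k \<Rightarrow> 'k) monoid" and B :: "('k, 'm) monoid_scheme"
  assumes A: "gmodule \<Gamma> A \<alpha>" and B: "comm_group B"
    and hom: "\<And>g. g \<in> carrier \<Gamma> \<Longrightarrow> g \<in> hom B B"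
    and one: "\<And>x. x \<in> carrier B \<Longrightarrow> \<one>\<^bsub>\<Gamma>\<^esub> x = x"
    and mult: "\<And>g h x. g \<in> carrier \<Gamma> \<Longrightarrow> h \<in> carrier \<Gamma> \<Longrightarrow> x \<in> carrier B \<Longrightarrow>
      (g \<otimes>\<^bsub>\<Gamma>\<^esub> h) x = g (h x)"
  shows "gmodule \<Gamma> (hom_grp A B) (twisted_act \<Gamma> A \<alpha>)"
proof -
  interpret A: gmodule \<Gamma> A \<alpha> by fact
  interpret B: comm_group B by fact
  have gB: "g x \<in> carrier B" if "g \<in> carrier \<Gamma>" "x \<in> carrier B" for g x
    using hom[OF that(1)] that(2) by (auto simp: hom_def)
  have gm: "g (x \<otimes>\<^bsub>B\<^esub> y) = g x \<otimes>\<^bsub>B\<^esub> g y"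
    if "g \<in> carrier \<Gamma>" "x \<in> carrier B" "y \<in> carrier B" for g x y
    using hom[OF that(1)] that(2,3) by (auto simp: hom_def)
  let ?t = "twisted_act \<Gamma> A \<alpha>"
  have closed: "?t g \<xi> \<in> carrier (hom_grp A B)"
    if g: "g \<in> carrier \<Gamma>" and \<xi>: "\<xi> \<in> carrier (hom_grp A B)" for g \<xi>
    using g hom_grpD[OF \<xi>]
    by (intro hom_grpI) (simp_all add: twisted_act_def gB gm A.act_m)
  show ?thesis
  proof (intro gmodule.intro gmodule_axioms.intro)
    show "group \<Gamma>" by (rule A.G.is_group)
    show "comm_group (hom_grp A B)" by (rule comm_group_hom_grp[OF A.is_group B])
  next
    fix g assume g: "g \<in> carrier \<Gamma>"
    show "?t g \<in> hom (hom_grp A B) (hom_grp A B)"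
    proof (rule homI)
      fix \<xi> \<eta> assume \<xi>: "\<xi> \<in> carrier (hom_grp A B)" and \<eta>: "\<eta> \<in> carrier (hom_grp A B)"
      show "?t g (\<xi> \<otimes>\<^bsub>hom_grp A B\<^esub> \<eta>) = ?t g \<xi> \<otimes>\<^bsub>hom_grp A B\<^esub> ?t g \<eta>"
        using g hom_grpD(2)[OF \<xi>] hom_grpD(2)[OF \<eta>]
        by (auto simp: twisted_act_def gm intro!: restrict_ext)
    qed (rule closed[OF g])
  next
    fix \<xi> assume \<xi>: "\<xi> \<in> carrier (hom_grp A B)"
    show "?t \<one>\<^bsub>\<Gamma>\<^esub> \<xi> = \<xi>"
      by (rule hom_grp_eqI[OF closed[OF A.G.one_closed \<xi>] \<xi>])
        (use hom_grpD(2)[OF \<xi>] in \<open>simp add: twisted_act_def A.act_one one\<close>)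
  next
    fix g h \<xi> assume gh: "g \<in> carrier \<Gamma>" "h \<in> carrier \<Gamma>" and \<xi>: "\<xi> \<in> carrier (hom_grp A B)"
    show "?t (g \<otimes>\<^bsub>\<Gamma>\<^esub> h) \<xi> = ?t g (?t h \<xi>)"
      unfolding twisted_act_def
      by (rule restrict_ext)
        (use gh hom_grpD(2)[OF \<xi>] in \<open>simp add: A.G.inv_mult_group A.act_mult mult\<close>)
  qed
qed

text \<open>The maps of the sequence \<open>G \<rightarrow> P \<rightarrow> T\<close> are both of this kind, for \<open>\<int>\<^sup>\<Sigma>\<^sup>(\<^sup>1\<^sup>) \<rightarrow> Cl(\<Sigma>)\<close> and for
  \<open>M \<rightarrow> \<int>\<^sup>\<Sigma>\<^sup>(\<^sup>1\<^sup>)\<close>.\<close>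

definition pullback :: "('a, 'm) monoid_scheme \<Rightarrow> ('a \<Rightarrow> 'b) \<Rightarrow> ('b \<Rightarrow> 'c) \<Rightarrow> ('a \<Rightarrow> 'c)" where
  "pullback A j \<xi> = (\<lambda>x\<in>carrier A. \<xi> (j x))"

lemma pullback_closed:
  assumes "group A" "j \<in> hom A E" "\<xi> \<in> carrier (hom_grp E B)"
  shows "pullback A j \<xi> \<in> carrier (hom_grp A B)"
proof -
  interpret A: group A by fact
  show ?thesis
    using assms(2) hom_grpD[OF assms(3)]
    by (intro hom_grpI) (auto simp: pullback_def hom_in_carrier hom_mult)
qed

lemma pullback_hom:
  assumes "group A" "j \<in> hom A E"
  shows "pullback A j \<in> hom (hom_grp E B) (hom_grp A B)"
proof (rule homI)
  fix \<xi> \<eta> assume "\<xi> \<in> carrier (hom_grp E B)" "\<eta> \<in> carrier (hom_grp E B)"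
  show "pullback A j (\<xi> \<otimes>\<^bsub>hom_grp E B\<^esub> \<eta>) = pullback A j \<xi> \<otimes>\<^bsub>hom_grp A B\<^esub> pullback A j \<eta>"
    using assms(2) by (auto simp: pullback_def hom_in_carrier intro!: restrict_ext)
qed (rule pullback_closed[OF assms])

lemma pullback_equivariant:
  assumes A: "gmodule \<Gamma> A \<alpha>" and j: "j \<in> hom A E"
    and eq: "\<And>g x. g \<in> carrier \<Gamma> \<Longrightarrow> x \<in> carrier A \<Longrightarrow> j (\<alpha> g x) = \<beta> g (j x)"
    and g: "g \<in> carrier \<Gamma>"
  shows "pullback A j (twisted_act \<Gamma> E \<beta> g \<xi>) = twisted_act \<Gamma> A \<alpha> g (pullback A j \<xi>)"
proof -
  interpret A: gmodule \<Gamma> A \<alpha> by fact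
  show ?thesis
    unfolding pullback_def twisted_act_def
    by (rule restrict_ext) (use g j in \<open>simp add: hom_in_carrier eq\<close>)
qed

lemma inj_on_pullback:
  assumes "j ` carrier A = carrier E"
  shows "inj_on (pullback A j) (carrier (hom_grp E B))"
proof (rule inj_onI)
  fix \<xi> \<eta> assume \<xi>: "\<xi> \<in> carrier (hom_grp E B)" and \<eta>: "\<eta> \<in> carrier (hom_grp E B)"
    and eq: "pullback A j \<xi> = pullback A j \<eta>"
  have "\<xi> (j x) = \<eta> (j x)" if "x \<in> carrier A" for x
    using fun_cong[OF eq, of x] that by (simp add: pullback_def)
  then have "\<forall>y\<in>j ` carrier A. \<xi> y = \<eta> y" by blast
  then show "\<xi> = \<eta>" unfolding assms by (intro hom_grp_eqI[OF \<xi> \<eta>]) blast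
qed

lemma quotient_map_hom:
  assumes "comm_group E" "subgroup H E"
  shows "r_coset E H \<in> hom E (E Mod H)" "r_coset E H ` carrier E = carrier (E Mod H)"
proof -
  interpret comm_group E by fact
  interpret normal H E using assms(2) by (simp add: normal_iff_subgroup)
  show "r_coset E H \<in> hom E (E Mod H)" using r_coset_hom_Mod by simp
  show "r_coset E H ` carrier E = carrier (E Mod H)" by (simp add: carrier_FactGroup)
qed

text \<open>Homomorphisms on the quotient are the homomorphisms that vanish on the subgroup.\<close>

lemma exact_pullback:
  assumes E: "comm_group E" and A: "group A" and B: "comm_group B" and j: "j \<in> hom A E"
    and H: "H = j ` carrier A" "subgroup H E"
  shows "pullback E (r_coset E H) ` carrier (hom_grp (E Mod H) B) =
    kernel (hom_grp E B) (hom_grp A B) (pullback A j)"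
proof
  interpret E: comm_group E by fact
  interpret A: group A by fact
  interpret B: comm_group B by fact
  interpret H: normal H E using H(2) by (simp add: E.normal_iff_subgroup)
  have Q: "group (E Mod H)" by (rule H.factorgroup_is_group)
  note q = quotient_map_hom[OF E H(2)]
  show "pullback E (r_coset E H) ` carrier (hom_grp (E Mod H) B)
    \<subseteq> kernel (hom_grp E B) (hom_grp A B) (pullback A j)"
  proof
    fix p assume "p \<in> pullback E (r_coset E H) ` carrier (hom_grp (E Mod H) B)"
    then obtain \<xi> where \<xi>: "\<xi> \<in> carrier (hom_grp (E Mod H) B)" "p = pullback E (r_coset E H) \<xi>"
      by blast
    have p: "p \<in> carrier (hom_grp E B)"
      unfolding \<xi>(2) by (rule pullback_closed[OF E.is_group q(1) \<xi>(1)])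
    have "p (j x) = \<one>\<^bsub>B\<^esub>" if x: "x \<in> carrier A" for x
    proof -
      have jx: "j x \<in> H" "j x \<in> carrier E" using x j H(1) by (auto simp: hom_in_carrier)
      then have "H #>\<^bsub>E\<^esub> j x = \<one>\<^bsub>E Mod H\<^esub>" using E.coset_join2 H(2) by simp
      then show ?thesis
        using hom_grp_one[OF Q B.is_group \<xi>(1)] jx(2) by (simp add: \<xi>(2) pullback_def)
    qed
    then show "p \<in> kernel (hom_grp E B) (hom_grp A B) (pullback A j)"
      using p by (auto simp: kernel_def pullback_def intro!: restrict_ext)
  qed
  show "kernel (hom_grp E B) (hom_grp A B) (pullback A j)
    \<subseteq> pullback E (r_coset E H) ` carrier (hom_grp (E Mod H) B)"
  proof
    fix p assume "p \<in> kernel (hom_grp E B) (hom_grp A B) (pullback A j)"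
    then have p: "p \<in> carrier (hom_grp E B)" and pj: "pullback A j p = (\<lambda>x\<in>carrier A. \<one>\<^bsub>B\<^esub>)"
      by (auto simp: kernel_def)
    have pH: "p h = \<one>\<^bsub>B\<^esub>" if h: "h \<in> H" for h
    proof -
      obtain x where x: "x \<in> carrier A" "h = j x" using h H(1) by blast
      then show ?thesis using fun_cong[OF pj, of x] by (simp add: pullback_def)
    qed
    interpret p: group_hom E B p
      using hom_grpD(1)[OF p] E.is_group B.is_group by (simp add: group_hom_def group_hom_axioms_def)
    have "H \<subseteq> kernel E B p" using pH H(2) by (auto simp: kernel_def subgroup.mem_carrier)
    then obtain \<xi> where \<xi>: "\<xi> \<in> hom (E Mod H) B"
      "\<And>x. x \<in> carrier E \<Longrightarrow> \<xi> (H #>\<^bsub>E\<^esub> x) = p x"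
      using p.FactGroup_universal_kernel[OF H.normal_axioms] by metis
    let ?\<xi> = "restrict \<xi> (carrier (E Mod H))"
    have 1: "?\<xi> \<in> carrier (hom_grp (E Mod H) B)" by (rule restrict_hom[OF Q \<xi>(1)])
    have "pullback E (r_coset E H) ?\<xi> = p"
    proof (rule hom_grp_eqI[OF pullback_closed[OF E.is_group q(1) 1] p])
      fix x assume x: "x \<in> carrier E"
      then have "H #>\<^bsub>E\<^esub> x \<in> carrier (E Mod H)" using q(2) by blast
      then show "pullback E (r_coset E H) ?\<xi> x = p x" using x \<xi>(2) by (simp add: pullback_def)
    qed
    then show "p \<in> pullback E (r_coset E H) ` carrier (hom_grp (E Mod H) B)" using 1 by blast
  qed
qed

lemma quotient_gmodule:
  assumes E: "gmodule \<Gamma> E \<alpha>" and H: "subgroup H E"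
    and inv: "\<And>g x. g \<in> carrier \<Gamma> \<Longrightarrow> x \<in> H \<Longrightarrow> \<alpha> g x \<in> H"
  shows "gmodule \<Gamma> (E Mod H) (\<lambda>g c. \<alpha> g ` c)"
    and "\<And>g x. g \<in> carrier \<Gamma> \<Longrightarrow> x \<in> carrier E \<Longrightarrow> r_coset E H (\<alpha> g x) = \<alpha> g ` (r_coset E H x)"
proof -
  interpret E: gmodule \<Gamma> E \<alpha> by fact
  interpret H: normal H E using H by (simp add: E.normal_iff_subgroup)
  have HE: "x \<in> carrier E" if "x \<in> H" for x using that H by (simp add: subgroup.mem_carrier)
  have onto: "\<alpha> g ` H = H" if g: "g \<in> carrier \<Gamma>" for g
  proof
    show "H \<subseteq> \<alpha> g ` H"
    proof
      fix x assume x: "x \<in> H"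
      have "x = \<alpha> g (\<alpha> (inv\<^bsub>\<Gamma>\<^esub> g) x)"
        using g HE[OF x] by (simp add: E.act_mult[symmetric] E.act_one)
      then show "x \<in> \<alpha> g ` H" using inv[of "inv\<^bsub>\<Gamma>\<^esub> g" x] g x by blast
    qed
  qed (use inv g in auto)
  have coset: "\<alpha> g ` (H #>\<^bsub>E\<^esub> x) = H #>\<^bsub>E\<^esub> \<alpha> g x" if g: "g \<in> carrier \<Gamma>" and x: "x \<in> carrier E" for g x
  proof -
    have "\<alpha> g ` (H #>\<^bsub>E\<^esub> x) = (\<lambda>h. \<alpha> g h \<otimes>\<^bsub>E\<^esub> \<alpha> g x) ` H"
      using g x HE by (auto simp: r_coset_def E.act_m image_iff intro!: bexI)
    also have "\<dots> = (\<lambda>h. h \<otimes>\<^bsub>E\<^esub> \<alpha> g x) ` \<alpha> g ` H" by (simp add: image_image)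
    also have "\<dots> = H #>\<^bsub>E\<^esub> \<alpha> g x" unfolding onto[OF g] by (auto simp: r_coset_def)
    finally show ?thesis .
  qed
  then show "\<And>g x. g \<in> carrier \<Gamma> \<Longrightarrow> x \<in> carrier E \<Longrightarrow> r_coset E H (\<alpha> g x) = \<alpha> g ` (r_coset E H x)"
    by simp
  note q = quotient_map_hom[OF E.comm_group_axioms H]
  have rep: "\<exists>x\<in>carrier E. c = H #>\<^bsub>E\<^esub> x" if "c \<in> carrier (E Mod H)" for c
    using that unfolding q(2)[symmetric] by blast
  have qm: "(H #>\<^bsub>E\<^esub> x) \<otimes>\<^bsub>E Mod H\<^esub> (H #>\<^bsub>E\<^esub> y) = H #>\<^bsub>E\<^esub> (x \<otimes>\<^bsub>E\<^esub> y)"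
    if "x \<in> carrier E" "y \<in> carrier E" for x y
    using hom_mult[OF q(1) that] by simp
  have qc: "H #>\<^bsub>E\<^esub> x \<in> carrier (E Mod H)" if "x \<in> carrier E" for x
    unfolding q(2)[symmetric] using that by (rule imageI)
  show "gmodule \<Gamma> (E Mod H) (\<lambda>g c. \<alpha> g ` c)"
  proof (intro gmodule.intro gmodule_axioms.intro)
    show "group \<Gamma>" by (rule E.G.is_group)
    show "comm_group (E Mod H)" by (rule E.abelian_FactGroup[OF H])
  next
    fix g assume g: "g \<in> carrier \<Gamma>"
    show "(`) (\<alpha> g) \<in> hom (E Mod H) (E Mod H)"
    proof (rule homI)
      fix c assume "c \<in> carrier (E Mod H)"
      then obtain x where x: "x \<in> carrier E" "c = H #>\<^bsub>E\<^esub> x" using rep by metis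
      show "\<alpha> g ` c \<in> carrier (E Mod H)"
        unfolding x(2) coset[OF g x(1)] by (rule qc[OF E.act_closed[OF g x(1)]])
    next
      fix c d assume "c \<in> carrier (E Mod H)" "d \<in> carrier (E Mod H)"
      then obtain x y where xy: "x \<in> carrier E" "y \<in> carrier E"
        "c = H #>\<^bsub>E\<^esub> x" "d = H #>\<^bsub>E\<^esub> y" using rep by metis
      show "\<alpha> g ` (c \<otimes>\<^bsub>E Mod H\<^esub> d) = (\<alpha> g ` c) \<otimes>\<^bsub>E Mod H\<^esub> (\<alpha> g ` d)"
        unfolding xy(3,4) using g xy(1,2) by (simp only: qm coset E.act_m E.act_closed E.m_closed)
    qed
  next
    fix c assume "c \<in> carrier (E Mod H)"
    then obtain x where "x \<in> carrier E" "c = H #>\<^bsub>E\<^esub> x" using rep by metis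
    then show "\<alpha> \<one>\<^bsub>\<Gamma>\<^esub> ` c = c" by (simp add: coset E.act_one)
  next
    fix g h c assume gh: "g \<in> carrier \<Gamma>" "h \<in> carrier \<Gamma>" and "c \<in> carrier (E Mod H)"
    then obtain x where "x \<in> carrier E" "c = H #>\<^bsub>E\<^esub> x" using rep by metis
    then show "\<alpha> (g \<otimes>\<^bsub>\<Gamma>\<^esub> h) ` c = \<alpha> g ` \<alpha> h ` c" using gh by (simp add: coset E.act_mult)
  qed
qed

lemma free_eval_hom:
  assumes "comm_group C"
  shows "free_eval C \<in> hom (free_Abelian_group (carrier C)) C"
    and "\<And>c. c \<in> carrier C \<Longrightarrow> free_eval C (frag_of c) = c"
proof -
  interpret comm_group C by fact
  have ext: "free_eval C x = (\<Otimes>\<^bsub>C\<^esub>a\<in>F. a [^]\<^bsub>C\<^esub> Poly_Mapping.lookup x a)"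
    if "finite F" "Poly_Mapping.keys x \<subseteq> F" "F \<subseteq> carrier C" for x F
    unfolding free_eval_def
    by (rule finprod_mono_neutral_cong_left) (use that in \<open>auto simp: in_keys_iff\<close>)
  show "free_eval C \<in> hom (free_Abelian_group (carrier C)) C"
  proof (rule homI)
    fix x assume "x \<in> carrier (free_Abelian_group (carrier C))"
    then show "free_eval C x \<in> carrier C" unfolding free_eval_def by (intro finprod_closed) auto
  next
    fix x y assume xy: "x \<in> carrier (free_Abelian_group (carrier C))"
      "y \<in> carrier (free_Abelian_group (carrier C))"
    let ?F = "Poly_Mapping.keys x \<union> Poly_Mapping.keys y"
    have F: "finite ?F" "?F \<subseteq> carrier C" using xy by auto
    have "free_eval C (x + y) = (\<Otimes>\<^bsub>C\<^esub>a\<in>?F. a [^]\<^bsub>C\<^esub> Poly_Mapping.lookup (x + y) a)"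
      by (rule ext) (use F keys_add[of x y] in auto)
    also have "\<dots> = (\<Otimes>\<^bsub>C\<^esub>a\<in>?F. a [^]\<^bsub>C\<^esub> Poly_Mapping.lookup x a \<otimes>\<^bsub>C\<^esub> a [^]\<^bsub>C\<^esub> Poly_Mapping.lookup y a)"
      by (rule finprod_cong') (use F in \<open>auto simp: lookup_add int_pow_mult\<close>)
    also have "\<dots> = free_eval C x \<otimes>\<^bsub>C\<^esub> free_eval C y"
      using F by (subst finprod_multf) (auto simp: ext[of ?F])
    finally show "free_eval C (x \<otimes>\<^bsub>free_Abelian_group (carrier C)\<^esub> y) = free_eval C x \<otimes>\<^bsub>C\<^esub> free_eval C y"
      by simp
  qed
  show "free_eval C (frag_of c) = c" if "c \<in> carrier C" for c
    using that by (simp add: free_eval_def)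
qed

text \<open>Choose a representative \<open>l(c) \<in> E\<close> of every class \<open>c\<close>, and let \<open>s\<close> be the homomorphism from the free
  group on the classes to \<open>E\<close> with these values.  It sends relations into \<open>H\<close>, so \<open>\<xi> \<circ> s\<close> is a
  homomorphism on the relations, which extends to some \<open>\<eta>\<close> on the free group because Ext vanishes.
  Then \<open>a \<mapsto> \<xi>(a / l[a]) \<cdot> \<eta>([a])\<close> is the required extension: the factor \<open>\<eta>\<close> compensates the failure of
  \<open>l\<close> to be a homomorphism.\<close>

theorem extend_hom_of_trivial_Ext1:
  assumes E: "comm_group E" and H: "subgroup H E" and B: "comm_group B"
    and Ext: "trivial_group (Ext1 (E Mod H) B)"
    and \<xi>: "\<xi> \<in> hom (E\<lparr>carrier := H\<rparr>) B"
  shows "\<exists>\<eta>. \<eta> \<in> hom E B \<and> (\<forall>h\<in>H. \<eta> h = \<xi> h)"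
proof -
  interpret E: comm_group E by fact
  interpret B: comm_group B by fact
  let ?C = "E Mod H" and ?q = "r_coset E H"
  let ?F = "free_Abelian_group (carrier ?C)" and ?R = "free_rels ?C"
  interpret C: comm_group ?C by (rule E.abelian_FactGroup[OF H])
  interpret F: group ?F by simp
  note q = quotient_map_hom[OF E H]
  have HE: "h \<in> carrier E" if "h \<in> H" for h using that H by (simp add: subgroup.mem_carrier)
  interpret ev: group_hom ?F ?C "free_eval ?C"
    using free_eval_hom(1)[OF C.comm_group_axioms] by unfold_locales
  have R: "carrier ?R = kernel ?F ?C (free_eval ?C)" by (simp add: free_rels_def)
  have RF: "x \<in> carrier ?F" if "x \<in> carrier ?R" for x using that by (simp add: R kernel_def)
  have R_mult: "x \<otimes>\<^bsub>?R\<^esub> y = x + y" for x y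
    by (simp add: free_rels_def)
  have "group (?F\<lparr>carrier := kernel ?F ?C (free_eval ?C)\<rparr>)"
    by (rule subgroup.subgroup_is_group[OF ev.subgroup_kernel F.is_group])
  then have Rg: "group ?R" by (simp add: free_rels_def)
  define l where "l c = (SOME x. x \<in> carrier E \<and> ?q x = c)" for c
  have l: "l c \<in> carrier E" "?q (l c) = c" if "c \<in> carrier ?C" for c
  proof -
    have "\<exists>x. x \<in> carrier E \<and> ?q x = c" using that unfolding q(2)[symmetric] by blast
    then have "l c \<in> carrier E \<and> ?q (l c) = c" unfolding l_def by (rule someI_ex)
    then show "l c \<in> carrier E" "?q (l c) = c" by auto
  qed
  have "l ` carrier ?C \<subseteq> carrier E" using l(1) by (rule image_subsetI)
  then obtain s where s: "s \<in> hom ?F E" "\<And>c. c \<in> carrier ?C \<Longrightarrow> s (frag_of c) = l c"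
    by (rule E.free_Abelian_group_universal) (rule that)
  interpret s: group_hom ?F E s using s(1) by unfold_locales
  interpret q: group_hom E ?C ?q using q(1) by unfold_locales
  have qs: "?q (s x) = free_eval ?C x" if x: "Poly_Mapping.keys x \<subseteq> carrier ?C" for x
  proof (rule free_Abelian_group_induct[OF x])
    have "?q (s \<one>\<^bsub>?F\<^esub>) = free_eval ?C \<one>\<^bsub>?F\<^esub>"
      by (simp only: s.hom_one q.hom_one ev.hom_one)
    then show "?q (s 0) = free_eval ?C 0" by simp
  next
    fix x y assume xy: "Poly_Mapping.keys x \<subseteq> carrier ?C" "Poly_Mapping.keys y \<subseteq> carrier ?C"
      and IH: "?q (s x) = free_eval ?C x" "?q (s y) = free_eval ?C y"
    have F: "x \<in> carrier ?F" "y \<in> carrier ?F" using xy by simp_all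
    have d: "x - y = x \<otimes>\<^bsub>?F\<^esub> inv\<^bsub>?F\<^esub> y" using xy(2) by simp
    show "?q (s (x - y)) = free_eval ?C (x - y)" unfolding d
      using F IH by (simp only: s.hom_mult s.hom_inv q.hom_mult q.hom_inv ev.hom_mult ev.hom_inv
          F.inv_closed s.hom_closed E.inv_closed)
  next
    fix c assume c: "c \<in> carrier ?C"
    show "?q (s (frag_of c)) = free_eval ?C (frag_of c)"
      unfolding s(2)[OF c] l(2)[OF c] by (rule free_eval_hom(2)[OF C.comm_group_axioms c, symmetric])
  qed
  have q_one: "x \<in> H" if "x \<in> carrier E" "?q x = \<one>\<^bsub>?C\<^esub>" for x
    using that E.coset_join1[of H x] H by simp
  have sR: "s x \<in> H" if x: "x \<in> carrier ?R" for x
  proof -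
    have "?q (s x) = \<one>\<^bsub>?C\<^esub>" using qs x by (simp add: R kernel_def)
    then show ?thesis using q_one RF[OF x] by simp
  qed
  have \<xi>_closed: "\<xi> h \<in> carrier B" if "h \<in> H" for h using \<xi> that by (auto simp: hom_def)
  have \<xi>_mult: "\<xi> (h \<otimes>\<^bsub>E\<^esub> h') = \<xi> h \<otimes>\<^bsub>B\<^esub> \<xi> h'" if "h \<in> H" "h' \<in> H" for h h'
    using \<xi> that by (auto simp: hom_def)
  let ?HF = "(\<lambda>f. restrict f (carrier ?R)) ` carrier (hom_grp ?F B)"
  let ?f = "\<lambda>x\<in>carrier ?R. \<xi> (s x)"
  interpret HR: comm_group "hom_grp ?R B" by (rule comm_group_hom_grp[OF Rg B])
  have f: "?f \<in> carrier (hom_grp ?R B)"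
  proof (rule hom_grpI)
    fix x y assume xy: "x \<in> carrier ?R" "y \<in> carrier ?R"
    then have "x \<otimes>\<^bsub>?R\<^esub> y \<in> carrier ?R" using Rg by (simp add: group.is_monoid monoid.m_closed)
    then have "x + y \<in> carrier ?R" by (simp add: R_mult)
    moreover have "s (x + y) = s x \<otimes>\<^bsub>E\<^esub> s y" using s.hom_mult[OF RF[OF xy(1)] RF[OF xy(2)]] by simp
    ultimately show "?f (x \<otimes>\<^bsub>?R\<^esub> y) = ?f x \<otimes>\<^bsub>B\<^esub> ?f y"
      using xy sR \<xi>_mult by (simp add: R_mult)
  qed (use sR \<xi>_closed in auto)
  have "?HF #>\<^bsub>hom_grp ?R B\<^esub> ?f \<in> carrier (Ext1 ?C B)"
    using f unfolding Ext1_def carrier_FactGroup by (rule imageI)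
  also have "carrier (Ext1 ?C B) = {?HF}" using Ext by (simp add: trivial_group_def Ext1_def)
  \<comment> \<open>the coset of the homomorphism on relations is the only element of the trivial group Ext\<close>
  finally have coset: "?HF #>\<^bsub>hom_grp ?R B\<^esub> ?f = ?HF" by (rule singletonD)
  have one: "\<one>\<^bsub>hom_grp ?R B\<^esub> \<in> ?HF"
  proof (rule image_eqI)
    interpret HF: comm_group "hom_grp ?F B" by (rule comm_group_hom_grp[OF F.is_group B])
    show "\<one>\<^bsub>hom_grp ?F B\<^esub> \<in> carrier (hom_grp ?F B)" by (rule HF.one_closed)
    show "\<one>\<^bsub>hom_grp ?R B\<^esub> = restrict \<one>\<^bsub>hom_grp ?F B\<^esub> (carrier ?R)"
      unfolding one_hom_grp by (rule ext) (simp add: restrict_def RF del: carrier_free_Abelian_group_iff)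
  qed
  have "\<one>\<^bsub>hom_grp ?R B\<^esub> \<otimes>\<^bsub>hom_grp ?R B\<^esub> ?f \<in> ?HF #>\<^bsub>hom_grp ?R B\<^esub> ?f"
    unfolding r_coset_def by (rule UN_I[OF one]) (rule singletonI)
  then have "?f \<in> ?HF" unfolding HR.l_one[OF f] coset .
  then obtain \<eta> where \<eta>: "\<eta> \<in> carrier (hom_grp ?F B)" "?f = restrict \<eta> (carrier ?R)"
    by (rule imageE)
  have \<eta>R: "\<eta> x = \<xi> (s x)" if "x \<in> carrier ?R" for x
    using fun_cong[OF \<eta>(2), of x] that by simp
  interpret \<eta>: group_hom ?F B \<eta> using hom_grpD(1)[OF \<eta>(1)] by unfold_locales
  define \<Xi> where "\<Xi> a = \<xi> (a \<otimes>\<^bsub>E\<^esub> inv\<^bsub>E\<^esub> l (?q a)) \<otimes>\<^bsub>B\<^esub> \<eta> (frag_of (?q a))" for a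
  have qC: "?q a \<in> carrier ?C" if "a \<in> carrier E" for a using that by (rule q.hom_closed)
  have dH: "a \<otimes>\<^bsub>E\<^esub> inv\<^bsub>E\<^esub> l (?q a) \<in> H" if a: "a \<in> carrier E" for a
  proof (rule q_one)
    show "a \<otimes>\<^bsub>E\<^esub> inv\<^bsub>E\<^esub> l (?q a) \<in> carrier E" using a l(1)[OF qC[OF a]] by simp
    have "?q (a \<otimes>\<^bsub>E\<^esub> inv\<^bsub>E\<^esub> l (?q a)) = ?q a \<otimes>\<^bsub>?C\<^esub> inv\<^bsub>?C\<^esub> ?q (l (?q a))"
      using a l(1)[OF qC[OF a]] by (simp only: q.hom_mult q.hom_inv E.inv_closed)
    also have "\<dots> = \<one>\<^bsub>?C\<^esub>" unfolding l(2)[OF qC[OF a]] by (rule C.r_inv[OF qC[OF a]])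
    finally show "?q (a \<otimes>\<^bsub>E\<^esub> inv\<^bsub>E\<^esub> l (?q a)) = \<one>\<^bsub>?C\<^esub>" .
  qed
  have \<eta>c: "\<eta> (frag_of c) \<in> carrier B" if "c \<in> carrier ?C" for c
    using that by (intro \<eta>.hom_closed) simp
  have "\<Xi> \<in> hom E B"
  proof (rule homI)
    fix a assume "a \<in> carrier E"
    then show "\<Xi> a \<in> carrier B" unfolding \<Xi>_def using dH qC \<eta>c \<xi>_closed by simp
  next
    fix a b assume a: "a \<in> carrier E" and b: "b \<in> carrier E"
    have ab: "a \<otimes>\<^bsub>E\<^esub> b \<in> carrier E" using a b by simp
    let ?ca = "?q a" and ?cb = "?q b" and ?cab = "?q (a \<otimes>\<^bsub>E\<^esub> b)"
    have cab: "?cab = ?ca \<otimes>\<^bsub>?C\<^esub> ?cb" using a b by (rule q.hom_mult)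
    have fr: "frag_of ?ca \<in> carrier ?F" "frag_of ?cb \<in> carrier ?F" "frag_of ?cab \<in> carrier ?F"
      using qC[OF a] qC[OF b] qC[OF ab] by simp_all
    let ?r = "frag_of ?ca \<otimes>\<^bsub>?F\<^esub> frag_of ?cb \<otimes>\<^bsub>?F\<^esub> inv\<^bsub>?F\<^esub> frag_of ?cab"
    have rF: "?r \<in> carrier ?F" using fr by (intro F.m_closed F.inv_closed)
    have "free_eval ?C ?r = ?ca \<otimes>\<^bsub>?C\<^esub> ?cb \<otimes>\<^bsub>?C\<^esub> inv\<^bsub>?C\<^esub> ?cab"
      using fr qC[OF a] qC[OF b] qC[OF ab]
      by (simp only: ev.hom_mult ev.hom_inv F.m_closed F.inv_closed free_eval_hom(2)[OF C.comm_group_axioms])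
    also have "\<dots> = \<one>\<^bsub>?C\<^esub>" unfolding cab[symmetric] by (rule C.r_inv[OF qC[OF ab]])
    finally have rR: "?r \<in> carrier ?R" unfolding R kernel_def using rF by simp
    have "\<eta> (frag_of ?ca) \<otimes>\<^bsub>B\<^esub> \<eta> (frag_of ?cb) = \<eta> ?r \<otimes>\<^bsub>B\<^esub> \<eta> (frag_of ?cab)"
      using fr \<eta>c[OF qC[OF a]] \<eta>c[OF qC[OF b]] \<eta>c[OF qC[OF ab]]
      by (simp only: \<eta>.hom_mult \<eta>.hom_inv F.m_closed F.inv_closed B.m_assoc B.l_inv B.r_one B.m_closed B.inv_closed)
    then have \<eta>ab: "\<eta> (frag_of ?ca) \<otimes>\<^bsub>B\<^esub> \<eta> (frag_of ?cb) = \<xi> (s ?r) \<otimes>\<^bsub>B\<^esub> \<eta> (frag_of ?cab)"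
      unfolding \<eta>R[OF rR] .
    let ?la = "l ?ca" and ?lb = "l ?cb" and ?lab = "l ?cab"
    have L: "?la \<in> carrier E" "?lb \<in> carrier E" "?lab \<in> carrier E"
      using l(1) qC[OF a] qC[OF b] qC[OF ab] by auto
    have sr: "s ?r = ?la \<otimes>\<^bsub>E\<^esub> ?lb \<otimes>\<^bsub>E\<^esub> inv\<^bsub>E\<^esub> ?lab"
      using fr qC[OF a] qC[OF b] qC[OF ab] by (simp only: s.hom_mult s.hom_inv F.m_closed F.inv_closed s(2))
    have "a \<otimes>\<^bsub>E\<^esub> b \<otimes>\<^bsub>E\<^esub> inv\<^bsub>E\<^esub> ?lab =
        (a \<otimes>\<^bsub>E\<^esub> inv\<^bsub>E\<^esub> ?la) \<otimes>\<^bsub>E\<^esub> (b \<otimes>\<^bsub>E\<^esub> inv\<^bsub>E\<^esub> ?lb) \<otimes>\<^bsub>E\<^esub> s ?r"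
    proof -
      have "(a \<otimes>\<^bsub>E\<^esub> inv\<^bsub>E\<^esub> ?la) \<otimes>\<^bsub>E\<^esub> (b \<otimes>\<^bsub>E\<^esub> inv\<^bsub>E\<^esub> ?lb) \<otimes>\<^bsub>E\<^esub> (?la \<otimes>\<^bsub>E\<^esub> ?lb \<otimes>\<^bsub>E\<^esub> inv\<^bsub>E\<^esub> ?lab)
        = (a \<otimes>\<^bsub>E\<^esub> b \<otimes>\<^bsub>E\<^esub> inv\<^bsub>E\<^esub> ?lab) \<otimes>\<^bsub>E\<^esub> (inv\<^bsub>E\<^esub> ?la \<otimes>\<^bsub>E\<^esub> ?la) \<otimes>\<^bsub>E\<^esub> (inv\<^bsub>E\<^esub> ?lb \<otimes>\<^bsub>E\<^esub> ?lb)"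
        using a b L by (simp only: E.m_ac E.m_closed E.inv_closed)
      also have "\<dots> = a \<otimes>\<^bsub>E\<^esub> b \<otimes>\<^bsub>E\<^esub> inv\<^bsub>E\<^esub> ?lab"
        using a b L by (simp only: E.l_inv E.r_one E.m_closed E.inv_closed)
      finally show ?thesis unfolding sr by simp
    qed
    then have "\<xi> (a \<otimes>\<^bsub>E\<^esub> b \<otimes>\<^bsub>E\<^esub> inv\<^bsub>E\<^esub> ?lab) =
        \<xi> (a \<otimes>\<^bsub>E\<^esub> inv\<^bsub>E\<^esub> ?la) \<otimes>\<^bsub>B\<^esub> \<xi> (b \<otimes>\<^bsub>E\<^esub> inv\<^bsub>E\<^esub> ?lb) \<otimes>\<^bsub>B\<^esub> \<xi> (s ?r)"
      using dH[OF a] dH[OF b] sR[OF rR] H by (simp only: \<xi>_mult subgroup.m_closed[OF H])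
    then have "\<Xi> (a \<otimes>\<^bsub>E\<^esub> b) = \<xi> (a \<otimes>\<^bsub>E\<^esub> inv\<^bsub>E\<^esub> ?la) \<otimes>\<^bsub>B\<^esub> \<xi> (b \<otimes>\<^bsub>E\<^esub> inv\<^bsub>E\<^esub> ?lb) \<otimes>\<^bsub>B\<^esub>
        (\<xi> (s ?r) \<otimes>\<^bsub>B\<^esub> \<eta> (frag_of ?cab))"
      using \<xi>_closed[OF dH[OF a]] \<xi>_closed[OF dH[OF b]] \<xi>_closed[OF sR[OF rR]] \<eta>c[OF qC[OF ab]]
      unfolding \<Xi>_def by (simp only: B.m_assoc B.m_closed)
    also have "\<dots> = \<Xi> a \<otimes>\<^bsub>B\<^esub> \<Xi> b"
      unfolding \<Xi>_def \<eta>ab[symmetric]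
      using \<xi>_closed[OF dH[OF a]] \<xi>_closed[OF dH[OF b]] \<eta>c[OF qC[OF a]] \<eta>c[OF qC[OF b]]
      by (simp only: B.m_ac B.m_closed)
    finally show "\<Xi> (a \<otimes>\<^bsub>E\<^esub> b) = \<Xi> a \<otimes>\<^bsub>B\<^esub> \<Xi> b" .
  qed
  moreover have "\<Xi> h = \<xi> h" if h: "h \<in> H" for h
  proof -
    let ?o = "\<one>\<^bsub>?C\<^esub>"
    have qh: "?q h = ?o" using E.coset_join2[OF HE[OF h] H h] by simp
    have oR: "frag_of ?o \<in> carrier ?R"
      using free_eval_hom(2)[OF C.comm_group_axioms C.one_closed] C.one_closed
      unfolding R kernel_def by simp
    have lo: "l ?o \<in> H" using sR[OF oR] s(2)[OF C.one_closed] by simp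
    have "\<Xi> h = \<xi> (h \<otimes>\<^bsub>E\<^esub> inv\<^bsub>E\<^esub> l ?o) \<otimes>\<^bsub>B\<^esub> \<xi> (l ?o)"
      unfolding \<Xi>_def qh using \<eta>R[OF oR] s(2)[OF C.one_closed] by simp
    also have "\<dots> = \<xi> (h \<otimes>\<^bsub>E\<^esub> inv\<^bsub>E\<^esub> l ?o \<otimes>\<^bsub>E\<^esub> l ?o)"
      using h lo H by (simp add: \<xi>_mult subgroup.m_closed subgroup.m_inv_closed)
    also have "h \<otimes>\<^bsub>E\<^esub> inv\<^bsub>E\<^esub> l ?o \<otimes>\<^bsub>E\<^esub> l ?o = h" using HE[OF h] HE[OF lo] by (simp add: E.m_assoc)
    finally show ?thesis .
  qed
  ultimately show ?thesis by blast
qed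

text \<open>Injectivity of \<open>j\<close> turns a homomorphism on \<open>M\<close> into one on the image of \<open>j\<close>, which then extends.\<close>

lemma surj_pullback:
  assumes M: "group M" and E: "comm_group E" and B: "comm_group B"
    and j: "j \<in> hom M E" "inj_on j (carrier M)"
    and Ext: "trivial_group (Ext1 (E Mod (j ` carrier M)) B)"
  shows "pullback M j ` carrier (hom_grp E B) = carrier (hom_grp M B)"
proof
  interpret M: group M by fact
  interpret E: comm_group E by fact
  interpret j: group_hom M E j using j(1) by unfold_locales
  show "pullback M j ` carrier (hom_grp E B) \<subseteq> carrier (hom_grp M B)"
    by (rule image_subsetI) (rule pullback_closed[OF M j(1)])
  show "carrier (hom_grp M B) \<subseteq> pullback M j ` carrier (hom_grp E B)"
  proof
    fix \<xi> assume \<xi>: "\<xi> \<in> carrier (hom_grp M B)"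
    let ?H = "j ` carrier M"
    define \<xi>' where "\<xi>' h = \<xi> (inv_into (carrier M) j h)" for h
    have \<xi>'j: "\<xi>' (j u) = \<xi> u" if "u \<in> carrier M" for u
      unfolding \<xi>'_def using j(2) that by (simp add: inv_into_f_f)
    have "\<xi>' \<in> hom (E\<lparr>carrier := ?H\<rparr>) B"
    proof (rule homI)
      fix h assume "h \<in> carrier (E\<lparr>carrier := ?H\<rparr>)"
      then obtain u where "u \<in> carrier M" "h = j u" by auto
      then show "\<xi>' h \<in> carrier B" using hom_grpD(2)[OF \<xi>] \<xi>'j by simp
    next
      fix h h' assume "h \<in> carrier (E\<lparr>carrier := ?H\<rparr>)" "h' \<in> carrier (E\<lparr>carrier := ?H\<rparr>)"
      then obtain u u' where u: "u \<in> carrier M" "h = j u" "u' \<in> carrier M" "h' = j u'" by auto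
      then have "\<xi>' (h \<otimes>\<^bsub>E\<^esub> h') = \<xi>' (j (u \<otimes>\<^bsub>M\<^esub> u'))" by simp
      also have "\<dots> = \<xi> (u \<otimes>\<^bsub>M\<^esub> u')" by (rule \<xi>'j[OF M.m_closed[OF u(1,3)]])
      also have "\<dots> = \<xi>' h \<otimes>\<^bsub>B\<^esub> \<xi>' h'"
        unfolding u(2,4) \<xi>'j[OF u(1)] \<xi>'j[OF u(3)] by (rule hom_grpD(3)[OF \<xi> u(1,3)])
      finally show "\<xi>' (h \<otimes>\<^bsub>E\<lparr>carrier := ?H\<rparr>\<^esub> h') = \<xi>' h \<otimes>\<^bsub>B\<^esub> \<xi>' h'" by simp
    qed
    then obtain \<eta> where \<eta>: "\<eta> \<in> hom E B" "\<forall>h\<in>?H. \<eta> h = \<xi>' h"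
      using extend_hom_of_trivial_Ext1[OF E j.img_is_subgroup B Ext] by blast
    let ?p = "restrict \<eta> (carrier E)"
    have p: "?p \<in> carrier (hom_grp E B)" by (rule restrict_hom[OF E.is_group \<eta>(1)])
    have "\<xi> = pullback M j ?p"
      by (rule hom_grp_eqI[OF \<xi> pullback_closed[OF M j(1) p]])
        (use \<eta>(2) \<xi>'j in \<open>simp add: pullback_def\<close>)
    then show "\<xi> \<in> pullback M j ` carrier (hom_grp E B)" using p by (rule image_eqI)
  qed
qed

section \<open>Permutation modules\<close>

definition unit_vector :: "'r set \<Rightarrow> 'r \<Rightarrow> 'r \<Rightarrow> int" where
  "unit_vector R \<rho> = (\<lambda>\<rho>'\<in>R. if \<rho>' = \<rho> then 1 else 0)"

lemma comm_group_int_power: "comm_group (product_group R (\<lambda>_. integer_group))"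
  by (rule group.group_comm_groupI) (auto intro!: restrict_ext)

lemma unit_vector_PiE [simp]: "unit_vector R \<rho> \<in> R \<rightarrow>\<^sub>E UNIV"
  by (auto simp: unit_vector_def)

lemma unit_vector_closed: "unit_vector R \<rho> \<in> carrier (product_group R (\<lambda>_. integer_group))"
  by simp

text \<open>Evaluation at the unit vectors identifies \<open>Hom(\<int>\<^sup>R, B)\<close> with the functions \<open>R \<rightarrow> B\<close>.  The sum of the
  coordinates of \<open>a\<close> is built up one coordinate at a time.\<close>

lemma hom_int_power_expand:
  assumes R: "finite R" and B: "comm_group B"
    and p: "p \<in> carrier (hom_grp (product_group R (\<lambda>_. integer_group)) B)"
    and a: "a \<in> carrier (product_group R (\<lambda>_. integer_group))"
  shows "p a = finprod B (\<lambda>\<rho>. p (unit_vector R \<rho>) [^]\<^bsub>B\<^esub> a \<rho>) R"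
proof -
  let ?E = "product_group R (\<lambda>_. integer_group)"
  interpret B: comm_group B by fact
  interpret E: comm_group ?E by (rule comm_group_int_power)
  have pc: "p (unit_vector R \<rho>) \<in> carrier B" for \<rho> by (rule hom_grpD(2)[OF p]) simp
  have single: "p (\<lambda>\<rho>'\<in>R. if \<rho>' = \<rho> then m else 0) = p (unit_vector R \<rho>) [^]\<^bsub>B\<^esub> m" for \<rho> m
  proof -
    let ?s = "\<lambda>m::int. p (\<lambda>\<rho>'\<in>R. if \<rho>' = \<rho> then m else 0)"
    have cl: "(\<lambda>\<rho>'\<in>R. if \<rho>' = \<rho> then m else 0) \<in> carrier ?E" for m :: int by auto
    have s: "?s \<in> hom integer_group B"
    proof (rule homI)
      fix m n :: int
      have "(\<lambda>\<rho>'\<in>R. if \<rho>' = \<rho> then m + n else 0) =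
          (\<lambda>\<rho>'\<in>R. if \<rho>' = \<rho> then m else 0) \<otimes>\<^bsub>?E\<^esub> (\<lambda>\<rho>'\<in>R. if \<rho>' = \<rho> then n else 0)"
        by (auto intro!: restrict_ext)
      then have "?s (m + n) = p (\<dots>)" by (rule arg_cong)
      also have "\<dots> = ?s m \<otimes>\<^bsub>B\<^esub> ?s n" by (rule hom_grpD(3)[OF p cl cl])
      finally show "?s (m \<otimes>\<^bsub>integer_group\<^esub> n) = ?s m \<otimes>\<^bsub>B\<^esub> ?s n"
        unfolding mult_integer_group .
    qed (rule hom_grpD(2)[OF p cl])
    have "(1::int) \<in> carrier integer_group" by simp
    from Group.hom_int_pow[OF s this group_integer_group B.is_group, of m]
    show ?thesis unfolding group_int_pow_integer_group mult_1_right unit_vector_def .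
  qed
  have "p (\<lambda>\<rho>\<in>R. if \<rho> \<in> F then a \<rho> else 0) = finprod B (\<lambda>\<rho>. p (unit_vector R \<rho>) [^]\<^bsub>B\<^esub> a \<rho>) F"
    if "finite F" "F \<subseteq> R" for F
    using that
  proof (induction F rule: finite_induct)
    case empty
    have "(\<lambda>\<rho>\<in>R. if \<rho> \<in> {} then a \<rho> else 0) = \<one>\<^bsub>?E\<^esub>" by auto
    then have "p (\<lambda>\<rho>\<in>R. if \<rho> \<in> {} then a \<rho> else 0) = \<one>\<^bsub>B\<^esub>"
      using hom_grp_one[OF E.is_group B.is_group p] by (simp only:)
    then show ?case by (simp only: B.finprod_empty)
  next
    case (insert \<rho> F)
    let ?x = "\<lambda>\<rho>'\<in>R. if \<rho>' = \<rho> then a \<rho> else 0" and ?y = "\<lambda>\<rho>\<in>R. if \<rho> \<in> F then a \<rho> else 0"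
    have xy: "?x \<in> carrier ?E" "?y \<in> carrier ?E" by auto
    have "(\<lambda>\<rho>'\<in>R. if \<rho>' \<in> insert \<rho> F then a \<rho>' else 0) = ?x \<otimes>\<^bsub>?E\<^esub> ?y"
      using insert.hyps by (auto intro!: restrict_ext)
    then have "p (\<lambda>\<rho>'\<in>R. if \<rho>' \<in> insert \<rho> F then a \<rho>' else 0) = p (?x \<otimes>\<^bsub>?E\<^esub> ?y)"
      by (rule arg_cong)
    also have "\<dots> = p ?x \<otimes>\<^bsub>B\<^esub> p ?y" by (rule hom_grpD(3)[OF p xy])
    also have "p ?x = p (unit_vector R \<rho>) [^]\<^bsub>B\<^esub> a \<rho>" by (rule single)
    also have "p ?y = finprod B (\<lambda>\<rho>. p (unit_vector R \<rho>) [^]\<^bsub>B\<^esub> a \<rho>) F"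
      using insert.IH insert.prems by (simp only: insert_subset)
    also have "p (unit_vector R \<rho>) [^]\<^bsub>B\<^esub> a \<rho> \<otimes>\<^bsub>B\<^esub> \<dots> =
        finprod B (\<lambda>\<rho>. p (unit_vector R \<rho>) [^]\<^bsub>B\<^esub> a \<rho>) (insert \<rho> F)"
      using insert.hyps pc by simp
    finally show ?case .
  qed
  moreover have "(\<lambda>\<rho>\<in>R. if \<rho> \<in> R then a \<rho> else 0) = restrict a R" by (rule restrict_ext) simp
  moreover have "restrict a R = a" using a by (simp add: PiE_restrict)
  ultimately show ?thesis using R by (metis subset_refl)
qed

lemma hom_int_power_eqI:
  assumes "finite R" "comm_group B"
    and p: "p \<in> carrier (hom_grp (product_group R (\<lambda>_. integer_group)) B)"
    and q: "q \<in> carrier (hom_grp (product_group R (\<lambda>_. integer_group)) B)"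
    and eq: "\<And>\<rho>. \<rho> \<in> R \<Longrightarrow> p (unit_vector R \<rho>) = q (unit_vector R \<rho>)"
  shows "p = q"
proof (rule hom_grp_eqI[OF p q])
  interpret B: comm_group B by fact
  fix a assume a: "a \<in> carrier (product_group R (\<lambda>_. integer_group))"
  have "q (unit_vector R \<rho>) \<in> carrier B" for \<rho> by (rule hom_grpD(2)[OF q]) simp
  then show "p a = q a"
    unfolding hom_int_power_expand[OF assms(1,2) p a] hom_int_power_expand[OF assms(1,2) q a]
    by (intro B.finprod_cong') (auto simp: eq)
qed

lemma hom_int_power_exists:
  assumes R: "finite R" and B: "comm_group B" and b: "b \<in> R \<rightarrow> carrier B"
  shows "\<exists>p\<in>carrier (hom_grp (product_group R (\<lambda>_. integer_group)) B).
    \<forall>\<rho>\<in>R. p (unit_vector R \<rho>) = b \<rho>"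
proof -
  let ?E = "product_group R (\<lambda>_. integer_group)"
  interpret B: comm_group B by fact
  have bc: "b \<rho> \<in> carrier B" if "\<rho> \<in> R" for \<rho> using b that by auto
  let ?p = "\<lambda>a\<in>carrier ?E. finprod B (\<lambda>\<rho>. b \<rho> [^]\<^bsub>B\<^esub> a \<rho>) R"
  have "?p \<in> carrier (hom_grp ?E B)"
  proof (rule hom_grpI)
    fix x y assume xy: "x \<in> carrier ?E" "y \<in> carrier ?E"
    have "x \<otimes>\<^bsub>?E\<^esub> y \<in> carrier ?E"
      by (rule monoid.m_closed[OF group.is_monoid xy]) simp
    then have "?p (x \<otimes>\<^bsub>?E\<^esub> y) = finprod B (\<lambda>\<rho>. b \<rho> [^]\<^bsub>B\<^esub> ((x \<otimes>\<^bsub>?E\<^esub> y) \<rho>)) R"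
      by (rule restrict_apply')
    also have "\<dots> = finprod B (\<lambda>\<rho>. b \<rho> [^]\<^bsub>B\<^esub> x \<rho> \<otimes>\<^bsub>B\<^esub> b \<rho> [^]\<^bsub>B\<^esub> y \<rho>) R"
      by (rule B.finprod_cong') (auto simp: bc B.int_pow_mult)
    also have "\<dots> = ?p x \<otimes>\<^bsub>B\<^esub> ?p y"
      using xy by (subst B.finprod_multf) (auto simp: bc)
    finally show "?p (x \<otimes>\<^bsub>?E\<^esub> y) = ?p x \<otimes>\<^bsub>B\<^esub> ?p y" .
  next
    fix x assume "x \<in> carrier ?E"
    then show "?p x \<in> carrier B" by (auto simp: bc intro!: B.finprod_closed)
  qed auto
  moreover have "?p (unit_vector R \<rho>) = b \<rho>" if \<rho>: "\<rho> \<in> R" for \<rho>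
  proof -
    have "?p (unit_vector R \<rho>) = finprod B (\<lambda>\<rho>'. b \<rho>' [^]\<^bsub>B\<^esub> unit_vector R \<rho> \<rho>') R"
      by (rule restrict_apply') simp
    also have "\<dots> = finprod B (\<lambda>\<rho>'. if \<rho> = \<rho>' then b \<rho>' else \<one>\<^bsub>B\<^esub>) R"
      by (rule B.finprod_cong') (auto simp: bc unit_vector_def)
    also have "\<dots> = b \<rho>" by (rule B.finprod_singleton) (use \<rho> R b in auto)
    finally show ?thesis .
  qed
  ultimately show ?thesis by blast
qed

context galois_extension
begin

lemma comm_group_units: "comm_group (units_of K)"
  by (rule units_comm_group)

lemma carrier_units: "carrier (units_of K) = carrier K - {\<zero>}"
  by (simp add: units_of_carrier field_Units)

lemma Gal_units_hom:
  assumes g: "g \<in> carrier (Gal K k)" shows "g \<in> hom (units_of K) (units_of K)"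
proof (rule homI)
  fix x assume x: "x \<in> carrier (units_of K)"
  have inj: "inj_on g (carrier K)" using Gal_memE(2)[OF g] by (auto simp: Bij_def bij_betw_def)
  have "g \<zero> = \<zero>" by (rule ring_hom_cring.hom_zero[OF Gal_ring_hom_cring[OF g]])
  then have "g x \<noteq> \<zero>"
    using x inj_onD[OF inj, of x \<zero>] by (auto simp: carrier_units)
  then show "g x \<in> carrier (units_of K)" using x g by (simp add: carrier_units Gal_closed)
next
  fix x y assume "x \<in> carrier (units_of K)" "y \<in> carrier (units_of K)"
  then show "g (x \<otimes>\<^bsub>units_of K\<^esub> y) = g x \<otimes>\<^bsub>units_of K\<^esub> g y"
    using ring_hom_mult[OF Gal_ring_hom[OF g]] by (simp add: carrier_units units_of_mult)
qed

lemma twisted_units_gmodule: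
  assumes "gmodule (Gal K k) A \<alpha>"
  shows "gmodule (Gal K k) (hom_grp A (units_of K)) (twisted_act (Gal K k) A \<alpha>)"
  by (rule twisted_gmodule[OF assms comm_group_units Gal_units_hom])
    (auto simp: Gal_one Gal_mult carrier_units)

text \<open>Hilbert 90 for \<open>Hom(\<int>\<^sup>R, K\<^sup>\<times>)\<close> and a cyclic group.  Evaluated at unit vectors, the cocycle with
  value \<open>p\<close> at the generator becomes a cocycle of functions on \<open>R\<close>, and a function \<open>b\<close> with
  \<open>c\<^sub>g \<cdot> g b = b\<close> yields \<open>q\<close> as the inverse of the homomorphism with values \<open>b\<close>.\<close>

theorem hilbert90_permutation_module:
  fixes \<pi> :: "('k \<Rightarrow> 'k) \<Rightarrow> 'r \<Rightarrow> 'r" and R :: "'r set"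
  defines "E \<equiv> product_group R (\<lambda>_. integer_group)"
  assumes R: "finite R"
    and \<pi>_closed: "\<And>g \<rho>. g \<in> carrier (Gal K k) \<Longrightarrow> \<rho> \<in> R \<Longrightarrow> \<pi> g \<rho> \<in> R"
    and \<pi>_one: "\<And>\<rho>. \<rho> \<in> R \<Longrightarrow> \<pi> \<one>\<^bsub>Gal K k\<^esub> \<rho> = \<rho>"
    and \<pi>_mult: "\<And>g h \<rho>. g \<in> carrier (Gal K k) \<Longrightarrow> h \<in> carrier (Gal K k) \<Longrightarrow> \<rho> \<in> R \<Longrightarrow>
      \<pi> (g \<otimes>\<^bsub>Gal K k\<^esub> h) \<rho> = \<pi> g (\<pi> h \<rho>)"
    and \<alpha>: "\<And>g \<rho>. g \<in> carrier (Gal K k) \<Longrightarrow> \<rho> \<in> R \<Longrightarrow>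
      \<alpha> g (unit_vector R \<rho>) = unit_vector R (\<pi> g \<rho>)"
    and P: "cyclic_gmodule (Gal K k) (hom_grp E (units_of K)) (twisted_act (Gal K k) E \<alpha>) \<tau>"
    and p: "p \<in> carrier (hom_grp E (units_of K))"
    and Np: "norm_map (Gal K k) (hom_grp E (units_of K)) (twisted_act (Gal K k) E \<alpha>) p =
      \<one>\<^bsub>hom_grp E (units_of K)\<^esub>"
  shows "\<exists>q\<in>carrier (hom_grp E (units_of K)).
    p = twisted_act (Gal K k) E \<alpha> \<tau> q \<otimes>\<^bsub>hom_grp E (units_of K)\<^esub> inv\<^bsub>hom_grp E (units_of K)\<^esub> q"
proof -
  let ?\<Gamma> = "carrier (Gal K k)" and ?B = "units_of K" and ?P = "hom_grp E (units_of K)"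
  let ?act = "twisted_act (Gal K k) E \<alpha>"
  interpret \<Gamma>: group "Gal K k" by (rule group_Gal)
  interpret P: cyclic_gmodule "Gal K k" ?P ?act \<tau> by (rule P)
  let ?c = "P.cyclic_cocycle p"
  have c: "?c \<in> cocycles1 (Gal K k) ?P ?act" by (rule P.cyclic_cocycle_is_cocycle[OF p Np])
  have c\<tau>: "?c \<tau> = p" by (rule P.cyclic_cocycle_generator[OF p Np])
  have cP: "?c g \<in> carrier ?P" if "g \<in> ?\<Gamma>" for g using c that unfolding cocycles1_def by blast
  have eE: "unit_vector R \<rho> \<in> carrier E" for \<rho> unfolding E_def by (rule unit_vector_closed)
  have act_e: "?act g q (unit_vector R \<rho>) = g (q (unit_vector R (\<pi> (inv\<^bsub>Gal K k\<^esub> g) \<rho>)))"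
    if "g \<in> ?\<Gamma>" "\<rho> \<in> R" for g q \<rho>
    using that eE by (simp add: twisted_act_def \<alpha>)
  have mult_e: "(p \<otimes>\<^bsub>?P\<^esub> q) (unit_vector R \<rho>) = p (unit_vector R \<rho>) \<otimes> q (unit_vector R \<rho>)" for p q \<rho>
    using eE by (simp add: units_of_mult)
  have unit: "?c g (unit_vector R \<rho>) \<in> carrier K - {\<zero>}" if "g \<in> ?\<Gamma>" for g \<rho>
    using hom_grpD(2)[OF cP[OF that] eE] by (simp add: carrier_units)
  have coc: "?c (g \<otimes>\<^bsub>Gal K k\<^esub> h) (unit_vector R \<rho>) =
      ?c g (unit_vector R \<rho>) \<otimes> g (?c h (unit_vector R (\<pi> (inv\<^bsub>Gal K k\<^esub> g) \<rho>)))"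
    if "g \<in> ?\<Gamma>" "h \<in> ?\<Gamma>" "\<rho> \<in> R" for g h \<rho>
  proof -
    have "?c (g \<otimes>\<^bsub>Gal K k\<^esub> h) = ?c g \<otimes>\<^bsub>?P\<^esub> ?act g (?c h)"
      using c that unfolding cocycles1_def by blast
    then show ?thesis using mult_e act_e that by simp
  qed
  have "\<exists>b. (\<forall>\<rho>\<in>R. b \<rho> \<in> carrier K - {\<zero>}) \<and> (\<forall>g\<in>?\<Gamma>. \<forall>\<rho>\<in>R.
      ?c g (unit_vector R \<rho>) \<otimes> g (b (\<pi> (inv\<^bsub>Gal K k\<^esub> g) \<rho>)) = b \<rho>)"
    using \<pi>_closed \<pi>_one \<pi>_mult unit coc
    by (rule hilbert90_permutation[where R = R and \<pi> = \<pi> and c = "\<lambda>g \<rho>. ?c g (unit_vector R \<rho>)"])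
  then obtain b where b: "\<And>\<rho>. \<rho> \<in> R \<Longrightarrow> b \<rho> \<in> carrier ?B"
    "\<And>g \<rho>. g \<in> ?\<Gamma> \<Longrightarrow> \<rho> \<in> R \<Longrightarrow>
      ?c g (unit_vector R \<rho>) \<otimes> g (b (\<pi> (inv\<^bsub>Gal K k\<^esub> g) \<rho>)) = b \<rho>"
    unfolding carrier_units by metis
  obtain q where q: "q \<in> carrier ?P" "\<And>\<rho>. \<rho> \<in> R \<Longrightarrow> q (unit_vector R \<rho>) = b \<rho>"
    using hom_int_power_exists[OF R comm_group_units, of b] b(1) unfolding E_def by auto
  have \<tau>: "\<tau> \<in> ?\<Gamma>" by (rule P.generator)
  have aq: "?act \<tau> q \<in> carrier ?P" by (rule P.act_closed[OF \<tau> q(1)])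
  have "p \<otimes>\<^bsub>?P\<^esub> ?act \<tau> q = q"
  proof (rule hom_int_power_eqI[OF R comm_group_units])
    show "p \<otimes>\<^bsub>?P\<^esub> ?act \<tau> q \<in> carrier (hom_grp (product_group R (\<lambda>_. integer_group)) ?B)"
      using P.m_closed[OF p aq] unfolding E_def .
    show "q \<in> carrier (hom_grp (product_group R (\<lambda>_. integer_group)) ?B)"
      using q(1) unfolding E_def .
    fix \<rho> assume \<rho>: "\<rho> \<in> R"
    show "(p \<otimes>\<^bsub>?P\<^esub> ?act \<tau> q) (unit_vector R \<rho>) = q (unit_vector R \<rho>)"
      unfolding mult_e act_e[OF \<tau> \<rho>]
      using b(2)[OF \<tau> \<rho>] q(2) \<pi>_closed[OF \<Gamma>.inv_closed[OF \<tau>] \<rho>] \<rho> by (simp add: c\<tau>)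
  qed
  then have "p = q \<otimes>\<^bsub>?P\<^esub> inv\<^bsub>?P\<^esub> ?act \<tau> q"
    using p aq q(1) by (metis P.inv_solve_right)
  also have "\<dots> = ?act \<tau> (inv\<^bsub>?P\<^esub> q) \<otimes>\<^bsub>?P\<^esub> inv\<^bsub>?P\<^esub> (inv\<^bsub>?P\<^esub> q)"
    unfolding P.act_inv[OF \<tau> q(1)] P.inv_inv[OF q(1)]
    by (rule P.m_comm[OF q(1) P.inv_closed[OF aq]])
  finally show ?thesis using P.inv_closed[OF q(1)] by (rule bexI)
qed

end

text \<open>Exponents may be reduced modulo the order, which makes them nonnegative.\<close>

lemma (in group) cyclic_group_nat_powers:
  assumes "finite (carrier G)" "cyclic_group G"
  shows "\<exists>x\<in>carrier G. carrier G = range (\<lambda>i::nat. x [^] i)"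
proof -
  obtain x where x: "x \<in> carrier G" "carrier G = range (\<lambda>n::int. x [^] n)"
    using assms(2) cyclic_group by auto
  have "range (\<lambda>n::int. x [^] n) \<subseteq> range (\<lambda>i::nat. x [^] i)"
  proof
    fix y assume "y \<in> range (\<lambda>n::int. x [^] n)"
    then obtain n :: int where n: "y = x [^] n" by auto
    let ?o = "int (order G)"
    have o: "?o > 0" using assms(1) order_gt_0_iff_finite by simp
    have "x [^] ?o = \<one>" using pow_order_eq_1[OF x(1)] by (simp add: int_pow_int)
    then have "x [^] (?o * (n div ?o)) = \<one>"
      using int_pow_pow[OF x(1), of ?o "n div ?o"] by simp
    moreover have "x [^] n = x [^] (?o * (n div ?o)) \<otimes> x [^] (n mod ?o)"
      using int_pow_mult[OF x(1), of "?o * (n div ?o)" "n mod ?o"] by simp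
    ultimately have "y = x [^] (n mod ?o)" using n x(1) by simp
    also have "\<dots> = x [^] nat (n mod ?o)"
      using int_pow_int[of G x "nat (n mod ?o)"] o by simp
    finally show "y \<in> range (\<lambda>i::nat. x [^] i)" by simp
  qed
  moreover have "range (\<lambda>i::nat. x [^] i) \<subseteq> carrier G" using x(1) by auto
  ultimately have "carrier G = range (\<lambda>i::nat. x [^] i)" using x(2) by simp
  then show ?thesis using x(1) by (rule bexI)
qed

section \<open>The Galois modules of a fan\<close>

locale fan_action = G: group \<Gamma> for \<Gamma> :: "('g, 'm) monoid_scheme" +
  fixes N :: "'v::real_vector set" and \<Sigma> :: "'v set set" and \<phi> :: "'g \<Rightarrow> 'v \<Rightarrow> 'v"
  assumes N: "full_lattice N" and F: "fan N \<Sigma>" and full_rank: "spans_full_rank N \<Sigma>"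
    and \<phi>: "\<phi> \<in> hom \<Gamma> (fan_aut N \<Sigma>)"
begin

lemma \<phi>_aut: "g \<in> carrier \<Gamma> \<Longrightarrow> \<phi> g \<in> carrier (fan_aut N \<Sigma>)"
  using \<phi> by (rule hom_in_carrier)

lemma \<phi>D:
  assumes "g \<in> carrier \<Gamma>" shows "linear (\<phi> g)" "bij (\<phi> g)" "\<And>n. n \<in> N \<Longrightarrow> \<phi> g n \<in> N"
  using \<phi>_aut[OF assms] by (auto simp: fan_aut_def)

lemma \<phi>_mult:
  "g \<in> carrier \<Gamma> \<Longrightarrow> h \<in> carrier \<Gamma> \<Longrightarrow> \<phi> (g \<otimes>\<^bsub>\<Gamma>\<^esub> h) = \<phi> g \<circ> \<phi> h"
  using hom_mult[OF \<phi>] by (simp add: fan_aut_def)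

text \<open>Homomorphisms are only required to respect products; the value at 1 is an idempotent bijection,
  hence the identity.\<close>

lemma \<phi>_one: "\<phi> \<one>\<^bsub>\<Gamma>\<^esub> = id"
proof
  fix x
  have "\<phi> \<one>\<^bsub>\<Gamma>\<^esub> (\<phi> \<one>\<^bsub>\<Gamma>\<^esub> x) = \<phi> \<one>\<^bsub>\<Gamma>\<^esub> x"
    using fun_cong[OF \<phi>_mult[OF G.one_closed G.one_closed], of x] by simp
  then show "\<phi> \<one>\<^bsub>\<Gamma>\<^esub> x = id x"
    using injD[OF bij_is_inj[OF \<phi>D(2)[OF G.one_closed]]] by simp
qed

lemma \<phi>_inv:
  assumes "g \<in> carrier \<Gamma>" shows "inv_into UNIV (\<phi> g) = \<phi> (inv\<^bsub>\<Gamma>\<^esub> g)"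
proof (rule inv_unique_comp)
  show "\<phi> g \<circ> \<phi> (inv\<^bsub>\<Gamma>\<^esub> g) = id" "\<phi> (inv\<^bsub>\<Gamma>\<^esub> g) \<circ> \<phi> g = id"
    using assms by (simp_all add: \<phi>_mult[symmetric] \<phi>_one)
qed

lemma \<phi>_inv_mult:
  "g \<in> carrier \<Gamma> \<Longrightarrow> h \<in> carrier \<Gamma> \<Longrightarrow>
    \<phi> (inv\<^bsub>\<Gamma>\<^esub> (g \<otimes>\<^bsub>\<Gamma>\<^esub> h)) = \<phi> (inv\<^bsub>\<Gamma>\<^esub> h) \<circ> \<phi> (inv\<^bsub>\<Gamma>\<^esub> g)"
  by (simp add: G.inv_mult_group \<phi>_mult)

lemma ray_closed: "g \<in> carrier \<Gamma> \<Longrightarrow> \<rho> \<in> rays \<Sigma> \<Longrightarrow> \<phi> g ` \<rho> \<in> rays \<Sigma>"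
  using fan_aut_rays(1)[OF N F \<phi>_aut] .

lemma ray_gen_\<phi>:
  "g \<in> carrier \<Gamma> \<Longrightarrow> \<rho> \<in> rays \<Sigma> \<Longrightarrow> ray_gen N (\<phi> g ` \<rho>) = \<phi> g (ray_gen N \<rho>)"
  using fan_aut_rays(2)[OF N F \<phi>_aut] .

lemma char_act_eq:
  "g \<in> carrier \<Gamma> \<Longrightarrow> char_act N (\<phi> g) u = (\<lambda>n\<in>N. u (\<phi> (inv\<^bsub>\<Gamma>\<^esub> g) n))"
  by (simp add: char_act_def \<phi>_inv)

lemma ray_act_eq:
  "g \<in> carrier \<Gamma> \<Longrightarrow> ray_act \<Sigma> (\<phi> g) a = (\<lambda>\<rho>\<in>rays \<Sigma>. a (\<phi> (inv\<^bsub>\<Gamma>\<^esub> g) ` \<rho>))"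
  by (simp add: ray_act_def \<phi>_inv)

lemma char_lattice_iff:
  "u \<in> carrier (char_lattice N) \<longleftrightarrow>
    (\<forall>x\<in>N. \<forall>y\<in>N. u (x + y) = u x + u y) \<and> u \<in> extensional N"
  by (auto simp: char_lattice_def add_group_def hom_def)

lemma char_lattice_mult: "u \<otimes>\<^bsub>char_lattice N\<^esub> w = (\<lambda>n\<in>N. u n + w n)"
  by (simp add: char_lattice_def add_group_def)

lemma comm_group_char_lattice: "comm_group (char_lattice N)"
  unfolding char_lattice_def
  by (rule comm_group_hom_grp)
    (simp_all add: comm_group_add_group[OF N, THEN comm_group.axioms(2)] abelian_integer_group)

lemma char_gmodule: "gmodule \<Gamma> (char_lattice N) (\<lambda>g. char_act N (\<phi> g))"
proof (intro gmodule.intro gmodule_axioms.intro)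
  show "group \<Gamma>" by (rule G.is_group)
  show "comm_group (char_lattice N)" by (rule comm_group_char_lattice)
next
  fix g assume g: "g \<in> carrier \<Gamma>"
  then have i: "inv\<^bsub>\<Gamma>\<^esub> g \<in> carrier \<Gamma>" by simp
  show "char_act N (\<phi> g) \<in> hom (char_lattice N) (char_lattice N)"
  proof (rule homI)
    fix u assume u: "u \<in> carrier (char_lattice N)"
    then show "char_act N (\<phi> g) u \<in> carrier (char_lattice N)"
      using \<phi>D(3)[OF i] lattice_add[OF N] linear_add[OF \<phi>D(1)[OF i]]
      by (auto simp: char_lattice_iff char_act_eq[OF g])
  next
    fix u w
    show "char_act N (\<phi> g) (u \<otimes>\<^bsub>char_lattice N\<^esub> w) =
        char_act N (\<phi> g) u \<otimes>\<^bsub>char_lattice N\<^esub> char_act N (\<phi> g) w"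
      using \<phi>D(3)[OF i] by (auto simp: char_lattice_mult char_act_eq[OF g] intro!: restrict_ext)
  qed
next
  fix u assume "u \<in> carrier (char_lattice N)"
  moreover have "char_act N (\<phi> \<one>\<^bsub>\<Gamma>\<^esub>) u = restrict u N"
    using char_act_eq[OF G.one_closed, of u] by (simp add: \<phi>_one)
  ultimately show "char_act N (\<phi> \<one>\<^bsub>\<Gamma>\<^esub>) u = u"
    by (simp add: char_lattice_iff extensional_restrict)
next
  fix g h u assume gh: "g \<in> carrier \<Gamma>" "h \<in> carrier \<Gamma>"
  then have i: "inv\<^bsub>\<Gamma>\<^esub> g \<in> carrier \<Gamma>" by simp
  show "char_act N (\<phi> (g \<otimes>\<^bsub>\<Gamma>\<^esub> h)) u = char_act N (\<phi> g) (char_act N (\<phi> h) u)"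
    unfolding char_act_eq[OF gh(1)] char_act_eq[OF gh(2)] char_act_eq[OF G.m_closed[OF gh]] \<phi>_inv_mult[OF gh]
    by (rule restrict_ext) (simp add: \<phi>D(3)[OF i])
qed

lemma comm_group_ray_lattice: "comm_group (ray_lattice \<Sigma>)"
  unfolding ray_lattice_def by (rule comm_group_int_power)

lemma ray_gmodule: "gmodule \<Gamma> (ray_lattice \<Sigma>) (\<lambda>g. ray_act \<Sigma> (\<phi> g))"
proof (intro gmodule.intro gmodule_axioms.intro)
  show "group \<Gamma>" by (rule G.is_group)
  show "comm_group (ray_lattice \<Sigma>)" by (rule comm_group_ray_lattice)
next
  fix g assume g: "g \<in> carrier \<Gamma>"
  then have i: "inv\<^bsub>\<Gamma>\<^esub> g \<in> carrier \<Gamma>" by simp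
  show "ray_act \<Sigma> (\<phi> g) \<in> hom (ray_lattice \<Sigma>) (ray_lattice \<Sigma>)"
    by (rule homI)
      (use ray_closed[OF i] in \<open>auto simp: ray_lattice_def ray_act_eq[OF g] intro!: restrict_ext\<close>)
next
  fix a assume "a \<in> carrier (ray_lattice \<Sigma>)"
  moreover have "ray_act \<Sigma> (\<phi> \<one>\<^bsub>\<Gamma>\<^esub>) a = restrict a (rays \<Sigma>)"
    using ray_act_eq[OF G.one_closed, of a] by (simp add: \<phi>_one)
  ultimately show "ray_act \<Sigma> (\<phi> \<one>\<^bsub>\<Gamma>\<^esub>) a = a"
    by (simp add: ray_lattice_def PiE_restrict)
next
  fix g h a assume gh: "g \<in> carrier \<Gamma>" "h \<in> carrier \<Gamma>"
  then have i: "inv\<^bsub>\<Gamma>\<^esub> g \<in> carrier \<Gamma>" by simp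
  show "ray_act \<Sigma> (\<phi> (g \<otimes>\<^bsub>\<Gamma>\<^esub> h)) a = ray_act \<Sigma> (\<phi> g) (ray_act \<Sigma> (\<phi> h) a)"
    unfolding ray_act_eq[OF gh(1)] ray_act_eq[OF gh(2)] ray_act_eq[OF G.m_closed[OF gh]] \<phi>_inv_mult[OF gh]
    by (rule restrict_ext) (simp add: ray_closed[OF i] image_image)
qed

text \<open>The ray lattice is a permutation module: \<open>\<Gamma>\<close> permutes its unit vectors as it permutes the rays.\<close>

lemma ray_act_unit_vector:
  assumes g: "g \<in> carrier \<Gamma>"
  shows "ray_act \<Sigma> (\<phi> g) (unit_vector (rays \<Sigma>) \<rho>) = unit_vector (rays \<Sigma>) (\<phi> g ` \<rho>)"
proof -
  have i: "inv\<^bsub>\<Gamma>\<^esub> g \<in> carrier \<Gamma>" using g by simp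
  have "\<phi> (inv\<^bsub>\<Gamma>\<^esub> g) ` \<rho>' = \<rho> \<longleftrightarrow> \<rho>' = \<phi> g ` \<rho>" for \<rho>'
  proof -
    have "\<phi> g ` \<phi> (inv\<^bsub>\<Gamma>\<^esub> g) ` \<rho>' = \<rho>'" "\<phi> (inv\<^bsub>\<Gamma>\<^esub> g) ` \<phi> g ` \<rho> = \<rho>"
      using g i by (simp_all add: image_comp \<phi>_mult[symmetric] \<phi>_one)
    then show ?thesis by auto
  qed
  then show ?thesis
    using ray_closed[OF i] by (auto simp: ray_act_eq[OF g] unit_vector_def intro!: restrict_ext)
qed

lemma char_to_ray_hom: "char_to_ray N \<Sigma> \<in> hom (char_lattice N) (ray_lattice \<Sigma>)"
  by (rule homI)
    (use ray_gen_in_lattice(1)[OF N F] in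
      \<open>auto simp: char_to_ray_def ray_lattice_def char_lattice_mult intro!: restrict_ext\<close>)

lemma inj_char_to_ray: "inj_on (char_to_ray N \<Sigma>) (carrier (char_lattice N))"
proof (rule inj_onI)
  fix u w assume u: "u \<in> carrier (char_lattice N)" and w: "w \<in> carrier (char_lattice N)"
    and eq: "char_to_ray N \<Sigma> u = char_to_ray N \<Sigma> w"
  let ?d = "\<lambda>n. u n - w n"
  have d: "?d \<in> hom (add_group N) integer_group"
    using u w by (auto simp: char_lattice_iff add_group_def hom_def)
  have "?d (ray_gen N \<rho>) = 0" if "\<rho> \<in> rays \<Sigma>" for \<rho>
    using fun_cong[OF eq, of \<rho>] that by (simp add: char_to_ray_def)
  then have "?d n = 0" if "n \<in> N" for n
    by (rule character_vanishing_on_rays[OF N F full_rank d that])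
  then show "u = w" using u w by (auto simp: char_lattice_iff intro!: extensionalityI[of _ N])
qed

lemma char_to_ray_equivariant:
  assumes g: "g \<in> carrier \<Gamma>"
  shows "char_to_ray N \<Sigma> (char_act N (\<phi> g) u) = ray_act \<Sigma> (\<phi> g) (char_to_ray N \<Sigma> u)"
proof -
  have i: "inv\<^bsub>\<Gamma>\<^esub> g \<in> carrier \<Gamma>" using g by simp
  show ?thesis
    unfolding char_to_ray_def ray_act_eq[OF g] char_act_eq[OF g]
    by (rule restrict_ext)
      (use ray_closed[OF i] ray_gen_\<phi>[OF i] ray_gen_in_lattice(1)[OF N F] in simp)
qed

lemma subgroup_principal: "subgroup (principal N \<Sigma>) (ray_lattice \<Sigma>)"
proof -
  have "group_hom (char_lattice N) (ray_lattice \<Sigma>) (char_to_ray N \<Sigma>)"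
    using char_to_ray_hom comm_group_char_lattice comm_group_ray_lattice
    by (simp add: group_hom_def group_hom_axioms_def comm_group_def)
  then show ?thesis unfolding principal_def by (rule group_hom.img_is_subgroup)
qed

lemma class_gmodule:
  shows "gmodule \<Gamma> (class_group N \<Sigma>) (\<lambda>g. class_act \<Sigma> (\<phi> g))"
    and "\<And>g a. g \<in> carrier \<Gamma> \<Longrightarrow> a \<in> carrier (ray_lattice \<Sigma>) \<Longrightarrow>
      ray_class N \<Sigma> (ray_act \<Sigma> (\<phi> g) a) = class_act \<Sigma> (\<phi> g) (ray_class N \<Sigma> a)"
proof -
  interpret M: gmodule \<Gamma> "char_lattice N" "\<lambda>g. char_act N (\<phi> g)" by (rule char_gmodule)
  have inv: "ray_act \<Sigma> (\<phi> g) a \<in> principal N \<Sigma>"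
    if g: "g \<in> carrier \<Gamma>" and a: "a \<in> principal N \<Sigma>" for g a
  proof -
    obtain u where u: "u \<in> carrier (char_lattice N)" "a = char_to_ray N \<Sigma> u"
      using a by (auto simp: principal_def)
    then show ?thesis
      using M.act_closed[OF g u(1)] unfolding principal_def
      by (auto simp: char_to_ray_equivariant[OF g, symmetric])
  qed
  show "gmodule \<Gamma> (class_group N \<Sigma>) (\<lambda>g. class_act \<Sigma> (\<phi> g))"
    unfolding class_group_def class_act_def
    by (rule quotient_gmodule(1)[OF ray_gmodule subgroup_principal inv])
  show "\<And>g a. g \<in> carrier \<Gamma> \<Longrightarrow> a \<in> carrier (ray_lattice \<Sigma>) \<Longrightarrow>
      ray_class N \<Sigma> (ray_act \<Sigma> (\<phi> g) a) = class_act \<Sigma> (\<phi> g) (ray_class N \<Sigma> a)"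
    unfolding ray_class_def class_act_def
    by (rule quotient_gmodule(2)[OF ray_gmodule subgroup_principal inv])
qed

lemma finite_rays: "finite (rays \<Sigma>)"
  using F by (auto simp: fan_def rays_def)

end

section \<open>The first cohomology of the twisted torus\<close>

theorem theorem4p1:
  fixes N :: "'v::real_vector set" and \<Sigma> :: "'v set set"
    and K :: "('k, 'm) ring_scheme" and k :: "'k set"
    and \<phi> :: "('k \<Rightarrow> 'k) \<Rightarrow> ('v \<Rightarrow> 'v)"
  assumes "full_lattice N"
    and "fan N \<Sigma>"
    and "spans_full_rank N \<Sigma>"
    and "finite_galois K k"
    and "cyclic_group (Gal K k)"
    and "trivial_group (Ext1 (class_group N \<Sigma>) (units_of K))"
    and "\<phi> \<in> hom (Gal K k) (fan_aut N \<Sigma>)"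
  shows "H1 (Gal K k) (torus N K) (torus_act N K k \<phi>) \<cong> norm_quotient N \<Sigma> K k \<phi>"
proof -
  interpret galois_extension K k
    using assms(4)
    by (auto simp: finite_galois_def galois_extension_def galois_extension_axioms_def)
  interpret \<Gamma>: group "Gal K k" by (rule group_Gal)
  interpret fan_action "Gal K k" N \<Sigma> \<phi>
    by unfold_locales (fact assms)+
  obtain \<tau> where \<tau>: "\<tau> \<in> carrier (Gal K k)" "carrier (Gal K k) = range (\<lambda>i::nat. \<tau> [^]\<^bsub>Gal K k\<^esub> i)"
    using \<Gamma>.cyclic_group_nat_powers[OF finite_Gal assms(5)] by blast
  have cyclic: "cyclic_gmodule (Gal K k) A act \<tau>" if "gmodule (Gal K k) A act"
    for A :: "('x, 'y) monoid_scheme" and act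
    using that finite_Gal \<tau> by (simp add: cyclic_gmodule_def cyclic_gmodule_axioms_def)
  let ?M = "char_lattice N" and ?E = "ray_lattice \<Sigma>" and ?C = "class_group N \<Sigma>"
  have T: "gmodule (Gal K k) (torus N K) (torus_act N K k \<phi>)"
    unfolding torus_def torus_act_def by (rule twisted_units_gmodule[OF char_gmodule])
  have P: "gmodule (Gal K k) (ray_torus \<Sigma> K) (ray_torus_act \<Sigma> K k \<phi>)"
    unfolding ray_torus_def ray_torus_act_def by (rule twisted_units_gmodule[OF ray_gmodule])
  have G: "gmodule (Gal K k) (G_group N \<Sigma> K) (G_group_act N \<Sigma> K k \<phi>)"
    unfolding G_group_def G_group_act_def by (rule twisted_units_gmodule[OF class_gmodule(1)])
  have M: "group ?M" and E: "group ?E"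
    using comm_group_char_lattice comm_group_ray_lattice by (auto simp: comm_group_def)
  have cls: "ray_class N \<Sigma> \<in> hom ?E ?C" "ray_class N \<Sigma> ` carrier ?E = carrier ?C"
    using quotient_map_hom[OF comm_group_ray_lattice subgroup_principal]
    unfolding ray_class_def[abs_def] class_group_def by simp_all
  let ?i = "pullback ?E (ray_class N \<Sigma>)" and ?r = "pullback ?M (char_to_ray N \<Sigma>)"
  have i: "G_incl N \<Sigma> = ?i" by (rule ext) (simp add: G_incl_def pullback_def)
  have "H1 (Gal K k) (torus N K) (torus_act N K k \<phi>) \<cong> (ray_torus \<Sigma> K)\<lparr>carrier :=
        ?i ` invariants (Gal K k) (G_group N \<Sigma> K) (G_group_act N \<Sigma> K k \<phi>)
        \<inter> norm_map (Gal K k) (ray_torus \<Sigma> K) (ray_torus_act \<Sigma> K k \<phi>) ` carrier (ray_torus \<Sigma> K)\<rparr>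
     Mod (?i ` norm_map (Gal K k) (G_group N \<Sigma> K) (G_group_act N \<Sigma> K k \<phi>) ` carrier (G_group N \<Sigma> K))"
  proof (rule cyclic_H1_iso_norm_quotient[where \<sigma> = \<tau> and r = ?r and i = ?i
        and actG = "G_group_act N \<Sigma> K k \<phi>" and actP = "ray_torus_act \<Sigma> K k \<phi>"])
    show "cyclic_gmodule (Gal K k) (G_group N \<Sigma> K) (G_group_act N \<Sigma> K k \<phi>) \<tau>" by (rule cyclic[OF G])
    show PC: "cyclic_gmodule (Gal K k) (ray_torus \<Sigma> K) (ray_torus_act \<Sigma> K k \<phi>) \<tau>" by (rule cyclic[OF P])
    show "cyclic_gmodule (Gal K k) (torus N K) (torus_act N K k \<phi>) \<tau>" by (rule cyclic[OF T])
    show "?i \<in> hom (G_group N \<Sigma> K) (ray_torus \<Sigma> K)"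
      unfolding G_group_def ray_torus_def by (rule pullback_hom[OF E cls(1)])
    show "inj_on ?i (carrier (G_group N \<Sigma> K))"
      unfolding G_group_def by (rule inj_on_pullback[OF cls(2)])
    show "?r \<in> hom (ray_torus \<Sigma> K) (torus N K)"
      unfolding ray_torus_def torus_def by (rule pullback_hom[OF M char_to_ray_hom])
    show "?r ` carrier (ray_torus \<Sigma> K) = carrier (torus N K)"
      unfolding ray_torus_def torus_def
      by (rule surj_pullback[OF M comm_group_ray_lattice comm_group_units char_to_ray_hom inj_char_to_ray])
        (use assms(6) in \<open>simp add: class_group_def principal_def\<close>)
    show "?i ` carrier (G_group N \<Sigma> K) = kernel (ray_torus \<Sigma> K) (torus N K) ?r"
      unfolding G_group_def ray_torus_def torus_def class_group_def ray_class_def[abs_def]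
      by (rule exact_pullback[OF comm_group_ray_lattice M comm_group_units char_to_ray_hom
            principal_def subgroup_principal])
    show "?i (G_group_act N \<Sigma> K k \<phi> g a) = ray_torus_act \<Sigma> K k \<phi> g (?i a)"
      if "g \<in> carrier (Gal K k)" for g a
      unfolding G_group_act_def ray_torus_act_def
      using ray_gmodule cls(1) class_gmodule(2) that
      by (rule pullback_equivariant[where \<alpha> = "\<lambda>g. ray_act \<Sigma> (\<phi> g)" and \<beta> = "\<lambda>g. class_act \<Sigma> (\<phi> g)"])
    show "?r (ray_torus_act \<Sigma> K k \<phi> g p) = torus_act N K k \<phi> g (?r p)"
      if "g \<in> carrier (Gal K k)" for g p
      unfolding torus_act_def ray_torus_act_def
      using char_gmodule char_to_ray_hom char_to_ray_equivariant that
      by (rule pullback_equivariant[where \<alpha> = "\<lambda>g. char_act N (\<phi> g)" and \<beta> = "\<lambda>g. ray_act \<Sigma> (\<phi> g)"])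
    show "\<exists>q\<in>carrier (ray_torus \<Sigma> K).
        p = ray_torus_act \<Sigma> K k \<phi> \<tau> q \<otimes>\<^bsub>ray_torus \<Sigma> K\<^esub> inv\<^bsub>ray_torus \<Sigma> K\<^esub> q"
      if "p \<in> carrier (ray_torus \<Sigma> K)"
        "norm_map (Gal K k) (ray_torus \<Sigma> K) (ray_torus_act \<Sigma> K k \<phi>) p = \<one>\<^bsub>ray_torus \<Sigma> K\<^esub>" for p
      using PC that unfolding ray_torus_def ray_torus_act_def ray_lattice_def
      by (intro hilbert90_permutation_module[where \<pi> = "\<lambda>g \<rho>. \<phi> g ` \<rho>"])
        (simp_all add: finite_rays ray_closed \<phi>_one \<phi>_mult image_comp ray_act_unit_vector)
  qed
  then show ?thesis unfolding norm_quotient_def i .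
qed

end
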